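(* Let $I=[0,1)$, let $\{w_t(k)\}$ be a family of weights (indexed by $t\in(0,1)$ and $k\in\mathbb{S}$, where $\mathbb{S}=\mathbb{N}$ or $\mathbb{S}=\mathbb{Z}$) satisfying Conditions 1–5 of the context, let $\mathcal{H}=\{\mathcal{H}_t : t\in I\}$ be the associated family of Hilbert spaces, and let $\Lambda\subset\prod_{t\in I}\mathcal{H}_t$ be the associated linear subspace (all described in the context). Then $\Lambda$ generates a continuous field of Hilbert spaces $(I,\mathcal{H},\Gamma)$. That is: for every $t\in I$ the set $\{x_t : x\in\Lambda\}$ is dense in $\mathcal{H}_t$; for every $x\in\Lambda$ the function $t\mapsto\|x_t\|_{\mathcal{H}_t}$ is continuous on $I$; and consequently $\Lambda$ extends uniquely to a linear subspace $\Gamma\subset\prod_{t\in I}\mathcal{H}_t$ such that $(I,\mathcal{H},\Gamma)$ is a continuous field of Hilbert spaces.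
   Context: **Continuous fields.** A continuous field of Hilbert spaces is a triple $(\Omega,\mathcal{H},\Gamma)$ where $\Omega$ is a locally compact topological space, $\mathcal{H}=\{H(\omega):\omega\in\Omega\}$ is a family of Hilbert spaces, and $\Gamma$ is a linear subspace of $\prod_{\omega\in\Omega}H(\omega)$ such that: (1) for every $\omega$, $\{x(\omega):x\in\Gamma\}$ is dense in $H(\omega)$; (2) for every $x\in\Gamma$, $\omega\mapsto\|x(\omega)\|$ is continuous; (3) if $x\in\prod_\omega H(\omega)$ is such that for every $\omega_0\in\Omega$ and $\varepsilon>0$ there is $x'\in\Gamma$ with $\|x(\omega)-x'(\omega)\|\le\varepsilon$ for all $\omega$ in some neighborhood of $\omega_0$, then $x\in\Gamma$. A linear subspace $\Lambda\subset\prod_\omega H(\omega)$ satisfying (1) and (2) is said to generate the continuous field $(\Omega,\mathcal{H},\Gamma)$, where $\Gamma$ is the unique extension of $\Lambda$ making this a continuous field (it consists of all sections $x$ such that for all $\omega_0$ and $\varepsilon>0$ there is $x'\in\Lambda$ with $\|x(\omega)-x'(\omega)\|\le\varepsilon$ in a neighborhood of $\omega_0$). **Weights.** $\mathbb{S}=\mathbb{N}=\{0,1,2,\dots\}$ (unilateral or disk case) or $\mathbb{S}=\mathbb{Z}$ (bilateral or annulus case). $\{e_k\}_{k\in\mathbb{S}}$ is the canonical basis of $\ell^2(\mathbb{S})$, $U e_k=e_{k+1}$, and for $t\in(0,1)$, $U_{w_t}e_k=w_t(k)e_{k+1}$. Put $S_t(k)=w_t(k)^2-w_t(k-1)^2$,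 with $w_t(-1):=0$ if $\mathbb{S}=\mathbb{N}$; $S_t=U_{w_t}^*U_{w_t}-U_{w_t}U_{w_t}^*$ is the diagonal operator $S_te_k=S_t(k)e_k$. If $\mathbb{S}=\mathbb{N}$, set $w_-:=0$, and limits $k\to\pm\infty$ below are read as $k\to+\infty$ only (with only $w_+$ involved). The conditions are: Condition 1. For each $t$, $w_t(k)$ is a positive, bounded, strictly increasing sequence in $k$ such that the limits $w_\pm=\lim_{k\to\pm\infty}w_t(k)$ exist, are positive, and do not depend on $t$. Condition 2. For every $k$ the function $t\mapsto w_t(k)$ is continuous, and for every $\varepsilon>0$, $w_t(k)\to w_\pm$ as $k\to\pm\infty$ uniformly in $t\ge\varepsilon$. Condition 3. $h_1(t):=\sup_{k\in\mathbb{S}}S_t(k)\to0$ as $t\to0^+$. Condition 4. $h_2(t):=\sup_{k\in\mathbb{S}}\left|1-\frac{S_t(k+1)}{S_t(k)}\right|$ exists, is a bounded function of $t$, and $h_2(t)\to0$ as $t\to0^+$. Condition 5. $h_3(k):=\sup_{t\in(0,1)}\left|1-\frac{w_t(k-1)}{w_t(k)}\right|$ exists for every $k$ and $h_3(k)\to0$ as $k\to\pm\infty$. **Hilbert spaces.** For $t\in(0,1)$, $\mathcal{H}_t$ is the completion of the $C^*$-algebra $C^*(U_{w_t})$ generated by $U_{w_t}$ with respect to the norm $\|a\|_t^2=\mathrm{tr}(S_t^{1/2}aS_t^{1/2}a^* )$. For $t=0$, $\mathcal{H}_0=L^2(\{z\in\mathbb{C}:|z|\le w_+\})$ if $\mathbb{S}=\mathbb{N}$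 and $\mathcal{H}_0=L^2(\{z\in\mathbb{C}:w_-\le|z|\le w_+\})$ if $\mathbb{S}=\mathbb{Z}$, with respect to $\frac1\pi$ times Lebesgue measure (so $\|f(r^2)e^{in\varphi}\|^2=\int_{(w_-)^2}^{(w_+)^2}|f(r^2)|^2\,d(r^2)$). **The space $\Lambda$.** For a function $F$ on $\mathbb{S}$ we also write $F(k)$ for the diagonal operator $e_k\mapsto F(k)e_k$. $\Lambda$ consists of all $x=\{x_t\}_{t\in I}$ for which there are $N>0$ and $f_n,g_n\in C([(w_-)^2,(w_+)^2])$ (independent of $t$) such that for $t>0$ $$x_t=\sum_{n=0}^NU^nf_n\big(w_t(k)^2\big)+\sum_{n=1}^Ng_n\big(w_t(k)^2\big)(U^* )^n,$$ and for $t=0$, in polar coordinates, $$x_0(r,\varphi)=\sum_{n=0}^Nf_n(r^2)e^{in\varphi}+\sum_{n=1}^Ng_n(r^2)e^{-in\varphi}.$$ *)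

theory Defs
  imports "HOL-Analysis.Analysis"
begin

section \<open>Complex Hilbert spaces with explicit carrier\<close>

text \<open>The fibres of a continuous field are different spaces, so that they are represented as
  records over one common type of vectors. Inner products are linear in the first argument.\<close>

record 'a cspace =
  vecs :: "'a set"
  vzero :: 'a
  vadd :: "'a \<Rightarrow> 'a \<Rightarrow> 'a"
  vscale :: "complex \<Rightarrow> 'a \<Rightarrow> 'a"
  vinner :: "'a \<Rightarrow> 'a \<Rightarrow> complex"

definition vdiff :: "'a cspace \<Rightarrow> 'a \<Rightarrow> 'a \<Rightarrow> 'a" where
  "vdiff V x y = vadd V x (vscale V (- 1) y)"

definition vnorm :: "'a cspace \<Rightarrow> 'a \<Rightarrow> real" where
  "vnorm V x = sqrt (Re (vinner V x x))"

definition vdist :: "'a cspace \<Rightarrow> 'a \<Rightarrow> 'a \<Rightarrow> real" where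
  "vdist V x y = vnorm V (vdiff V x y)"

definition vcauchy :: "'a cspace \<Rightarrow> (nat \<Rightarrow> 'a) \<Rightarrow> bool" where
  "vcauchy V X \<longleftrightarrow> (\<forall>n. X n \<in> vecs V) \<and>
     (\<forall>\<epsilon>>0. \<exists>M. \<forall>m\<ge>M. \<forall>n\<ge>M. vdist V (X m) (X n) < \<epsilon>)"

locale hilbert_space =
  fixes V :: "'a cspace"
  assumes zero_closed: "vzero V \<in> vecs V"
    and add_closed: "\<lbrakk>x \<in> vecs V; y \<in> vecs V\<rbrakk> \<Longrightarrow> vadd V x y \<in> vecs V"
    and scale_closed: "x \<in> vecs V \<Longrightarrow> vscale V c x \<in> vecs V"
    and add_assoc: "\<lbrakk>x \<in> vecs V; y \<in> vecs V; z \<in> vecs V\<rbrakk> \<Longrightarrow>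
      vadd V (vadd V x y) z = vadd V x (vadd V y z)"
    and add_commute: "\<lbrakk>x \<in> vecs V; y \<in> vecs V\<rbrakk> \<Longrightarrow> vadd V x y = vadd V y x"
    and add_zero: "x \<in> vecs V \<Longrightarrow> vadd V x (vzero V) = x"
    and diff_self: "x \<in> vecs V \<Longrightarrow> vdiff V x x = vzero V"
    and scale_add_right: "\<lbrakk>x \<in> vecs V; y \<in> vecs V\<rbrakk> \<Longrightarrow>
      vscale V c (vadd V x y) = vadd V (vscale V c x) (vscale V c y)"
    and scale_add_left: "x \<in> vecs V \<Longrightarrow>
      vscale V (c + d) x = vadd V (vscale V c x) (vscale V d x)"
    and scale_scale: "x \<in> vecs V \<Longrightarrow> vscale V c (vscale V d x) = vscale V (c * d) x"
    and scale_one: "x \<in> vecs V \<Longrightarrow> vscale V 1 x = x"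
    and inner_add: "\<lbrakk>x \<in> vecs V; y \<in> vecs V; z \<in> vecs V\<rbrakk> \<Longrightarrow>
      vinner V (vadd V x y) z = vinner V x z + vinner V y z"
    and inner_scale: "\<lbrakk>x \<in> vecs V; y \<in> vecs V\<rbrakk> \<Longrightarrow> vinner V (vscale V c x) y = c * vinner V x y"
    and inner_cnj: "\<lbrakk>x \<in> vecs V; y \<in> vecs V\<rbrakk> \<Longrightarrow> vinner V x y = cnj (vinner V y x)"
    and inner_nonneg: "x \<in> vecs V \<Longrightarrow> Re (vinner V x x) \<ge> 0"
    and inner_definite: "\<lbrakk>x \<in> vecs V; vinner V x x = 0\<rbrakk> \<Longrightarrow> x = vzero V"
    and complete: "vcauchy V X \<Longrightarrow> \<exists>x\<in>vecs V. (\<lambda>n. vdist V (X n) x) \<longlonglongrightarrow> 0"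

text \<open>Transport of the structure along an injection of the carrier.\<close>

definition transport :: "('a \<Rightarrow> 'b) \<Rightarrow> 'a cspace \<Rightarrow> 'b cspace" where
  "transport \<phi> V = (let \<psi> = inv_into (vecs V) \<phi> in
    \<lparr> vecs = \<phi> ` vecs V,
      vzero = \<phi> (vzero V),
      vadd = (\<lambda>x y. \<phi> (vadd V (\<psi> x) (\<psi> y))),
      vscale = (\<lambda>c x. \<phi> (vscale V c (\<psi> x))),
      vinner = (\<lambda>x y. vinner V (\<psi> x) (\<psi> y)) \<rparr>)"

text \<open>Completion of a pre-Hilbert space: Cauchy sequences modulo null sequences.\<close>

definition cauchy_class :: "'a cspace \<Rightarrow> (nat \<Rightarrow> 'a) \<Rightarrow> (nat \<Rightarrow> 'a) set" where
  "cauchy_class V X = {Y. vcauchy V Y \<and> (\<lambda>n. vdist V (X n) (Y n)) \<longlonglongrightarrow> 0}"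

definition class_rep :: "'b set \<Rightarrow> 'b" where
  "class_rep A = (SOME X. X \<in> A)"

definition hcompletion :: "'a cspace \<Rightarrow> (nat \<Rightarrow> 'a) set cspace" where
  "hcompletion V =
    \<lparr> vecs = cauchy_class V ` {X. vcauchy V X},
      vzero = cauchy_class V (\<lambda>_. vzero V),
      vadd = (\<lambda>A B. cauchy_class V (\<lambda>n. vadd V (class_rep A n) (class_rep B n))),
      vscale = (\<lambda>c A. cauchy_class V (\<lambda>n. vscale V c (class_rep A n))),
      vinner = (\<lambda>A B. lim (\<lambda>n. vinner V (class_rep A n) (class_rep B n))) \<rparr>"

definition embed :: "'a cspace \<Rightarrow> 'a \<Rightarrow> (nat \<Rightarrow> 'a) set" where
  "embed V a = cauchy_class V (\<lambda>_. a)"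

text \<open>The space $L^2$ of a measure: square integrable functions modulo equality almost
  everywhere.\<close>

definition square_integrable :: "'a measure \<Rightarrow> ('a \<Rightarrow> complex) \<Rightarrow> bool" where
  "square_integrable M f \<longleftrightarrow> f \<in> borel_measurable M \<and> integrable M (\<lambda>z. (cmod (f z))\<^sup>2)"

definition ae_class :: "'a measure \<Rightarrow> ('a \<Rightarrow> complex) \<Rightarrow> ('a \<Rightarrow> complex) set" where
  "ae_class M f = {g \<in> borel_measurable M. AE z in M. f z = g z}"

definition L2 :: "'a measure \<Rightarrow> ('a \<Rightarrow> complex) set cspace" where
  "L2 M =
    \<lparr> vecs = ae_class M ` {f. square_integrable M f},
      vzero = ae_class M (\<lambda>_. 0),
      vadd = (\<lambda>A B. ae_class M (\<lambda>z. class_rep A z + class_rep B z)),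
      vscale = (\<lambda>c A. ae_class M (\<lambda>z. c * class_rep A z)),
      vinner = (\<lambda>A B. \<integral>z. class_rep A z * cnj (class_rep B z) \<partial>M) \<rparr>"


section \<open>Continuous fields of Hilbert spaces\<close>

text \<open>Sections are extensional functions on the base space, so that the sets of sections below
  are literally subsets of the product of the fibres.\<close>

definition section_subspace ::
    "'o topology \<Rightarrow> ('o \<Rightarrow> 'a cspace) \<Rightarrow> ('o \<Rightarrow> 'a) set \<Rightarrow> bool" where
  "section_subspace \<Omega> H \<Lambda> \<longleftrightarrow>
     \<Lambda> \<subseteq> (\<Pi>\<^sub>E \<omega>\<in>topspace \<Omega>. vecs (H \<omega>)) \<and>
     (\<lambda>\<omega>\<in>topspace \<Omega>. vzero (H \<omega>)) \<in> \<Lambda> \<and>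
     (\<forall>x\<in>\<Lambda>. \<forall>y\<in>\<Lambda>. (\<lambda>\<omega>\<in>topspace \<Omega>. vadd (H \<omega>) (x \<omega>) (y \<omega>)) \<in> \<Lambda>) \<and>
     (\<forall>c. \<forall>x\<in>\<Lambda>. (\<lambda>\<omega>\<in>topspace \<Omega>. vscale (H \<omega>) c (x \<omega>)) \<in> \<Lambda>)"

definition fibrewise_dense ::
    "'o topology \<Rightarrow> ('o \<Rightarrow> 'a cspace) \<Rightarrow> ('o \<Rightarrow> 'a) set \<Rightarrow> bool" where
  "fibrewise_dense \<Omega> H \<Lambda> \<longleftrightarrow>
     (\<forall>\<omega>\<in>topspace \<Omega>. \<forall>v\<in>vecs (H \<omega>). \<forall>\<epsilon>>0. \<exists>x\<in>\<Lambda>. vdist (H \<omega>) (x \<omega>) v < \<epsilon>)"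

definition norm_continuous ::
    "'o topology \<Rightarrow> ('o \<Rightarrow> 'a cspace) \<Rightarrow> ('o \<Rightarrow> 'a) set \<Rightarrow> bool" where
  "norm_continuous \<Omega> H \<Lambda> \<longleftrightarrow>
     (\<forall>x\<in>\<Lambda>. continuous_map \<Omega> euclideanreal (\<lambda>\<omega>. vnorm (H \<omega>) (x \<omega>)))"

definition locally_approximable ::
    "'o topology \<Rightarrow> ('o \<Rightarrow> 'a cspace) \<Rightarrow> ('o \<Rightarrow> 'a) set \<Rightarrow> ('o \<Rightarrow> 'a) \<Rightarrow> bool" where
  "locally_approximable \<Omega> H \<Lambda> x \<longleftrightarrow>
     (\<forall>\<omega>\<^sub>0\<in>topspace \<Omega>. \<forall>\<epsilon>>0. \<exists>x'\<in>\<Lambda>. \<exists>W. openin \<Omega> W \<and> \<omega>\<^sub>0 \<in> W \<and>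
        (\<forall>\<omega>\<in>W. vdist (H \<omega>) (x \<omega>) (x' \<omega>) \<le> \<epsilon>))"

definition continuous_field ::
    "'o topology \<Rightarrow> ('o \<Rightarrow> 'a cspace) \<Rightarrow> ('o \<Rightarrow> 'a) set \<Rightarrow> bool" where
  "continuous_field \<Omega> H \<Gamma> \<longleftrightarrow>
     locally_compact_space \<Omega> \<and>
     (\<forall>\<omega>\<in>topspace \<Omega>. hilbert_space (H \<omega>)) \<and>
     section_subspace \<Omega> H \<Gamma> \<and>
     fibrewise_dense \<Omega> H \<Gamma> \<and>
     norm_continuous \<Omega> H \<Gamma> \<and>
     (\<forall>x \<in> (\<Pi>\<^sub>E \<omega>\<in>topspace \<Omega>. vecs (H \<omega>)). locally_approximable \<Omega> H \<Gamma> x \<longrightarrow> x \<in> \<Gamma>)"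


section \<open>Bounded operators and generated C*-algebras\<close>

definition bounded_ops :: "'a cspace \<Rightarrow> ('a \<Rightarrow> 'a) set" where
  "bounded_ops V = {A \<in> vecs V \<rightarrow>\<^sub>E vecs V.
     (\<forall>x\<in>vecs V. \<forall>y\<in>vecs V. A (vadd V x y) = vadd V (A x) (A y)) \<and>
     (\<forall>c. \<forall>x\<in>vecs V. A (vscale V c x) = vscale V c (A x)) \<and>
     (\<exists>C. \<forall>x\<in>vecs V. vnorm V (A x) \<le> C * vnorm V x)}"

definition op_zero :: "'a cspace \<Rightarrow> 'a \<Rightarrow> 'a" where
  "op_zero V = (\<lambda>x\<in>vecs V. vzero V)"

definition op_add :: "'a cspace \<Rightarrow> ('a \<Rightarrow> 'a) \<Rightarrow> ('a \<Rightarrow> 'a) \<Rightarrow> 'a \<Rightarrow> 'a" where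
  "op_add V A B = (\<lambda>x\<in>vecs V. vadd V (A x) (B x))"

definition op_scale :: "'a cspace \<Rightarrow> complex \<Rightarrow> ('a \<Rightarrow> 'a) \<Rightarrow> 'a \<Rightarrow> 'a" where
  "op_scale V c A = (\<lambda>x\<in>vecs V. vscale V c (A x))"

abbreviation op_mult :: "'a cspace \<Rightarrow> ('a \<Rightarrow> 'a) \<Rightarrow> ('a \<Rightarrow> 'a) \<Rightarrow> 'a \<Rightarrow> 'a" where
  "op_mult V A B \<equiv> compose (vecs V) A B"

primrec op_pow :: "'a cspace \<Rightarrow> ('a \<Rightarrow> 'a) \<Rightarrow> nat \<Rightarrow> 'a \<Rightarrow> 'a" where
  "op_pow V A 0 = (\<lambda>x\<in>vecs V. x)"
| "op_pow V A (Suc n) = op_mult V A (op_pow V A n)"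

definition op_adj :: "'a cspace \<Rightarrow> ('a \<Rightarrow> 'a) \<Rightarrow> 'a \<Rightarrow> 'a" where
  "op_adj V A = (THE B. B \<in> bounded_ops V \<and>
     (\<forall>x\<in>vecs V. \<forall>y\<in>vecs V. vinner V (A x) y = vinner V x (B y)))"

text \<open>The last conjunct is closedness in operator norm: the bound on $(A - B)x$ says that the
  operator norm of $A - B$ is at most $\varepsilon$.\<close>

definition cstar_subalgebra :: "'a cspace \<Rightarrow> ('a \<Rightarrow> 'a) set \<Rightarrow> bool" where
  "cstar_subalgebra V \<A> \<longleftrightarrow>
     \<A> \<subseteq> bounded_ops V \<and>
     op_zero V \<in> \<A> \<and>
     (\<forall>A\<in>\<A>. \<forall>B\<in>\<A>. op_add V A B \<in> \<A>) \<and>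
     (\<forall>c. \<forall>A\<in>\<A>. op_scale V c A \<in> \<A>) \<and>
     (\<forall>A\<in>\<A>. \<forall>B\<in>\<A>. op_mult V A B \<in> \<A>) \<and>
     (\<forall>A\<in>\<A>. op_adj V A \<in> \<A>) \<and>
     (\<forall>A\<in>bounded_ops V.
        (\<forall>\<epsilon>>0. \<exists>B\<in>\<A>. \<forall>x\<in>vecs V. vdist V (A x) (B x) \<le> \<epsilon> * vnorm V x) \<longrightarrow> A \<in> \<A>)"

definition cstar_generated :: "'a cspace \<Rightarrow> ('a \<Rightarrow> 'a) \<Rightarrow> ('a \<Rightarrow> 'a) set" where
  "cstar_generated V A = \<Inter>{\<A>. cstar_subalgebra V \<A> \<and> A \<in> \<A>}"


section \<open>Weighted shifts\<close>

text \<open>Throughout, \<open>S\<close> is the index set, \<open>{0..}\<close> or \<open>UNIV\<close>, as a set of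
  integers. Sequences over \<open>S\<close> are functions on all integers that vanish outside \<open>S\<close>; the
  values of weights outside \<open>S\<close> are irrelevant.\<close>

definition ell2 :: "int set \<Rightarrow> (int \<Rightarrow> complex) cspace" where
  "ell2 S =
    \<lparr> vecs = {x. (\<forall>k. k \<notin> S \<longrightarrow> x k = 0) \<and> (\<lambda>k. (cmod (x k))\<^sup>2) summable_on S},
      vzero = (\<lambda>_. 0),
      vadd = (\<lambda>x y k. x k + y k),
      vscale = (\<lambda>c x k. c * x k),
      vinner = (\<lambda>x y. \<Sum>\<^sub>\<infinity>k\<in>S. x k * cnj (y k)) \<rparr>"

definition basis_vec :: "int \<Rightarrow> int \<Rightarrow> complex" where
  "basis_vec k = (\<lambda>j. if j = k then 1 else 0)"

definition diag_op :: "int set \<Rightarrow> (int \<Rightarrow> complex) \<Rightarrow> (int \<Rightarrow> complex) \<Rightarrow> int \<Rightarrow> complex" where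
  "diag_op S F = (\<lambda>x\<in>vecs (ell2 S). \<lambda>k. F k * x k)"

text \<open>The shift maps \<open>basis_vec k\<close> to \<open>basis_vec (k + 1)\<close>; for \<open>S = {0..}\<close> the
  value at \<open>0\<close> of the image is \<open>x (- 1) = 0\<close>.\<close>

definition shift_op :: "int set \<Rightarrow> (int \<Rightarrow> complex) \<Rightarrow> int \<Rightarrow> complex" where
  "shift_op S = (\<lambda>x\<in>vecs (ell2 S). \<lambda>k. x (k - 1))"

definition weighted_shift :: "int set \<Rightarrow> (int \<Rightarrow> real) \<Rightarrow> (int \<Rightarrow> complex) \<Rightarrow> int \<Rightarrow> complex" where
  "weighted_shift S v = (\<lambda>x\<in>vecs (ell2 S). \<lambda>k. of_real (v (k - 1)) * x (k - 1))"

definition op_trace :: "int set \<Rightarrow> ((int \<Rightarrow> complex) \<Rightarrow> int \<Rightarrow> complex) \<Rightarrow> complex" where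
  "op_trace S A = (\<Sum>\<^sub>\<infinity>k\<in>S. vinner (ell2 S) (A (basis_vec k)) (basis_vec k))"

text \<open>The weight \<open>v\<close> with the convention that its value at \<open>- 1\<close> is \<open>0\<close> if
  \<open>S = {0..}\<close>.\<close>

definition weight_ext :: "int set \<Rightarrow> (int \<Rightarrow> real) \<Rightarrow> int \<Rightarrow> real" where
  "weight_ext S v k = (if k \<in> S then v k else 0)"

definition weight_diff :: "int set \<Rightarrow> (int \<Rightarrow> real) \<Rightarrow> int \<Rightarrow> real" where
  "weight_diff S v k = (weight_ext S v k)\<^sup>2 - (weight_ext S v (k - 1))\<^sup>2"


section \<open>The conditions on the weights\<close>

definition condition1 :: "int set \<Rightarrow> (real \<Rightarrow> int \<Rightarrow> real) \<Rightarrow> real \<Rightarrow> real \<Rightarrow> bool" where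
  "condition1 S w wm wp \<longleftrightarrow>
     (\<forall>t\<in>{0<..<1}. (\<forall>k\<in>S. w t k > 0) \<and> bounded (w t ` S) \<and> strict_mono_on S (w t) \<and>
        (w t \<longlongrightarrow> wp) at_top \<and> (S = UNIV \<longrightarrow> (w t \<longlongrightarrow> wm) at_bot)) \<and>
     wp > 0 \<and> (if S = UNIV then wm > 0 else wm = 0)"

definition condition2 :: "int set \<Rightarrow> (real \<Rightarrow> int \<Rightarrow> real) \<Rightarrow> real \<Rightarrow> real \<Rightarrow> bool" where
  "condition2 S w wm wp \<longleftrightarrow>
     (\<forall>k\<in>S. continuous_on {0<..<1} (\<lambda>t. w t k)) \<and>
     (\<forall>\<epsilon>>0. uniform_limit {\<epsilon>..<1} (\<lambda>k t. w t k) (\<lambda>_. wp) at_top \<and>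
        (S = UNIV \<longrightarrow> uniform_limit {\<epsilon>..<1} (\<lambda>k t. w t k) (\<lambda>_. wm) at_bot))"

definition h1 :: "int set \<Rightarrow> (real \<Rightarrow> int \<Rightarrow> real) \<Rightarrow> real \<Rightarrow> real" where
  "h1 S w t = (SUP k\<in>S. weight_diff S (w t) k)"

definition h2 :: "int set \<Rightarrow> (real \<Rightarrow> int \<Rightarrow> real) \<Rightarrow> real \<Rightarrow> real" where
  "h2 S w t = (SUP k\<in>S. \<bar>1 - weight_diff S (w t) (k + 1) / weight_diff S (w t) k\<bar>)"

definition h3 :: "int set \<Rightarrow> (real \<Rightarrow> int \<Rightarrow> real) \<Rightarrow> int \<Rightarrow> real" where
  "h3 S w k = (SUP t\<in>{0<..<1}. \<bar>1 - weight_ext S (w t) (k - 1) / weight_ext S (w t) k\<bar>)"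

definition condition3 :: "int set \<Rightarrow> (real \<Rightarrow> int \<Rightarrow> real) \<Rightarrow> bool" where
  "condition3 S w \<longleftrightarrow> (h1 S w \<longlongrightarrow> 0) (at_right 0)"

text \<open>Existence of a supremum means that the supremum is finite, that is, \<open>bdd_above\<close>; for
  \<open>h1\<close> this is automatic as the weights are bounded.\<close>

definition condition4 :: "int set \<Rightarrow> (real \<Rightarrow> int \<Rightarrow> real) \<Rightarrow> bool" where
  "condition4 S w \<longleftrightarrow>
     (\<forall>t\<in>{0<..<1}.
        bdd_above ((\<lambda>k. \<bar>1 - weight_diff S (w t) (k + 1) / weight_diff S (w t) k\<bar>) ` S)) \<and>
     bounded (h2 S w ` {0<..<1}) \<and>
     (h2 S w \<longlongrightarrow> 0) (at_right 0)"

definition condition5 :: "int set \<Rightarrow> (real \<Rightarrow> int \<Rightarrow> real) \<Rightarrow> bool" where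
  "condition5 S w \<longleftrightarrow>
     (\<forall>k\<in>S. bdd_above
        ((\<lambda>t. \<bar>1 - weight_ext S (w t) (k - 1) / weight_ext S (w t) k\<bar>) ` {0<..<1})) \<and>
     (h3 S w \<longlongrightarrow> 0) at_top \<and> (S = UNIV \<longrightarrow> (h3 S w \<longlongrightarrow> 0) at_bot)"


section \<open>The Hilbert spaces and the space of sections\<close>

definition sqrt_S :: "int set \<Rightarrow> (int \<Rightarrow> real) \<Rightarrow> (int \<Rightarrow> complex) \<Rightarrow> int \<Rightarrow> complex" where
  "sqrt_S S v = diag_op S (\<lambda>k. of_real (sqrt (weight_diff S v k)))"

text \<open>The C*-algebra generated by the weighted shift, with the inner product
  $\mathrm{tr}(S_t^{1/2} a S_t^{1/2} b^*)$, whose norm is the one of the completion.\<close>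

definition quantum_pre ::
    "int set \<Rightarrow> (int \<Rightarrow> real) \<Rightarrow> ((int \<Rightarrow> complex) \<Rightarrow> int \<Rightarrow> complex) cspace" where
  "quantum_pre S v = (let V = ell2 S; R = sqrt_S S v in
    \<lparr> vecs = cstar_generated V (weighted_shift S v),
      vzero = op_zero V,
      vadd = op_add V,
      vscale = op_scale V,
      vinner = (\<lambda>a b. op_trace S (op_mult V R (op_mult V a (op_mult V R (op_adj V b))))) \<rparr>)"

definition disk_measure :: "real \<Rightarrow> real \<Rightarrow> complex measure" where
  "disk_measure wm wp =
     scale_measure (ennreal (1 / pi)) (lebesgue_on {z. wm \<le> cmod z \<and> cmod z \<le> wp})"

text \<open>The fibre at \<open>0\<close> and the other fibres are tagged by \<open>Inl\<close> and \<open>Inr\<close> only to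
  obtain a common type of vectors.\<close>

type_synonym fibre_vec =
  "(complex \<Rightarrow> complex) set + (nat \<Rightarrow> (int \<Rightarrow> complex) \<Rightarrow> int \<Rightarrow> complex) set"

definition fibre ::
    "int set \<Rightarrow> (real \<Rightarrow> int \<Rightarrow> real) \<Rightarrow> real \<Rightarrow> real \<Rightarrow> real \<Rightarrow> fibre_vec cspace" where
  "fibre S w wm wp t =
     (if t = 0 then transport Inl (L2 (disk_measure wm wp))
      else transport Inr (hcompletion (quantum_pre S (w t))))"

definition classical_poly ::
    "nat \<Rightarrow> (nat \<Rightarrow> real \<Rightarrow> complex) \<Rightarrow> (nat \<Rightarrow> real \<Rightarrow> complex) \<Rightarrow> complex \<Rightarrow> complex" where
  "classical_poly N f g z =
     (\<Sum>n=0..N. f n ((cmod z)\<^sup>2) * cis (real n * Arg z)) +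
     (\<Sum>n=1..N. g n ((cmod z)\<^sup>2) * cis (- real n * Arg z))"

definition quantum_poly ::
    "int set \<Rightarrow> (int \<Rightarrow> real) \<Rightarrow> nat \<Rightarrow> (nat \<Rightarrow> real \<Rightarrow> complex) \<Rightarrow> (nat \<Rightarrow> real \<Rightarrow> complex) \<Rightarrow>
      (int \<Rightarrow> complex) \<Rightarrow> int \<Rightarrow> complex" where
  "quantum_poly S v N f g = (let V = ell2 S; U = shift_op S in
     (\<lambda>x\<in>vecs V. \<lambda>k.
       (\<Sum>n=0..N. op_mult V (op_pow V U n) (diag_op S (\<lambda>j. f n ((v j)\<^sup>2))) x k) +
       (\<Sum>n=1..N. op_mult V (diag_op S (\<lambda>j. g n ((v j)\<^sup>2))) (op_pow V (op_adj V U) n) x k)))"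

definition Lambda_sections ::
    "int set \<Rightarrow> (real \<Rightarrow> int \<Rightarrow> real) \<Rightarrow> real \<Rightarrow> real \<Rightarrow> (real \<Rightarrow> fibre_vec) set" where
  "Lambda_sections S w wm wp =
     {x. \<exists>N f g. N > 0 \<and>
        (\<forall>n\<le>N. continuous_on {wm\<^sup>2..wp\<^sup>2} (f n)) \<and>
        (\<forall>n\<in>{1..N}. continuous_on {wm\<^sup>2..wp\<^sup>2} (g n)) \<and>
        x = (\<lambda>t\<in>{0..<1}.
           if t = 0 then Inl (ae_class (disk_measure wm wp) (classical_poly N f g))
           else Inr (embed (quantum_pre S (w t)) (quantum_poly S (w t) N f g)))}"

end

theory Submission
  imports Defs
begin

text \<open>
  Each fibre norm is computed explicitly. For \<open>t > 0\<close>, the matrix entries \<open>a k j\<close> of a bounded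
  operator satisfy \<open>\<parallel>a\<parallel>\<^sup>2 = (\<Sum>k j. s k * s j * \<bar>a k j\<bar>\<^sup>2)\<close> with \<open>s = S\<^sub>t powr (1/2)\<close>. Two
  consequences: finite matrices are dense, and they lie in \<open>\<Lambda>\<close> because each \<open>w\<^sub>t(k)\<^sup>2\<close> is isolated
  in the spectrum; and a section in \<open>\<Lambda>\<close>, whose entry on the diagonal \<open>d = k - j\<close> is
  \<open>c d (w\<^sub>t(min k j)\<^sup>2)\<close>, has squared norm \<open>\<Sum>d. \<Sum>m. s m * s (m + \<bar>d\<bar>) * \<bar>c d (w\<^sub>t(m)\<^sup>2)\<bar>\<^sup>2\<close>. The tails of
  this series telescope, so by condition 2 it converges locally uniformly in \<open>t > 0\<close>. As \<open>t\<close> tends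
  to \<open>0\<close>, condition 4 replaces \<open>s m * s (m + \<bar>d\<bar>)\<close> by \<open>S\<^sub>t(m)\<close>, which turns the series into a Riemann
  sum, of mesh tending to \<open>0\<close> by condition 3, for \<open>\<integral>\<bar>c d\<bar>\<^sup>2\<close> over the interval from \<open>w\<^sub>-\<^sup>2\<close> to \<open>w\<^sub>+\<^sup>2\<close>.
  In polar coordinates the latter integrals add up to the squared norm in the classical fibre.
\<close>

text \<open>Two facts are needed before any norm can be computed. The double series for the trace
  form has to converge for every bounded operator: \<open>s k * s j\<close> is at most half of
  \<open>S_t(k) + S_t(j)\<close>, so the rows and columns of the matrix control it, and the
  differences \<open>S_t(k)\<close> have a finite sum. And the components of a section, written with
  the unweighted shift, have to lie in the algebra generated by the weighted shift. That algebra is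
  not assumed to contain the identity, but the squared weights stay above a positive number
  \<open>lo\<close>, so that the shift can be recovered as the polar part of the weighted shift. In
  the disk case \<open>wm = 0\<close>, hence \<open>lo\<close> is \<open>w_t(0)^2\<close> and
  depends on \<open>t\<close>, whereas the coefficients live on one fixed interval. Unilateral and
  bilateral shifts are treated together by extending the weights by 0 below the index set: the
  squared weights \<open>E\<close> then run from \<open>wm^2\<close> to \<open>wp^2\<close> over all
  integers in both cases. Condition 2 is uniform only away from \<open>t = 0\<close>; this is why
  the limit at 0 takes a different argument from continuity at positive \<open>t\<close>.\<close>

text \<open>Definiteness is left out on purpose: the completion identifies vectors at distance \<open>0\<close>, so
  that the trace form need not be shown to be faithful on the generated C*-algebra.\<close>

locale pre_hilbert =
  fixes V :: "'a cspace"
  assumes zero_closed: "vzero V \<in> vecs V"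
    and add_closed: "\<lbrakk>x \<in> vecs V; y \<in> vecs V\<rbrakk> \<Longrightarrow> vadd V x y \<in> vecs V"
    and scale_closed: "x \<in> vecs V \<Longrightarrow> vscale V c x \<in> vecs V"
    and add_assoc: "\<lbrakk>x \<in> vecs V; y \<in> vecs V; z \<in> vecs V\<rbrakk> \<Longrightarrow>
      vadd V (vadd V x y) z = vadd V x (vadd V y z)"
    and add_commute: "\<lbrakk>x \<in> vecs V; y \<in> vecs V\<rbrakk> \<Longrightarrow> vadd V x y = vadd V y x"
    and add_zero: "x \<in> vecs V \<Longrightarrow> vadd V x (vzero V) = x"
    and diff_self: "x \<in> vecs V \<Longrightarrow> vdiff V x x = vzero V"
    and scale_add_right: "\<lbrakk>x \<in> vecs V; y \<in> vecs V\<rbrakk> \<Longrightarrow>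
      vscale V c (vadd V x y) = vadd V (vscale V c x) (vscale V c y)"
    and scale_add_left: "x \<in> vecs V \<Longrightarrow>
      vscale V (c + d) x = vadd V (vscale V c x) (vscale V d x)"
    and scale_scale: "x \<in> vecs V \<Longrightarrow> vscale V c (vscale V d x) = vscale V (c * d) x"
    and scale_one: "x \<in> vecs V \<Longrightarrow> vscale V 1 x = x"
    and inner_add: "\<lbrakk>x \<in> vecs V; y \<in> vecs V; z \<in> vecs V\<rbrakk> \<Longrightarrow>
      vinner V (vadd V x y) z = vinner V x z + vinner V y z"
    and inner_scale: "\<lbrakk>x \<in> vecs V; y \<in> vecs V\<rbrakk> \<Longrightarrow> vinner V (vscale V c x) y = c * vinner V x y"
    and inner_cnj: "\<lbrakk>x \<in> vecs V; y \<in> vecs V\<rbrakk> \<Longrightarrow> vinner V x y = cnj (vinner V y x)"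
    and inner_nonneg: "x \<in> vecs V \<Longrightarrow> Re (vinner V x x) \<ge> 0"

text \<open>Separates the two axioms that a completion creates, so that the estimates below are
  proved once and serve the algebra and its completion alike.\<close>

lemma hilbert_space_iff:
  "hilbert_space V \<longleftrightarrow> pre_hilbert V \<and>
     (\<forall>x\<in>vecs V. vinner V x x = 0 \<longrightarrow> x = vzero V) \<and>
     (\<forall>X. vcauchy V X \<longrightarrow> (\<exists>x\<in>vecs V. (\<lambda>n. vdist V (X n) x) \<longlonglongrightarrow> 0))"
  unfolding hilbert_space_def pre_hilbert_def by (simp add: Ball_def)

section \<open>Inner products, norms and distances without definiteness\<close>

context pre_hilbert
begin

lemma inner_add_right:
  assumes "x \<in> vecs V" "y \<in> vecs V" "z \<in> vecs V"
  shows "vinner V z (vadd V x y) = vinner V z x + vinner V z y"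
  using assms inner_cnj[of z "vadd V x y"] inner_cnj[of z x] inner_cnj[of z y]
  by (simp add: add_closed inner_add)

lemma inner_scale_right:
  assumes "x \<in> vecs V" "z \<in> vecs V"
  shows "vinner V z (vscale V c x) = cnj c * vinner V z x"
  using assms inner_cnj[of z "vscale V c x"] inner_cnj[of z x]
  by (simp add: scale_closed inner_scale)

lemma diff_closed: "\<lbrakk>x \<in> vecs V; y \<in> vecs V\<rbrakk> \<Longrightarrow> vdiff V x y \<in> vecs V"
  by (simp add: vdiff_def add_closed scale_closed)

lemma inner_diff:
  "\<lbrakk>x \<in> vecs V; y \<in> vecs V; z \<in> vecs V\<rbrakk> \<Longrightarrow>
     vinner V (vdiff V x y) z = vinner V x z - vinner V y z"
  by (simp add: vdiff_def inner_add inner_scale scale_closed)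

lemma inner_diff_right:
  "\<lbrakk>x \<in> vecs V; y \<in> vecs V; z \<in> vecs V\<rbrakk> \<Longrightarrow>
     vinner V z (vdiff V x y) = vinner V z x - vinner V z y"
  by (simp add: vdiff_def inner_add_right inner_scale_right scale_closed)

lemmas inner_simps =
  add_closed scale_closed diff_closed inner_add inner_add_right inner_scale inner_scale_right
  inner_diff inner_diff_right

lemma scale_zero: "x \<in> vecs V \<Longrightarrow> vscale V 0 x = vzero V"
  using scale_add_left[of x 1 "-1"] diff_self[of x] scale_one[of x] by (simp add: vdiff_def)

lemma inner_zero: "x \<in> vecs V \<Longrightarrow> vinner V (vzero V) x = 0"
  using inner_scale[of "vzero V" x 0] scale_zero[of "vzero V"] zero_closed by simp

lemma inner_zero_right: "x \<in> vecs V \<Longrightarrow> vinner V x (vzero V) = 0"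
  using inner_cnj[of x "vzero V"] inner_zero[of x] zero_closed by simp

lemma norm_nonneg: "x \<in> vecs V \<Longrightarrow> 0 \<le> vnorm V x"
  by (simp add: vnorm_def inner_nonneg)

lemma norm_sq: "x \<in> vecs V \<Longrightarrow> (vnorm V x)\<^sup>2 = Re (vinner V x x)"
  by (simp add: vnorm_def inner_nonneg)

lemma inner_self: "x \<in> vecs V \<Longrightarrow> vinner V x x = of_real ((vnorm V x)\<^sup>2)"
  using inner_cnj[of x x] norm_sq[of x] by (simp add: complex_eq_iff)

text \<open>Subtracting from \<open>x\<close> the multiple \<open>s * vinner V x y\<close> of
  \<open>y\<close> has the right phase: the squared norm of the difference is a real quadratic in
  \<open>s\<close>, whose nonnegativity is used at a single value of \<open>s\<close>.\<close>

lemma Cauchy_Schwarz: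
  assumes x: "x \<in> vecs V" and y: "y \<in> vecs V"
  shows "cmod (vinner V x y) \<le> vnorm V x * vnorm V y"
proof -
  define p where "p = (cmod (vinner V x y))\<^sup>2"
  define a where "a = (vnorm V x)\<^sup>2"
  define b where "b = (vnorm V y)\<^sup>2"
  have ineq: "0 \<le> a - 2 * s * p + s\<^sup>2 * p * b" for s :: real
  proof -
    define c where "c = of_real s * vinner V x y"
    have "0 \<le> Re (vinner V (vdiff V x (vscale V c y)) (vdiff V x (vscale V c y)))"
      using x y by (intro inner_nonneg) (simp add: inner_simps)
    also have "vinner V (vdiff V x (vscale V c y)) (vdiff V x (vscale V c y)) =
        vinner V x x - cnj c * vinner V x y - c * cnj (vinner V x y) + c * cnj c * vinner V y y"
      using x y inner_cnj[of y x] by (simp add: inner_simps algebra_simps)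
    also have "\<dots> = of_real a - 2 * of_real s * (vinner V x y * cnj (vinner V x y))
        + (of_real s)\<^sup>2 * (vinner V x y * cnj (vinner V x y)) * of_real b"
      by (simp add: inner_self[OF x] inner_self[OF y] a_def b_def c_def power2_eq_square)
    also have "\<dots> = of_real (a - 2 * s * p + s\<^sup>2 * p * b)"
    proof -
      have "vinner V x y * cnj (vinner V x y) = of_real p"
        unfolding p_def by (simp only: complex_norm_square)
      then show ?thesis by simp
    qed
    finally show ?thesis by simp
  qed
  have "p \<le> a * b"
  \<comment> \<open>Norm 0 does not force \<open>y\<close> to be the zero vector here. The
    inequality is then linear in \<open>s\<close>, and the value of \<open>s\<close> chosen below
    turns its right-hand side into -1.\<close>
  proof (cases "b = 0")
    case True
    have "p = 0"
    proof (rule ccontr)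
      assume "p \<noteq> 0"
      then show False using ineq[of "(a + 1) / (2 * p)"] True by simp
    qed
    then show ?thesis using True by simp
  next
    case False
    then have "b > 0" by (simp add: b_def)
    \<comment> \<open>The minimizer of the quadratic.\<close>
    then show ?thesis using ineq[of "1 / b"] by (simp add: field_simps power2_eq_square)
  qed
  then have "(cmod (vinner V x y))\<^sup>2 \<le> (vnorm V x * vnorm V y)\<^sup>2"
    by (simp add: p_def a_def b_def power_mult_distrib)
  then show ?thesis
    by (rule power2_le_imp_le) (simp add: norm_nonneg x y)
qed

lemma norm_scale: "x \<in> vecs V \<Longrightarrow> vnorm V (vscale V c x) = cmod c * vnorm V x"
proof -
  assume x: "x \<in> vecs V"
  have "(vnorm V (vscale V c x))\<^sup>2 = Re (c * cnj c * of_real ((vnorm V x)\<^sup>2))"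
    using x by (simp add: algebra_simps norm_sq[OF scale_closed[OF x]] inner_simps inner_self[OF x])
  also have "c * cnj c = of_real ((cmod c)\<^sup>2)" by (simp only: complex_norm_square)
  also have "Re (of_real ((cmod c)\<^sup>2) * of_real ((vnorm V x)\<^sup>2)) = (cmod c * vnorm V x)\<^sup>2"
    by (simp add: power_mult_distrib)
  finally show ?thesis
    using x by (simp add: norm_nonneg scale_closed power2_eq_iff_nonneg)
qed

lemma norm_triangle:
  assumes "x \<in> vecs V" "y \<in> vecs V"
  shows "vnorm V (vadd V x y) \<le> vnorm V x + vnorm V y"
proof -
  have "(vnorm V (vadd V x y))\<^sup>2 = (vnorm V x)\<^sup>2 + (vnorm V y)\<^sup>2 + 2 * Re (vinner V x y)"
    using assms inner_cnj[of y x] by (simp add: norm_sq inner_simps)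
  also have "\<dots> \<le> (vnorm V x)\<^sup>2 + (vnorm V y)\<^sup>2 + 2 * (vnorm V x * vnorm V y)"
    using Cauchy_Schwarz[OF assms] complex_Re_le_cmod[of "vinner V x y"] by simp
  also have "\<dots> = (vnorm V x + vnorm V y)\<^sup>2" by (simp add: power2_eq_square algebra_simps)
  finally show ?thesis
    by (rule power2_le_imp_le) (simp add: norm_nonneg assms)
qed

text \<open>All vector space laws carry membership side conditions, which makes rearranging vectors
  laborious. Equality of expanded inner products is enough for the distance identities
  below.\<close>

lemma norm_eqI:
  assumes "x \<in> vecs V" "y \<in> vecs V" "vinner V x x = vinner V y y"
  shows "vnorm V x = vnorm V y"
  using assms by (simp add: vnorm_def)

lemma dist_nonneg: "\<lbrakk>x \<in> vecs V; y \<in> vecs V\<rbrakk> \<Longrightarrow> 0 \<le> vdist V x y"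
  by (simp add: vdist_def norm_nonneg diff_closed)

lemma norm_zero: "vnorm V (vzero V) = 0"
  by (simp add: vnorm_def inner_zero zero_closed)

lemma dist_self: "x \<in> vecs V \<Longrightarrow> vdist V x x = 0"
  by (simp add: vdist_def diff_self norm_zero)

lemma dist_commute: "\<lbrakk>x \<in> vecs V; y \<in> vecs V\<rbrakk> \<Longrightarrow> vdist V x y = vdist V y x"
  unfolding vdist_def by (rule norm_eqI) (simp_all add: inner_simps)

lemma dist_zero: "x \<in> vecs V \<Longrightarrow> vdist V x (vzero V) = vnorm V x"
  unfolding vdist_def
  by (rule norm_eqI) (simp_all add: inner_simps inner_zero inner_zero_right zero_closed)

lemma dist_triangle:
  assumes "x \<in> vecs V" "y \<in> vecs V" "z \<in> vecs V"
  shows "vdist V x z \<le> vdist V x y + vdist V y z"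
proof -
  have "vdist V x z = vnorm V (vadd V (vdiff V x y) (vdiff V y z))"
    unfolding vdist_def using assms by (intro norm_eqI) (simp_all add: inner_simps)
  also have "\<dots> \<le> vdist V x y + vdist V y z"
    unfolding vdist_def using assms by (intro norm_triangle) (simp_all add: inner_simps)
  finally show ?thesis .
qed

lemma dist_add:
  assumes "x \<in> vecs V" "y \<in> vecs V" "x' \<in> vecs V" "y' \<in> vecs V"
  shows "vdist V (vadd V x y) (vadd V x' y') \<le> vdist V x x' + vdist V y y'"
proof -
  have "vdist V (vadd V x y) (vadd V x' y') = vnorm V (vadd V (vdiff V x x') (vdiff V y y'))"
    unfolding vdist_def using assms by (intro norm_eqI) (simp_all add: inner_simps)
  also have "\<dots> \<le> vdist V x x' + vdist V y y'"
    unfolding vdist_def using assms by (intro norm_triangle) (simp_all add: inner_simps)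
  finally show ?thesis .
qed

lemma dist_scale:
  assumes "x \<in> vecs V" "y \<in> vecs V"
  shows "vdist V (vscale V c x) (vscale V c y) = cmod c * vdist V x y"
proof -
  have "vdist V (vscale V c x) (vscale V c y) = vnorm V (vscale V c (vdiff V x y))"
    unfolding vdist_def using assms
    by (intro norm_eqI) (simp_all add: inner_simps algebra_simps)
  then show ?thesis using assms by (simp add: norm_scale diff_closed vdist_def)
qed

lemma norm_diff_le_dist:
  assumes "x \<in> vecs V" "y \<in> vecs V"
  shows "\<bar>vnorm V x - vnorm V y\<bar> \<le> vdist V x y"
  using dist_triangle[of x y "vzero V"] dist_triangle[of y x "vzero V"] assms
    dist_commute[of x y]
  by (simp add: dist_zero zero_closed)

text \<open>The local Lipschitz estimate behind every limit of inner products in the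
  completion.\<close>

lemma inner_diff_le:
  assumes "x \<in> vecs V" "y \<in> vecs V" "x' \<in> vecs V" "y' \<in> vecs V"
  shows "cmod (vinner V x y - vinner V x' y') \<le>
    vdist V x x' * vnorm V y + vnorm V x' * vdist V y y'"
proof -
  have "vinner V x y - vinner V x' y' =
      vinner V (vdiff V x x') y + vinner V x' (vdiff V y y')"
    using assms by (simp add: inner_simps)
  also have "cmod \<dots> \<le> vdist V x x' * vnorm V y + vnorm V x' * vdist V y y'"
    unfolding vdist_def using assms
    by (intro norm_triangle_le add_mono Cauchy_Schwarz) (simp_all add: inner_simps)
  finally show ?thesis .
qed

end

section \<open>Completions\<close>

context pre_hilbert
begin

lemma vcauchy_closed: "vcauchy V X \<Longrightarrow> X n \<in> vecs V"
  by (simp add: vcauchy_def)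

lemma vcauchyD:
  "\<lbrakk>vcauchy V X; \<epsilon> > 0\<rbrakk> \<Longrightarrow> \<exists>M. \<forall>m\<ge>M. \<forall>n\<ge>M. vdist V (X m) (X n) < \<epsilon>"
  by (simp add: vcauchy_def)

lemma vcauchyE:
  assumes "vcauchy V X" "\<epsilon> > 0"
  obtains M where "\<And>m n. m \<ge> M \<Longrightarrow> n \<ge> M \<Longrightarrow> vdist V (X m) (X n) < \<epsilon>"
  using vcauchyD[OF assms] by blast

lemma vcauchy_const: "x \<in> vecs V \<Longrightarrow> vcauchy V (\<lambda>_. x)"
  by (simp add: vcauchy_def dist_self)

lemma vcauchy_add:
  assumes X: "vcauchy V X" and Y: "vcauchy V Y"
  shows "vcauchy V (\<lambda>n. vadd V (X n) (Y n))"
  unfolding vcauchy_def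
proof (intro conjI allI impI)
  show "vadd V (X n) (Y n) \<in> vecs V" for n
    using X Y by (simp add: vcauchy_closed add_closed)
next
  fix \<epsilon> :: real assume "\<epsilon> > 0"
  then have half: "\<epsilon> / 2 > 0" by simp
  obtain M1 where M1: "\<And>m n. m \<ge> M1 \<Longrightarrow> n \<ge> M1 \<Longrightarrow> vdist V (X m) (X n) < \<epsilon> / 2"
    using vcauchyE[OF X half] by blast
  obtain M2 where M2: "\<And>m n. m \<ge> M2 \<Longrightarrow> n \<ge> M2 \<Longrightarrow> vdist V (Y m) (Y n) < \<epsilon> / 2"
    using vcauchyE[OF Y half] by blast
  show "\<exists>M. \<forall>m\<ge>M. \<forall>n\<ge>M. vdist V (vadd V (X m) (Y m)) (vadd V (X n) (Y n)) < \<epsilon>"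
  proof (intro exI[of _ "max M1 M2"] allI impI)
    fix m n assume "max M1 M2 \<le> m" "max M1 M2 \<le> n"
    then show "vdist V (vadd V (X m) (Y m)) (vadd V (X n) (Y n)) < \<epsilon>"
      using M1[of m n] M2[of m n] dist_add[of "X m" "Y m" "X n" "Y n"] X Y
      by (simp add: vcauchy_closed)
  qed
qed

lemma vcauchy_scale:
  assumes X: "vcauchy V X"
  shows "vcauchy V (\<lambda>n. vscale V c (X n))"
  unfolding vcauchy_def
proof (intro conjI allI impI)
  show "vscale V c (X n) \<in> vecs V" for n
    using X by (simp add: vcauchy_closed scale_closed)
next
  fix \<epsilon> :: real assume e: "\<epsilon> > 0"
  \<comment> \<open>The summand 1 avoids a division by 0 when \<open>c = 0\<close>.\<close>
  have pos: "cmod c + 1 > 0" by (simp add: add_nonneg_pos)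
  then obtain M where M: "\<And>m n. m \<ge> M \<Longrightarrow> n \<ge> M \<Longrightarrow> vdist V (X m) (X n) < \<epsilon> / (cmod c + 1)"
    using vcauchyD[OF X, of "\<epsilon> / (cmod c + 1)"] e by auto
  show "\<exists>M. \<forall>m\<ge>M. \<forall>n\<ge>M. vdist V (vscale V c (X m)) (vscale V c (X n)) < \<epsilon>"
  proof (intro exI[of _ M] allI impI)
    fix m n assume "M \<le> m" "M \<le> n"
    then have "(cmod c + 1) * vdist V (X m) (X n) < \<epsilon>"
      using M[of m n] pos by (simp add: field_simps)
    moreover have "cmod c * vdist V (X m) (X n) \<le> (cmod c + 1) * vdist V (X m) (X n)"
      using X by (intro mult_right_mono) (simp_all add: dist_nonneg vcauchy_closed)
    ultimately show "vdist V (vscale V c (X m)) (vscale V c (X n)) < \<epsilon>"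
      using X by (simp add: dist_scale vcauchy_closed)
  qed
qed

lemma vcauchy_diff:
  "\<lbrakk>vcauchy V X; vcauchy V Y\<rbrakk> \<Longrightarrow> vcauchy V (\<lambda>n. vdiff V (X n) (Y n))"
  unfolding vdiff_def by (intro vcauchy_add vcauchy_scale)

lemma vcauchy_norm_bounded:
  assumes X: "vcauchy V X"
  shows "\<exists>B>0. \<forall>n. vnorm V (X n) \<le> B"
proof -
  have "Cauchy (\<lambda>n. vnorm V (X n))"
  proof (rule CauchyI)
    fix e :: real assume "e > 0"
    then obtain M where M: "\<And>m n. m \<ge> M \<Longrightarrow> n \<ge> M \<Longrightarrow> vdist V (X m) (X n) < e"
      using vcauchyE[OF X] by blast
    show "\<exists>M. \<forall>m\<ge>M. \<forall>n\<ge>M. norm (vnorm V (X m) - vnorm V (X n)) < e"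
    proof (intro exI[of _ M] allI impI)
      fix m n assume "M \<le> m" "M \<le> n"
      then show "norm (vnorm V (X m) - vnorm V (X n)) < e"
        using norm_diff_le_dist[of "X m" "X n"] M[of m n] X by (simp add: vcauchy_closed)
    qed
  qed
  then have "Bseq (\<lambda>n. vnorm V (X n))" by (rule Cauchy_Bseq)
  then obtain B where "B > 0" "\<forall>n. norm (vnorm V (X n)) \<le> B" by (rule BseqE)
  then show ?thesis by (intro exI[of _ B]) (auto intro: order_trans[OF abs_ge_self])
qed

text \<open>The completion defines its inner product by the total function \<open>lim\<close>;
  convergence is what gives that value a meaning.\<close>

lemma vcauchy_inner_convergent:
  assumes X: "vcauchy V X" and Y: "vcauchy V Y"
  shows "convergent (\<lambda>n. vinner V (X n) (Y n))"
proof -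
  obtain B where B: "B > 0" "\<And>n. vnorm V (X n) \<le> B" using vcauchy_norm_bounded[OF X] by blast
  obtain C where C: "C > 0" "\<And>n. vnorm V (Y n) \<le> C" using vcauchy_norm_bounded[OF Y] by blast
  have "Cauchy (\<lambda>n. vinner V (X n) (Y n))"
  proof (rule CauchyI)
    fix e :: real assume e: "e > 0"
    have pos: "e / (2 * C) > 0" "e / (2 * B) > 0" using e B(1) C(1) by simp_all
    obtain M1 where M1: "\<And>m n. m \<ge> M1 \<Longrightarrow> n \<ge> M1 \<Longrightarrow> vdist V (X m) (X n) < e / (2 * C)"
      using vcauchyE[OF X pos(1)] by blast
    obtain M2 where M2: "\<And>m n. m \<ge> M2 \<Longrightarrow> n \<ge> M2 \<Longrightarrow> vdist V (Y m) (Y n) < e / (2 * B)"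
      using vcauchyE[OF Y pos(2)] by blast
    show "\<exists>M. \<forall>m\<ge>M. \<forall>n\<ge>M. norm (vinner V (X m) (Y m) - vinner V (X n) (Y n)) < e"
    proof (intro exI[of _ "max M1 M2"] allI impI)
      fix m n assume mn: "max M1 M2 \<le> m" "max M1 M2 \<le> n"
      note closed = vcauchy_closed[OF X] vcauchy_closed[OF Y]
      have "norm (vinner V (X m) (Y m) - vinner V (X n) (Y n)) \<le>
          vdist V (X m) (X n) * vnorm V (Y m) + vnorm V (X n) * vdist V (Y m) (Y n)"
        by (rule inner_diff_le) (simp_all add: closed)
      also have "\<dots> \<le> vdist V (X m) (X n) * C + B * vdist V (Y m) (Y n)"
        using B C by (intro add_mono mult_left_mono mult_right_mono)
          (simp_all add: dist_nonneg closed)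
      also have "\<dots> < e / (2 * C) * C + B * (e / (2 * B))"
        using M1[of m n] M2[of m n] mn B(1) C(1)
        by (intro add_strict_mono mult_strict_right_mono mult_strict_left_mono) auto
      also have "\<dots> = e" using B(1) C(1) by (simp add: field_simps)
      finally show "norm (vinner V (X m) (Y m) - vinner V (X n) (Y n)) < e" .
    qed
  qed
  then show ?thesis by (simp add: Cauchy_convergent_iff)
qed

text \<open>Both sequences are required to be Cauchy, so that this is a partial equivalence relation
  whose domain is the set of Cauchy sequences and whose classes are the vectors of the
  completion.\<close>

definition null_eq :: "(nat \<Rightarrow> 'a) \<Rightarrow> (nat \<Rightarrow> 'a) \<Rightarrow> bool" where
  "null_eq X Y \<longleftrightarrow> vcauchy V X \<and> vcauchy V Y \<and> (\<lambda>n. vdist V (X n) (Y n)) \<longlonglongrightarrow> 0"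

lemma null_eq_refl: "vcauchy V X \<Longrightarrow> null_eq X X"
  by (simp add: null_eq_def dist_self vcauchy_closed)

lemma null_eq_sym: "null_eq X Y \<Longrightarrow> null_eq Y X"
  by (simp add: null_eq_def dist_commute[of "Y _" "X _"] vcauchy_closed)

lemma null_eq_trans:
  assumes "null_eq X Y" "null_eq Y Z"
  shows "null_eq X Z"
proof -
  have c: "vcauchy V X" "vcauchy V Y" "vcauchy V Z" using assms by (auto simp: null_eq_def)
  have "(\<lambda>n. vdist V (X n) (Z n)) \<longlonglongrightarrow> 0"
  proof (rule tendsto_sandwich[OF _ _ tendsto_const])
    show "(\<lambda>n. vdist V (X n) (Y n) + vdist V (Y n) (Z n)) \<longlonglongrightarrow> 0"
      using assms tendsto_add[of _ 0 sequentially _ 0] by (auto simp: null_eq_def)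
  qed (use c in \<open>auto intro!: always_eventually dist_nonneg dist_triangle simp: vcauchy_closed\<close>)
  then show ?thesis using c by (simp add: null_eq_def)
qed

lemma mem_cauchy_class: "vcauchy V X \<Longrightarrow> Y \<in> cauchy_class V X \<longleftrightarrow> null_eq X Y"
  by (simp add: cauchy_class_def null_eq_def)

lemma cauchy_class_eq_iff:
  assumes "vcauchy V X" "vcauchy V Y"
  shows "cauchy_class V X = cauchy_class V Y \<longleftrightarrow> null_eq X Y"
  using assms mem_cauchy_class null_eq_refl null_eq_sym null_eq_trans by blast

lemma class_rep_null_eq: "vcauchy V X \<Longrightarrow> null_eq X (class_rep (cauchy_class V X))"
  unfolding class_rep_def
  by (rule someI2[of _ X]) (auto simp: mem_cauchy_class null_eq_refl)

lemma null_eq_add: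
  assumes "null_eq X X'" "null_eq Y Y'"
  shows "null_eq (\<lambda>n. vadd V (X n) (Y n)) (\<lambda>n. vadd V (X' n) (Y' n))"
proof -
  have c: "vcauchy V X" "vcauchy V Y" "vcauchy V X'" "vcauchy V Y'"
    using assms by (auto simp: null_eq_def)
  have "(\<lambda>n. vdist V (vadd V (X n) (Y n)) (vadd V (X' n) (Y' n))) \<longlonglongrightarrow> 0"
  proof (rule tendsto_sandwich[OF _ _ tendsto_const])
    show "(\<lambda>n. vdist V (X n) (X' n) + vdist V (Y n) (Y' n)) \<longlonglongrightarrow> 0"
      using assms tendsto_add[of _ 0 sequentially _ 0] by (auto simp: null_eq_def)
  qed (use c in \<open>auto intro!: always_eventually dist_nonneg dist_add simp: vcauchy_closed add_closed\<close>)
  then show ?thesis using c by (simp add: null_eq_def vcauchy_add)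
qed

lemma null_eq_scale:
  assumes "null_eq X X'"
  shows "null_eq (\<lambda>n. vscale V c (X n)) (\<lambda>n. vscale V c (X' n))"
  using assms tendsto_mult_right_zero[of "\<lambda>n. vdist V (X n) (X' n)" sequentially "cmod c"]
  by (auto simp: null_eq_def vcauchy_scale vcauchy_closed dist_scale)

lemma null_eq_inner:
  assumes "null_eq X X'" "null_eq Y Y'"
  shows "(\<lambda>n. vinner V (X n) (Y n) - vinner V (X' n) (Y' n)) \<longlonglongrightarrow> 0"
proof -
  have c: "vcauchy V X" "vcauchy V Y" "vcauchy V X'" "vcauchy V Y'"
    using assms by (auto simp: null_eq_def)
  obtain B where B: "B > 0" "\<And>n. vnorm V (X' n) \<le> B" using vcauchy_norm_bounded[OF c(3)] by blast
  obtain C where C: "C > 0" "\<And>n. vnorm V (Y n) \<le> C" using vcauchy_norm_bounded[OF c(2)] by blast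
  show ?thesis
  proof (rule Lim_null_comparison)
    show "\<forall>\<^sub>F n in sequentially. norm (vinner V (X n) (Y n) - vinner V (X' n) (Y' n)) \<le>
        vdist V (X n) (X' n) * C + B * vdist V (Y n) (Y' n)"
    proof (intro always_eventually allI)
      fix n
      have "norm (vinner V (X n) (Y n) - vinner V (X' n) (Y' n)) \<le>
          vdist V (X n) (X' n) * vnorm V (Y n) + vnorm V (X' n) * vdist V (Y n) (Y' n)"
        using c by (intro inner_diff_le) (simp_all add: vcauchy_closed)
      also have "\<dots> \<le> vdist V (X n) (X' n) * C + B * vdist V (Y n) (Y' n)"
        using B C c by (intro add_mono mult_left_mono mult_right_mono)
          (simp_all add: dist_nonneg vcauchy_closed)
      finally show "norm (vinner V (X n) (Y n) - vinner V (X' n) (Y' n)) \<le>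
        vdist V (X n) (X' n) * C + B * vdist V (Y n) (Y' n)" .
    qed
    have "(\<lambda>n. vdist V (X n) (X' n) * C + B * vdist V (Y n) (Y' n)) \<longlonglongrightarrow> 0 * C + B * 0"
      using assms unfolding null_eq_def by (intro tendsto_intros) auto
    then show "(\<lambda>n. vdist V (X n) (X' n) * C + B * vdist V (Y n) (Y' n)) \<longlonglongrightarrow> 0" by simp
  qed
qed

abbreviation cls :: "(nat \<Rightarrow> 'a) \<Rightarrow> (nat \<Rightarrow> 'a) set" where
  "cls \<equiv> cauchy_class V"

lemma completion_vecs: "vecs (hcompletion V) = cls ` {X. vcauchy V X}"
  and completion_zero: "vzero (hcompletion V) = cls (\<lambda>_. vzero V)"
  by (simp_all add: hcompletion_def)

text \<open>The operations are defined through chosen representatives. Compatibility with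
  \<open>null_eq\<close> allows any Cauchy sequence in place of the chosen one, and no later proof
  returns to the choice.\<close>

lemma completion_add:
  "\<lbrakk>vcauchy V X; vcauchy V Y\<rbrakk> \<Longrightarrow>
     vadd (hcompletion V) (cls X) (cls Y) = cls (\<lambda>n. vadd V (X n) (Y n))"
  using null_eq_add[OF class_rep_null_eq class_rep_null_eq, of X Y]
  by (simp add: hcompletion_def) (metis cauchy_class_eq_iff null_eq_def)

lemma completion_scale:
  "vcauchy V X \<Longrightarrow> vscale (hcompletion V) c (cls X) = cls (\<lambda>n. vscale V c (X n))"
  using null_eq_scale[OF class_rep_null_eq, of X c]
  by (simp add: hcompletion_def) (metis cauchy_class_eq_iff null_eq_def)

lemma completion_diff:
  "\<lbrakk>vcauchy V X; vcauchy V Y\<rbrakk> \<Longrightarrow>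
     vdiff (hcompletion V) (cls X) (cls Y) = cls (\<lambda>n. vdiff V (X n) (Y n))"
  by (simp add: vdiff_def completion_add completion_scale vcauchy_scale)

lemma completion_inner:
  assumes "vcauchy V X" "vcauchy V Y"
  shows "(\<lambda>n. vinner V (X n) (Y n)) \<longlonglongrightarrow> vinner (hcompletion V) (cls X) (cls Y)"
proof -
  let ?X = "class_rep (cls X)" and ?Y = "class_rep (cls Y)"
  have r: "null_eq X ?X" "null_eq Y ?Y" using assms by (simp_all add: class_rep_null_eq)
  then have "convergent (\<lambda>n. vinner V (?X n) (?Y n))"
    by (simp add: vcauchy_inner_convergent null_eq_def)
  then have "(\<lambda>n. vinner V (?X n) (?Y n)) \<longlonglongrightarrow> vinner (hcompletion V) (cls X) (cls Y)"
    by (simp add: hcompletion_def convergent_LIMSEQ_iff)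
  from tendsto_add[OF null_eq_inner[OF r] this] show ?thesis by simp
qed

lemma completion_inner_eqI:
  "\<lbrakk>vcauchy V X; vcauchy V Y; (\<lambda>n. vinner V (X n) (Y n)) \<longlonglongrightarrow> c\<rbrakk> \<Longrightarrow>
     vinner (hcompletion V) (cls X) (cls Y) = c"
  using completion_inner LIMSEQ_unique by blast

lemma completion_dist:
  assumes "vcauchy V X" "vcauchy V Y"
  shows "(\<lambda>n. vdist V (X n) (Y n)) \<longlonglongrightarrow> vdist (hcompletion V) (cls X) (cls Y)"
  unfolding vdist_def vnorm_def completion_diff[OF assms]
  by (intro tendsto_intros completion_inner vcauchy_diff assms)

lemma pre_hilbert_completion: "pre_hilbert (hcompletion V)"
proof -
  let ?H = "hcompletion V"
  show ?thesis
  proof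
    fix x y z c d
    show "vzero ?H \<in> vecs ?H"
      by (simp add: completion_vecs completion_zero vcauchy_const zero_closed)
    assume "x \<in> vecs ?H"
    then obtain X where X: "x = cls X" "vcauchy V X" by (auto simp: completion_vecs)
    note cl = vcauchy_closed[OF X(2)]
    note eqs = completion_add completion_scale completion_diff completion_vecs completion_zero
      vcauchy_add vcauchy_scale vcauchy_const
    show "vscale ?H c x \<in> vecs ?H" "vadd ?H x (vzero ?H) = x" "vdiff ?H x x = vzero ?H"
      "vscale ?H (c + d) x = vadd ?H (vscale ?H c x) (vscale ?H d x)"
      "vscale ?H c (vscale ?H d x) = vscale ?H (c * d) x" "vscale ?H 1 x = x"
      using X(2) unfolding X(1)
      by (simp_all add: eqs cl zero_closed add_zero diff_self scale_add_left scale_scale scale_one)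
    show "Re (vinner ?H x x) \<ge> 0"
      using tendsto_Re[OF completion_inner[OF X(2) X(2)]] unfolding X(1)
      by (rule tendsto_lowerbound) (simp_all add: cl inner_nonneg)
    assume "y \<in> vecs ?H"
    then obtain Y where Y: "y = cls Y" "vcauchy V Y" by (auto simp: completion_vecs)
    note cl = cl vcauchy_closed[OF Y(2)]
    show "vadd ?H x y \<in> vecs ?H"
      "vscale ?H c (vadd ?H x y) = vadd ?H (vscale ?H c x) (vscale ?H c y)"
      using X(2) Y(2) unfolding X(1) Y(1)
      by (simp_all add: eqs cl scale_add_right)
    show "vadd ?H x y = vadd ?H y x"
      using X(2) Y(2) add_commute[OF cl] unfolding X(1) Y(1) by (simp add: eqs)
    show "vinner ?H (vscale ?H c x) y = c * vinner ?H x y"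
      using X(2) Y(2) tendsto_mult_left[OF completion_inner[OF X(2) Y(2)], of c] unfolding X(1) Y(1)
      by (simp add: eqs, intro completion_inner_eqI) (simp_all add: eqs cl inner_scale)
    show "vinner ?H x y = cnj (vinner ?H y x)"
      using X(2) Y(2) tendsto_cnj[OF completion_inner[OF Y(2) X(2)]] unfolding X(1) Y(1)
      by (intro completion_inner_eqI) (simp_all add: inner_cnj[OF cl, symmetric])
    assume "z \<in> vecs ?H"
    then obtain Z where Z: "z = cls Z" "vcauchy V Z" by (auto simp: completion_vecs)
    note cl = cl vcauchy_closed[OF Z(2)]
    show "vadd ?H (vadd ?H x y) z = vadd ?H x (vadd ?H y z)"
      using X(2) Y(2) Z(2) unfolding X(1) Y(1) Z(1) by (simp add: eqs cl add_assoc)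
    show "vinner ?H (vadd ?H x y) z = vinner ?H x z + vinner ?H y z"
      using X(2) Y(2) Z(2)
        tendsto_add[OF completion_inner[OF X(2) Z(2)] completion_inner[OF Y(2) Z(2)]]
      unfolding X(1) Y(1) Z(1)
      by (simp add: eqs, intro completion_inner_eqI) (simp_all add: eqs cl inner_add)
  qed
qed

lemma embed_closed: "a \<in> vecs V \<Longrightarrow> embed V a \<in> vecs (hcompletion V)"
  by (simp add: embed_def completion_vecs vcauchy_const)

lemma embed_zero: "vzero (hcompletion V) = embed V (vzero V)"
  by (simp add: embed_def completion_zero)

lemma embed_add:
  "\<lbrakk>a \<in> vecs V; b \<in> vecs V\<rbrakk> \<Longrightarrow>
     vadd (hcompletion V) (embed V a) (embed V b) = embed V (vadd V a b)"
  by (simp add: embed_def completion_add vcauchy_const)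

lemma embed_scale:
  "a \<in> vecs V \<Longrightarrow> vscale (hcompletion V) c (embed V a) = embed V (vscale V c a)"
  by (simp add: embed_def completion_scale vcauchy_const)

lemma embed_norm: "a \<in> vecs V \<Longrightarrow> vnorm (hcompletion V) (embed V a) = vnorm V a"
  by (simp add: embed_def vnorm_def completion_inner_eqI[OF _ _ tendsto_const] vcauchy_const)

lemma embed_dist:
  "\<lbrakk>a \<in> vecs V; b \<in> vecs V\<rbrakk> \<Longrightarrow> vdist (hcompletion V) (embed V a) (embed V b) = vdist V a b"
  by (simp add: vdist_def completion_diff embed_def vcauchy_const)
    (simp add: embed_norm[unfolded embed_def] diff_closed)

lemma dist_cls_embed_le:
  assumes X: "vcauchy V X" and a: "a \<in> vecs V" and M: "\<And>m. m \<ge> M \<Longrightarrow> vdist V (X m) a \<le> \<epsilon>"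
  shows "vdist (hcompletion V) (cls X) (embed V a) \<le> \<epsilon>"
  using completion_dist[OF X vcauchy_const[OF a]] unfolding embed_def
  by (rule tendsto_upperbound) (auto simp: eventually_sequentially intro!: exI[of _ M] M)

lemma embed_dense:
  assumes "x \<in> vecs (hcompletion V)" "\<epsilon> > 0"
  shows "\<exists>a\<in>vecs V. vdist (hcompletion V) (embed V a) x < \<epsilon>"
proof -
  interpret H: pre_hilbert "hcompletion V" by (rule pre_hilbert_completion)
  obtain X where X: "x = cls X" "vcauchy V X" using assms by (auto simp: completion_vecs)
  obtain M where M: "\<And>m n. m \<ge> M \<Longrightarrow> n \<ge> M \<Longrightarrow> vdist V (X m) (X n) < \<epsilon> / 2"
    using vcauchyD[OF X(2), of "\<epsilon> / 2"] assms(2) by auto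
  have "vdist (hcompletion V) x (embed V (X M)) \<le> \<epsilon> / 2"
    unfolding X(1) by (rule dist_cls_embed_le[OF X(2) vcauchy_closed[OF X(2)]])
      (rule less_imp_le[OF M[OF _ order_refl]])
  then show ?thesis
    using assms H.dist_commute[OF assms(1) embed_closed[OF vcauchy_closed[OF X(2), of M]]]
    by (intro bexI[of _ "X M"]) (auto simp: vcauchy_closed X)
qed

text \<open>A Cauchy sequence of classes is approximated by embedded vectors \<open>Y n\<close> with
  error at most \<open>1 / (n + 1)\<close>. The embedding is isometric, so \<open>Y\<close> is
  itself Cauchy, and its class is the limit.\<close>

lemma hilbert_space_completion: "hilbert_space (hcompletion V)"
  unfolding hilbert_space_iff
proof (intro conjI ballI allI impI)
  let ?H = "hcompletion V"
  interpret H: pre_hilbert ?H by (rule pre_hilbert_completion)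
  show "pre_hilbert ?H" by (rule pre_hilbert_completion)
  show "x = vzero ?H" if x: "x \<in> vecs ?H" "vinner ?H x x = 0" for x
  proof -
    obtain X where X: "x = cls X" "vcauchy V X" using x(1) by (auto simp: completion_vecs)
    \<comment> \<open>Distance 0 to the zero class means that the representing sequence tends to 0;
      definiteness thus comes from the quotient.\<close>
    have "vdist ?H x (vzero ?H) = 0" using x by (simp add: H.dist_zero vnorm_def)
    then have "null_eq X (\<lambda>_. vzero V)"
      using completion_dist[OF X(2) vcauchy_const[OF zero_closed]] X
      by (simp add: null_eq_def vcauchy_const zero_closed completion_zero)
    then show ?thesis
      using X cauchy_class_eq_iff[of X "\<lambda>_. vzero V"]
      by (simp add: completion_zero vcauchy_const zero_closed)
  qed
  fix F assume F: "vcauchy ?H F"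
  have Fc: "F n \<in> vecs ?H" for n using F by (simp add: vcauchy_def)
  then have "\<forall>n. \<exists>a\<in>vecs V. vdist ?H (embed V a) (F n) < inverse (real (Suc n))"
    by (intro allI embed_dense) auto
  then obtain Y where Y: "\<And>n. Y n \<in> vecs V"
      "\<And>n. vdist ?H (embed V (Y n)) (F n) < inverse (real (Suc n))"
    by metis
  have small: "\<exists>M. \<forall>n\<ge>M. inverse (real (Suc n)) < e" if "e > 0" for e
    using order_tendstoD(2)[OF LIMSEQ_inverse_real_of_nat that] by (simp add: eventually_sequentially)
  have Ycauchy: "vcauchy V Y"
    unfolding vcauchy_def
  proof (intro conjI allI impI Y(1))
    fix e :: real assume e: "e > 0"
    obtain M1 where M1: "\<And>m n. m \<ge> M1 \<Longrightarrow> n \<ge> M1 \<Longrightarrow> vdist ?H (F m) (F n) < e / 3"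
      using H.vcauchyD[OF F, of "e / 3"] e by auto
    obtain M2 where M2: "\<And>n. n \<ge> M2 \<Longrightarrow> inverse (real (Suc n)) < e / 3"
      using small[of "e / 3"] e by auto
    show "\<exists>M. \<forall>m\<ge>M. \<forall>n\<ge>M. vdist V (Y m) (Y n) < e"
    proof (intro exI[of _ "max M1 M2"] allI impI)
      fix m n assume mn: "max M1 M2 \<le> m" "max M1 M2 \<le> n"
      note cl = embed_closed[OF Y(1)] Fc
      have "vdist V (Y m) (Y n) = vdist ?H (embed V (Y m)) (embed V (Y n))"
        by (simp add: embed_dist Y)
      also have "\<dots> \<le> vdist ?H (embed V (Y m)) (F m) + (vdist ?H (F m) (F n) +
          vdist ?H (F n) (embed V (Y n)))"
        using H.dist_triangle[OF cl(1)[of m] cl(2)[of m] cl(1)[of n]]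
          H.dist_triangle[OF cl(2)[of m] cl(2)[of n] cl(1)[of n]] by simp
      also have "\<dots> < e / 3 + (e / 3 + e / 3)"
        using Y(2)[of m] Y(2)[of n] M2[of m] M2[of n] M1[of m n] mn
        unfolding H.dist_commute[OF cl(2)[of n] cl(1)[of n]] by simp
      finally show "vdist V (Y m) (Y n) < e" by simp
    qed
  qed
  have lim: "(\<lambda>n. vdist ?H (embed V (Y n)) (cls Y)) \<longlonglongrightarrow> 0"
  proof (rule LIMSEQ_I)
    fix r :: real assume r: "r > 0"
    obtain M where M: "\<And>m n. m \<ge> M \<Longrightarrow> n \<ge> M \<Longrightarrow> vdist V (Y m) (Y n) < r / 2"
      using vcauchyD[OF Ycauchy, of "r / 2"] r by auto
    have cY: "cls Y \<in> vecs ?H" using Ycauchy by (simp add: completion_vecs)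
    show "\<exists>no. \<forall>n\<ge>no. norm (vdist ?H (embed V (Y n)) (cls Y) - 0) < r"
    proof (intro exI[of _ M] allI impI)
      fix n assume n: "n \<ge> M"
      have "vdist ?H (cls Y) (embed V (Y n)) \<le> r / 2"
        by (rule dist_cls_embed_le[OF Ycauchy Y(1)]) (rule less_imp_le[OF M[OF _ n]])
      then show "norm (vdist ?H (embed V (Y n)) (cls Y) - 0) < r"
        using r H.dist_commute[OF cY embed_closed[OF Y(1)]]
          H.dist_nonneg[OF embed_closed[OF Y(1)] cY]
        by simp
    qed
  qed
  have cY: "cls Y \<in> vecs ?H" using Ycauchy by (simp add: completion_vecs)
  have "(\<lambda>n. vdist ?H (F n) (cls Y)) \<longlonglongrightarrow> 0"
  proof (rule tendsto_sandwich[OF _ _ tendsto_const])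
    show "(\<lambda>n. inverse (real (Suc n)) + vdist ?H (embed V (Y n)) (cls Y)) \<longlonglongrightarrow> 0"
      using tendsto_add[OF LIMSEQ_inverse_real_of_nat lim] by simp
    show "\<forall>\<^sub>F n in sequentially. 0 \<le> vdist ?H (F n) (cls Y)"
      by (simp add: H.dist_nonneg Fc cY)
    show "\<forall>\<^sub>F n in sequentially. vdist ?H (F n) (cls Y) \<le>
        inverse (real (Suc n)) + vdist ?H (embed V (Y n)) (cls Y)"
    proof (intro always_eventually allI)
      fix n
      show "vdist ?H (F n) (cls Y) \<le>
          inverse (real (Suc n)) + vdist ?H (embed V (Y n)) (cls Y)"
        using H.dist_triangle[OF Fc embed_closed[OF Y(1)] cY, of n n] Y(2)[of n]
          H.dist_commute[OF Fc embed_closed[OF Y(1)], of n n]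
        by simp
    qed
  qed
  then show "\<exists>x\<in>vecs ?H. (\<lambda>n. vdist ?H (F n) x) \<longlonglongrightarrow> 0" using cY by blast
qed

end

section \<open>Transport of structure\<close>

context
  fixes \<phi> :: "'a \<Rightarrow> 'b" and V :: "'a cspace"
  assumes inj: "inj \<phi>"
begin

lemma transport_vecs: "vecs (transport \<phi> V) = \<phi> ` vecs V"
  by (simp add: transport_def Let_def)

lemma transport_zero: "vzero (transport \<phi> V) = \<phi> (vzero V)"
  by (simp add: transport_def Let_def)

lemma transport_inv: "x \<in> vecs V \<Longrightarrow> inv_into (vecs V) \<phi> (\<phi> x) = x"
  using inj by (simp add: inj_on_subset)

lemma transport_add:
  "\<lbrakk>x \<in> vecs V; y \<in> vecs V\<rbrakk> \<Longrightarrow> vadd (transport \<phi> V) (\<phi> x) (\<phi> y) = \<phi> (vadd V x y)"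
  by (simp add: transport_def Let_def transport_inv)

lemma transport_scale:
  "x \<in> vecs V \<Longrightarrow> vscale (transport \<phi> V) c (\<phi> x) = \<phi> (vscale V c x)"
  by (simp add: transport_def Let_def transport_inv)

lemma transport_inner:
  "\<lbrakk>x \<in> vecs V; y \<in> vecs V\<rbrakk> \<Longrightarrow> vinner (transport \<phi> V) (\<phi> x) (\<phi> y) = vinner V x y"
  by (simp add: transport_def Let_def transport_inv)

lemma transport_norm: "x \<in> vecs V \<Longrightarrow> vnorm (transport \<phi> V) (\<phi> x) = vnorm V x"
  by (simp add: vnorm_def transport_inner)

lemma transport_dist:
  assumes "pre_hilbert V" "x \<in> vecs V" "y \<in> vecs V"
  shows "vdist (transport \<phi> V) (\<phi> x) (\<phi> y) = vdist V x y"
  using assms pre_hilbert.diff_closed[OF assms] pre_hilbert.scale_closed[OF assms(1)]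
  by (simp add: vdist_def vdiff_def transport_add transport_scale transport_norm)

lemma hilbert_space_transport:
  assumes "hilbert_space V"
  shows "hilbert_space (transport \<phi> V)"
proof -
  interpret hilbert_space V by fact
  interpret P: pre_hilbert V using assms by (simp add: hilbert_space_iff)
  note tr = transport_vecs transport_zero transport_add transport_scale transport_inner
  let ?T = "transport \<phi> V"
  have "pre_hilbert ?T"
  proof
    fix x y z c d
    show "vzero ?T \<in> vecs ?T" by (simp add: tr zero_closed)
    assume "x \<in> vecs ?T"
    then obtain x' where x: "x = \<phi> x'" "x' \<in> vecs V" by (auto simp: tr)
    show "vscale ?T c x \<in> vecs ?T" "vadd ?T x (vzero ?T) = x" "vdiff ?T x x = vzero ?T"
      "vscale ?T (c + d) x = vadd ?T (vscale ?T c x) (vscale ?T d x)"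
      "vscale ?T c (vscale ?T d x) = vscale ?T (c * d) x" "vscale ?T 1 x = x"
      "Re (vinner ?T x x) \<ge> 0"
      using x(2) unfolding x(1) vdiff_def
      by (simp_all add: tr zero_closed add_closed scale_closed add_zero diff_self[unfolded vdiff_def]
          scale_add_left scale_scale scale_one inner_nonneg)
    assume "y \<in> vecs ?T"
    then obtain y' where y: "y = \<phi> y'" "y' \<in> vecs V" by (auto simp: tr)
    show "vadd ?T x y \<in> vecs ?T"
      "vscale ?T c (vadd ?T x y) = vadd ?T (vscale ?T c x) (vscale ?T c y)"
      "vinner ?T (vscale ?T c x) y = c * vinner ?T x y"
      using x(2) y(2) unfolding x(1) y(1)
      by (simp_all add: tr add_closed scale_closed scale_add_right inner_scale)
    show "vadd ?T x y = vadd ?T y x"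
      using x(2) y(2) add_commute[OF x(2) y(2)] unfolding x(1) y(1) by (simp add: tr)
    show "vinner ?T x y = cnj (vinner ?T y x)"
      using x(2) y(2) inner_cnj[OF x(2) y(2)] unfolding x(1) y(1) by (simp add: tr)
    assume "z \<in> vecs ?T"
    then obtain z' where z: "z = \<phi> z'" "z' \<in> vecs V" by (auto simp: tr)
    show "vadd ?T (vadd ?T x y) z = vadd ?T x (vadd ?T y z)"
      "vinner ?T (vadd ?T x y) z = vinner ?T x z + vinner ?T y z"
      using x(2) y(2) z(2) unfolding x(1) y(1) z(1)
      by (simp_all add: tr add_closed add_assoc inner_add)
  qed
  moreover have "x = vzero ?T" if "x \<in> vecs ?T" "vinner ?T x x = 0" for x
    using that inner_definite by (auto simp: tr)
  moreover have "\<exists>x\<in>vecs ?T. (\<lambda>n. vdist ?T (X n) x) \<longlonglongrightarrow> 0" if X: "vcauchy ?T X" for X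
  proof -
    have "\<forall>n. \<exists>y\<in>vecs V. X n = \<phi> y" using X by (auto simp: vcauchy_def transport_vecs)
    then obtain Y where Y: "\<And>n. Y n \<in> vecs V" "\<And>n. X n = \<phi> (Y n)" by metis
    then have "vcauchy V Y"
      using X by (simp add: vcauchy_def transport_dist P.pre_hilbert_axioms)
    then obtain y where "y \<in> vecs V" "(\<lambda>n. vdist V (Y n) y) \<longlonglongrightarrow> 0" using complete by blast
    then show ?thesis
      using Y by (intro bexI[of _ "\<phi> y"])
        (auto simp: transport_dist P.pre_hilbert_axioms transport_vecs)
  qed
  ultimately show ?thesis by (simp add: hilbert_space_iff)
qed

end

section \<open>Generating subspaces\<close>

lemma continuous_map_realI:
  fixes f :: "'a \<Rightarrow> real"
  assumes "\<And>x e. x \<in> topspace X \<Longrightarrow> e > 0 \<Longrightarrow>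
    \<exists>W. openin X W \<and> x \<in> W \<and> (\<forall>y\<in>W. \<bar>f y - f x\<bar> < e)"
  shows "continuous_map X euclideanreal f"
  unfolding continuous_map_atin
proof
  fix x assume x: "x \<in> topspace X"
  have "(f \<longlongrightarrow> f x) (atin X x)"
  proof (rule tendstoI)
    fix e :: real assume "e > 0"
    then show "\<forall>\<^sub>F y in atin X x. dist (f y) (f x) < e"
      using assms[OF x] by (force simp: eventually_atin dist_real_def)
  qed
  then show "limitin euclideanreal f (f x) (atin X x)" by simp
qed

text \<open>Existence takes all locally approximable sections. For uniqueness, a section of a larger
  field is close to an element of the generating subspace at one point by density, and continuity of
  the norm of their difference spreads this to a neighbourhood.\<close>

lemma generating_subspace_extends_uniquely:
  assumes lc: "locally_compact_space \<Omega>"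
    and hilbert: "\<And>\<omega>. \<omega> \<in> topspace \<Omega> \<Longrightarrow> hilbert_space (H \<omega>)"
    and sub: "section_subspace \<Omega> H \<Lambda>"
    and dense: "fibrewise_dense \<Omega> H \<Lambda>"
    and cont: "norm_continuous \<Omega> H \<Lambda>"
  shows "\<exists>!\<Gamma>. \<Lambda> \<subseteq> \<Gamma> \<and> continuous_field \<Omega> H \<Gamma>"
proof -
  have pre: "pre_hilbert (H \<omega>)" if "\<omega> \<in> topspace \<Omega>" for \<omega>
    using hilbert[OF that] by (simp add: hilbert_space_iff)
  let ?P = "\<Pi>\<^sub>E \<omega>\<in>topspace \<Omega>. vecs (H \<omega>)"
  have nhd: "\<omega> \<in> topspace \<Omega>" if "openin \<Omega> W" "\<omega> \<in> W" for \<omega> W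
    using that openin_subset by blast
  define \<Gamma> where "\<Gamma> = {x \<in> ?P. locally_approximable \<Omega> H \<Lambda> x}"
  have \<Lambda>P: "\<Lambda> \<subseteq> ?P" using sub by (simp add: section_subspace_def)
  have \<Lambda>v: "x \<omega> \<in> vecs (H \<omega>)" if "x \<in> \<Lambda>" "\<omega> \<in> topspace \<Omega>" for x \<omega>
    using \<Lambda>P that by (auto simp: PiE_def Pi_def)
  have "\<Lambda> \<subseteq> \<Gamma>"
  proof
    fix x assume x: "x \<in> \<Lambda>"
    have "locally_approximable \<Omega> H \<Lambda> x"
      unfolding locally_approximable_def
    proof (intro ballI allI impI)
      fix \<omega>\<^sub>0 and e :: real assume "\<omega>\<^sub>0 \<in> topspace \<Omega>" "e > 0"
      then show "\<exists>x'\<in>\<Lambda>. \<exists>W. openin \<Omega> W \<and> \<omega>\<^sub>0 \<in> W \<and> (\<forall>\<omega>\<in>W. vdist (H \<omega>) (x \<omega>) (x' \<omega>) \<le> e)"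
        by (intro bexI[OF _ x] exI[of _ "topspace \<Omega>"])
          (auto simp: pre_hilbert.dist_self[OF pre] \<Lambda>v[OF x])
    qed
    then show "x \<in> \<Gamma>" using x \<Lambda>P by (auto simp: \<Gamma>_def)
  qed
  have approxD: "\<exists>x'\<in>\<Lambda>. \<exists>W. openin \<Omega> W \<and> \<omega>\<^sub>0 \<in> W \<and> (\<forall>\<omega>\<in>W. vdist (H \<omega>) (x \<omega>) (x' \<omega>) \<le> e)"
    if "x \<in> \<Gamma>" "\<omega>\<^sub>0 \<in> topspace \<Omega>" "e > 0" for x \<omega>\<^sub>0 and e :: real
    using that by (auto simp: \<Gamma>_def locally_approximable_def)
  have \<Gamma>v: "x \<omega> \<in> vecs (H \<omega>)" if "x \<in> \<Gamma>" "\<omega> \<in> topspace \<Omega>" for x \<omega>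
    using that by (auto simp: \<Gamma>_def PiE_def Pi_def)
  have "section_subspace \<Omega> H \<Gamma>"
    unfolding section_subspace_def
  proof (intro conjI ballI allI)
    show "\<Gamma> \<subseteq> ?P" by (auto simp: \<Gamma>_def)
    show "(\<lambda>\<omega>\<in>topspace \<Omega>. vzero (H \<omega>)) \<in> \<Gamma>"
      using sub \<open>\<Lambda> \<subseteq> \<Gamma>\<close> by (auto simp: section_subspace_def)
  next
    fix x y assume x: "x \<in> \<Gamma>" and y: "y \<in> \<Gamma>"
    let ?z = "\<lambda>\<omega>\<in>topspace \<Omega>. vadd (H \<omega>) (x \<omega>) (y \<omega>)"
    have "locally_approximable \<Omega> H \<Lambda> ?z"
      unfolding locally_approximable_def
    proof (intro ballI allI impI)
      fix \<omega>\<^sub>0 and e :: real assume a: "\<omega>\<^sub>0 \<in> topspace \<Omega>" "e > 0"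
      obtain x' W1 where 1: "x' \<in> \<Lambda>" "openin \<Omega> W1" "\<omega>\<^sub>0 \<in> W1"
        "\<And>\<omega>. \<omega> \<in> W1 \<Longrightarrow> vdist (H \<omega>) (x \<omega>) (x' \<omega>) \<le> e / 2"
        using approxD[OF x a(1), of "e / 2"] a by auto
      obtain y' W2 where 2: "y' \<in> \<Lambda>" "openin \<Omega> W2" "\<omega>\<^sub>0 \<in> W2"
        "\<And>\<omega>. \<omega> \<in> W2 \<Longrightarrow> vdist (H \<omega>) (y \<omega>) (y' \<omega>) \<le> e / 2"
        using approxD[OF y a(1), of "e / 2"] a by auto
      show "\<exists>x'\<in>\<Lambda>. \<exists>W. openin \<Omega> W \<and> \<omega>\<^sub>0 \<in> W \<and> (\<forall>\<omega>\<in>W. vdist (H \<omega>) (?z \<omega>) (x' \<omega>) \<le> e)"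
      proof (intro bexI[of _ "\<lambda>\<omega>\<in>topspace \<Omega>. vadd (H \<omega>) (x' \<omega>) (y' \<omega>)"] exI[of _ "W1 \<inter> W2"]
          conjI ballI)
        fix \<omega> assume w: "\<omega> \<in> W1 \<inter> W2"
        then have t: "\<omega> \<in> topspace \<Omega>" using 1 nhd by blast
        show "vdist (H \<omega>) (?z \<omega>) ((\<lambda>\<omega>\<in>topspace \<Omega>. vadd (H \<omega>) (x' \<omega>) (y' \<omega>)) \<omega>) \<le> e"
          using pre_hilbert.dist_add[OF pre[OF t] \<Gamma>v[OF x t] \<Gamma>v[OF y t] \<Lambda>v[OF 1(1) t]
              \<Lambda>v[OF 2(1) t]] 1(4)[of \<omega>] 2(4)[of \<omega>] w t by simp
      qed (use 1 2 sub in \<open>auto simp: section_subspace_def\<close>)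
    qed
    then show "?z \<in> \<Gamma>"
      using \<Gamma>v[OF x] \<Gamma>v[OF y] pre_hilbert.add_closed[OF pre] by (auto simp: \<Gamma>_def)
  next
    fix c x assume x: "x \<in> \<Gamma>"
    let ?z = "\<lambda>\<omega>\<in>topspace \<Omega>. vscale (H \<omega>) c (x \<omega>)"
    have "locally_approximable \<Omega> H \<Lambda> ?z"
      unfolding locally_approximable_def
    proof (intro ballI allI impI)
      fix \<omega>\<^sub>0 and e :: real assume a: "\<omega>\<^sub>0 \<in> topspace \<Omega>" "e > 0"
      have pos: "cmod c + 1 > 0" by (simp add: add_nonneg_pos)
      obtain x' W where 1: "x' \<in> \<Lambda>" "openin \<Omega> W" "\<omega>\<^sub>0 \<in> W"
        "\<And>\<omega>. \<omega> \<in> W \<Longrightarrow> vdist (H \<omega>) (x \<omega>) (x' \<omega>) \<le> e / (cmod c + 1)"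
        using approxD[OF x a(1), of "e / (cmod c + 1)"] a pos by auto
      show "\<exists>x'\<in>\<Lambda>. \<exists>W. openin \<Omega> W \<and> \<omega>\<^sub>0 \<in> W \<and> (\<forall>\<omega>\<in>W. vdist (H \<omega>) (?z \<omega>) (x' \<omega>) \<le> e)"
      proof (intro bexI[of _ "\<lambda>\<omega>\<in>topspace \<Omega>. vscale (H \<omega>) c (x' \<omega>)"] exI[of _ W] conjI ballI)
        fix \<omega> assume w: "\<omega> \<in> W"
        then have t: "\<omega> \<in> topspace \<Omega>" using 1 nhd by blast
        have "cmod c * vdist (H \<omega>) (x \<omega>) (x' \<omega>) \<le> (cmod c + 1) * (e / (cmod c + 1))"
          using 1(4)[OF w] pre_hilbert.dist_nonneg[OF pre[OF t] \<Gamma>v[OF x t] \<Lambda>v[OF 1(1) t]]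
          by (intro mult_mono) auto
        then show "vdist (H \<omega>) (?z \<omega>) ((\<lambda>\<omega>\<in>topspace \<Omega>. vscale (H \<omega>) c (x' \<omega>)) \<omega>) \<le> e"
          using pre_hilbert.dist_scale[OF pre[OF t] \<Gamma>v[OF x t] \<Lambda>v[OF 1(1) t], of c] t pos by simp
      qed (use 1 sub in \<open>auto simp: section_subspace_def\<close>)
    qed
    then show "?z \<in> \<Gamma>"
      using \<Gamma>v[OF x] pre_hilbert.scale_closed[OF pre] by (auto simp: \<Gamma>_def)
  qed
  moreover have "fibrewise_dense \<Omega> H \<Gamma>"
    using dense \<open>\<Lambda> \<subseteq> \<Gamma>\<close> unfolding fibrewise_dense_def by blast
  moreover have "norm_continuous \<Omega> H \<Gamma>"
    unfolding norm_continuous_def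
  proof
    fix x assume x: "x \<in> \<Gamma>"
    show "continuous_map \<Omega> euclideanreal (\<lambda>\<omega>. vnorm (H \<omega>) (x \<omega>))"
    proof (rule continuous_map_realI)
      fix \<omega>\<^sub>0 and e :: real assume a: "\<omega>\<^sub>0 \<in> topspace \<Omega>" "e > 0"
      obtain x' W where 1: "x' \<in> \<Lambda>" "openin \<Omega> W" "\<omega>\<^sub>0 \<in> W"
        "\<And>\<omega>. \<omega> \<in> W \<Longrightarrow> vdist (H \<omega>) (x \<omega>) (x' \<omega>) \<le> e / 4"
        using approxD[OF x a(1), of "e / 4"] a by auto
      have le: "\<bar>vnorm (H \<omega>) (x \<omega>) - vnorm (H \<omega>) (x' \<omega>)\<bar> \<le> e / 4" if "\<omega> \<in> W" for \<omega>
        using pre_hilbert.norm_diff_le_dist[OF pre \<Gamma>v[OF x] \<Lambda>v[OF 1(1)]] nhd[OF 1(2) that] 1(4)[OF that]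
        by (meson order_trans)
      have "continuous_map \<Omega> euclideanreal (\<lambda>\<omega>. vnorm (H \<omega>) (x' \<omega>))"
        using cont 1(1) by (simp add: norm_continuous_def)
      then have op: "openin \<Omega> {\<omega> \<in> topspace \<Omega>. vnorm (H \<omega>) (x' \<omega>) \<in>
          ball (vnorm (H \<omega>\<^sub>0) (x' \<omega>\<^sub>0)) (e / 4)}" (is "openin \<Omega> ?W'")
        by (rule openin_continuous_map_preimage) auto
      show "\<exists>W. openin \<Omega> W \<and> \<omega>\<^sub>0 \<in> W \<and>
          (\<forall>\<omega>\<in>W. \<bar>vnorm (H \<omega>) (x \<omega>) - vnorm (H \<omega>\<^sub>0) (x \<omega>\<^sub>0)\<bar> < e)"
      proof (intro exI[of _ "W \<inter> ?W'"] conjI ballI)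
        fix \<omega> assume "\<omega> \<in> W \<inter> ?W'"
        then have "\<omega> \<in> W" "\<bar>vnorm (H \<omega>) (x' \<omega>) - vnorm (H \<omega>\<^sub>0) (x' \<omega>\<^sub>0)\<bar> < e / 4"
          by (auto simp: dist_real_def abs_minus_commute)
        then show "\<bar>vnorm (H \<omega>) (x \<omega>) - vnorm (H \<omega>\<^sub>0) (x \<omega>\<^sub>0)\<bar> < e"
          using le[OF \<open>\<omega> \<in> W\<close>] le[OF 1(3)] a(2) by linarith
      qed (use 1 op a in auto)
    qed
  qed
  moreover have "x \<in> \<Gamma>" if x: "x \<in> ?P" "locally_approximable \<Omega> H \<Gamma> x" for x
  proof -
    have "locally_approximable \<Omega> H \<Lambda> x"
      unfolding locally_approximable_def
    proof (intro ballI allI impI)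
      fix \<omega>\<^sub>0 and e :: real assume a: "\<omega>\<^sub>0 \<in> topspace \<Omega>" "e > 0"
      obtain y W1 where 1: "y \<in> \<Gamma>" "openin \<Omega> W1" "\<omega>\<^sub>0 \<in> W1"
        "\<And>\<omega>. \<omega> \<in> W1 \<Longrightarrow> vdist (H \<omega>) (x \<omega>) (y \<omega>) \<le> e / 2"
        using x(2) a unfolding locally_approximable_def by (metis half_gt_zero)
      obtain y' W2 where 2: "y' \<in> \<Lambda>" "openin \<Omega> W2" "\<omega>\<^sub>0 \<in> W2"
        "\<And>\<omega>. \<omega> \<in> W2 \<Longrightarrow> vdist (H \<omega>) (y \<omega>) (y' \<omega>) \<le> e / 2"
        using approxD[OF 1(1) a(1), of "e / 2"] a by auto
      show "\<exists>x'\<in>\<Lambda>. \<exists>W. openin \<Omega> W \<and> \<omega>\<^sub>0 \<in> W \<and> (\<forall>\<omega>\<in>W. vdist (H \<omega>) (x \<omega>) (x' \<omega>) \<le> e)"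
      proof (intro bexI[of _ y'] exI[of _ "W1 \<inter> W2"] conjI ballI)
        fix \<omega> assume w: "\<omega> \<in> W1 \<inter> W2"
        then have t: "\<omega> \<in> topspace \<Omega>" using 1 nhd by blast
        then have "x \<omega> \<in> vecs (H \<omega>)" using x by auto
        then show "vdist (H \<omega>) (x \<omega>) (y' \<omega>) \<le> e"
          using pre_hilbert.dist_triangle[OF pre[OF t] _ \<Gamma>v[OF 1(1) t] \<Lambda>v[OF 2(1) t], of "x \<omega>"]
            1(4)[of \<omega>] 2(4)[of \<omega>] w by auto
      qed (use 1 2 in auto)
    qed
    then show ?thesis using x by (simp add: \<Gamma>_def)
  qed
  ultimately have field: "continuous_field \<Omega> H \<Gamma>"
    unfolding continuous_field_def using lc hilbert by blast
  show ?thesis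
  proof (rule ex1I[of _ \<Gamma>])
    show "\<Lambda> \<subseteq> \<Gamma> \<and> continuous_field \<Omega> H \<Gamma>" using field \<open>\<Lambda> \<subseteq> \<Gamma>\<close> by blast
    fix \<Gamma>' assume "\<Lambda> \<subseteq> \<Gamma>' \<and> continuous_field \<Omega> H \<Gamma>'"
    then have sub': "\<Lambda> \<subseteq> \<Gamma>'" and field': "section_subspace \<Omega> H \<Gamma>'" "norm_continuous \<Omega> H \<Gamma>'"
      "\<And>x. x \<in> ?P \<Longrightarrow> locally_approximable \<Omega> H \<Gamma>' x \<Longrightarrow> x \<in> \<Gamma>'"
      unfolding continuous_field_def by blast+
    show "\<Gamma>' = \<Gamma>"
    proof
      have "locally_approximable \<Omega> H \<Gamma>' x" if "locally_approximable \<Omega> H \<Lambda> x" for x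
        using that sub' unfolding locally_approximable_def by (meson subsetD)
      then show "\<Gamma> \<subseteq> \<Gamma>'" using field'(3) by (auto simp: \<Gamma>_def)
    next
      show "\<Gamma>' \<subseteq> \<Gamma>"
      proof
        fix x assume x: "x \<in> \<Gamma>'"
        have xP: "x \<in> ?P" using x field'(1) by (auto simp: section_subspace_def)
        have "locally_approximable \<Omega> H \<Lambda> x"
          unfolding locally_approximable_def
        proof (intro ballI allI impI)
          fix \<omega>\<^sub>0 and e :: real assume a: "\<omega>\<^sub>0 \<in> topspace \<Omega>" "e > 0"
          have x0: "x \<omega>\<^sub>0 \<in> vecs (H \<omega>\<^sub>0)" using xP a by auto
          then obtain y where y: "y \<in> \<Lambda>" "vdist (H \<omega>\<^sub>0) (y \<omega>\<^sub>0) (x \<omega>\<^sub>0) < e"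
            using dense a unfolding fibrewise_dense_def by blast
          \<comment> \<open>The difference of \<open>x\<close> and \<open>y\<close>, which lies in
            the competing field, so that its norm is continuous and stays below \<open>e\<close>
            near the given point.\<close>
          let ?z = "\<lambda>\<omega>\<in>topspace \<Omega>. vadd (H \<omega>) (x \<omega>)
            ((\<lambda>\<omega>\<in>topspace \<Omega>. vscale (H \<omega>) (-1) (y \<omega>)) \<omega>)"
          have "?z \<in> \<Gamma>'"
            using field'(1) x sub' y(1) unfolding section_subspace_def by blast
          with field'(2) have "continuous_map \<Omega> euclideanreal (\<lambda>\<omega>. vnorm (H \<omega>) (?z \<omega>))"
            unfolding norm_continuous_def by (rule bspec)
          then have op: "openin \<Omega> {\<omega> \<in> topspace \<Omega>. vnorm (H \<omega>) (?z \<omega>) \<in> {..<e}}"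
            by (rule openin_continuous_map_preimage) auto
          have eq: "vnorm (H \<omega>) (?z \<omega>) = vdist (H \<omega>) (x \<omega>) (y \<omega>)" if "\<omega> \<in> topspace \<Omega>" for \<omega>
            using that by (simp add: vdist_def vdiff_def)
          show "\<exists>x'\<in>\<Lambda>. \<exists>W. openin \<Omega> W \<and> \<omega>\<^sub>0 \<in> W \<and> (\<forall>\<omega>\<in>W. vdist (H \<omega>) (x \<omega>) (x' \<omega>) \<le> e)"
          proof (intro bexI[of _ y] exI conjI, rule op)
            show "\<omega>\<^sub>0 \<in> {\<omega> \<in> topspace \<Omega>. vnorm (H \<omega>) (?z \<omega>) \<in> {..<e}}"
              using a y(2) pre_hilbert.dist_commute[OF pre[OF a(1)] x0 \<Lambda>v[OF y(1) a(1)]] eq[OF a(1)]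
              by simp
          qed (use y eq in \<open>auto intro: less_imp_le\<close>)
        qed
        then show "x \<in> \<Gamma>" using xP by (simp add: \<Gamma>_def)
      qed
    qed
  qed
qed

section \<open>The space $L^2$ of a finite measure\<close>

lemma borel_measurable_cnj [measurable (raw)]:
  "f \<in> borel_measurable M \<Longrightarrow> (\<lambda>z. cnj (f z)) \<in> borel_measurable M"
  by (rule measurable_compose[OF _ borel_measurable_continuous_onI]) (auto intro: continuous_intros)

context
  fixes M :: "'a measure"
begin

lemma square_integrable_measurable: "square_integrable M f \<Longrightarrow> f \<in> borel_measurable M"
  by (simp add: square_integrable_def)

lemma square_integrable_add:
  assumes "square_integrable M f" "square_integrable M g"
  shows "square_integrable M (\<lambda>z. f z + g z)"
proof -
  have m[measurable]: "f \<in> borel_measurable M" "g \<in> borel_measurable M"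
    using assms by (simp_all add: square_integrable_def)
  have "integrable M (\<lambda>z. (cmod (f z + g z))\<^sup>2)"
  proof (rule Bochner_Integration.integrable_bound)
    show "integrable M (\<lambda>z. 2 * (cmod (f z))\<^sup>2 + 2 * (cmod (g z))\<^sup>2)"
      using assms by (simp add: square_integrable_def)
    show "AE z in M. norm ((cmod (f z + g z))\<^sup>2) \<le> norm (2 * (cmod (f z))\<^sup>2 + 2 * (cmod (g z))\<^sup>2)"
    proof (intro always_eventually allI)
      fix z
      have "(cmod (f z + g z))\<^sup>2 \<le> (cmod (f z) + cmod (g z))\<^sup>2"
        by (intro power_mono norm_triangle_ineq) simp
      also have "\<dots> \<le> 2 * (cmod (f z))\<^sup>2 + 2 * (cmod (g z))\<^sup>2"
        using sum_squares_bound[of "cmod (f z)" "cmod (g z)"] by (simp add: power2_sum)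
      finally show "norm ((cmod (f z + g z))\<^sup>2) \<le> norm (2 * (cmod (f z))\<^sup>2 + 2 * (cmod (g z))\<^sup>2)"
        by simp
    qed
  qed simp
  then show ?thesis by (simp add: square_integrable_def)
qed

lemma square_integrable_scale:
  "square_integrable M f \<Longrightarrow> square_integrable M (\<lambda>z. c * f z)"
  by (auto simp: square_integrable_def norm_mult power_mult_distrib)

lemma square_integrable_zero: "square_integrable M (\<lambda>_. 0)"
  by (simp add: square_integrable_def)

lemma square_integrable_diff:
  "\<lbrakk>square_integrable M f; square_integrable M g\<rbrakk> \<Longrightarrow> square_integrable M (\<lambda>z. f z - g z)"
  using square_integrable_add[OF _ square_integrable_scale[of g "-1"], of f] by simp

lemma square_integrable_mult_cnj:
  assumes "square_integrable M f" "square_integrable M g"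
  shows "integrable M (\<lambda>z. f z * cnj (g z))"
proof (rule Bochner_Integration.integrable_bound)
  have m[measurable]: "f \<in> borel_measurable M" "g \<in> borel_measurable M"
    using assms by (simp_all add: square_integrable_def)
  show "integrable M (\<lambda>z. (cmod (f z))\<^sup>2 + (cmod (g z))\<^sup>2)"
    using assms by (simp add: square_integrable_def)
  show "(\<lambda>z. f z * cnj (g z)) \<in> borel_measurable M" by simp
  show "AE z in M. norm (f z * cnj (g z)) \<le> norm ((cmod (f z))\<^sup>2 + (cmod (g z))\<^sup>2)"
  proof (intro always_eventually allI)
    fix z
    have "2 * cmod (f z) * cmod (g z) \<le> (cmod (f z))\<^sup>2 + (cmod (g z))\<^sup>2" by (rule sum_squares_bound)
    moreover have "0 \<le> cmod (f z) * cmod (g z)" by simp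
    ultimately have "cmod (f z) * cmod (g z) \<le> (cmod (f z))\<^sup>2 + (cmod (g z))\<^sup>2" by linarith
    then show "norm (f z * cnj (g z)) \<le> norm ((cmod (f z))\<^sup>2 + (cmod (g z))\<^sup>2)"
      by (simp add: norm_mult)
  qed
qed

lemma ae_class_eqI:
  assumes "f \<in> borel_measurable M" "g \<in> borel_measurable M" "AE z in M. f z = g z"
  shows "ae_class M f = ae_class M g"
proof -
  have "(AE z in M. f z = h z) \<longleftrightarrow> (AE z in M. g z = h z)" for h
    using assms(3) by (rule eventually_subst[OF eventually_mono]) auto
  then show ?thesis by (simp add: ae_class_def)
qed

lemma class_rep_ae:
  assumes "f \<in> borel_measurable M"
  shows class_rep_measurable: "class_rep (ae_class M f) \<in> borel_measurable M"
    and class_rep_AE: "AE z in M. class_rep (ae_class M f) z = f z"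
proof -
  have "class_rep (ae_class M f) \<in> ae_class M f"
    unfolding class_rep_def by (rule someI[of _ f]) (simp add: ae_class_def assms)
  then show "class_rep (ae_class M f) \<in> borel_measurable M"
    "AE z in M. class_rep (ae_class M f) z = f z"
    by (auto simp: ae_class_def eq_commute)
qed

lemma L2_vecs: "vecs (L2 M) = ae_class M ` {f. square_integrable M f}"
  and L2_zero: "vzero (L2 M) = ae_class M (\<lambda>_. 0)"
  by (simp_all add: L2_def)

lemma L2_add:
  assumes f: "f \<in> borel_measurable M" and g: "g \<in> borel_measurable M"
  shows "vadd (L2 M) (ae_class M f) (ae_class M g) = ae_class M (\<lambda>z. f z + g z)"
  unfolding L2_def cspace.simps
  using class_rep_AE[OF f] class_rep_AE[OF g] class_rep_measurable[OF f] class_rep_measurable[OF g] f g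
  by (intro ae_class_eqI) auto

lemma L2_scale:
  assumes f: "f \<in> borel_measurable M"
  shows "vscale (L2 M) c (ae_class M f) = ae_class M (\<lambda>z. c * f z)"
  unfolding L2_def cspace.simps
  using class_rep_AE[OF f] class_rep_measurable[OF f] f
  by (intro ae_class_eqI) auto

lemma L2_inner:
  assumes f: "f \<in> borel_measurable M" and g: "g \<in> borel_measurable M"
  shows "vinner (L2 M) (ae_class M f) (ae_class M g) = (\<integral>z. f z * cnj (g z) \<partial>M)"
  unfolding L2_def cspace.simps
  using class_rep_AE[OF f] class_rep_AE[OF g]
  by (intro integral_cong_AE borel_measurable_times borel_measurable_cnj
      class_rep_measurable f g) auto

lemma L2_diff:
  "\<lbrakk>f \<in> borel_measurable M; g \<in> borel_measurable M\<rbrakk> \<Longrightarrow>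
    vdiff (L2 M) (ae_class M f) (ae_class M g) = ae_class M (\<lambda>z. f z - g z)"
  by (simp add: vdiff_def L2_add L2_scale)

lemma L2_norm:
  assumes "f \<in> borel_measurable M"
  shows "vnorm (L2 M) (ae_class M f) = sqrt (\<integral>z. (cmod (f z))\<^sup>2 \<partial>M)"
proof -
  have "(\<integral>z. f z * cnj (f z) \<partial>M) = of_real (\<integral>z. (cmod (f z))\<^sup>2 \<partial>M)"
    by (simp only: complex_norm_square[symmetric] integral_complex_of_real)
  then show ?thesis using assms by (simp add: vnorm_def L2_inner)
qed

lemma L2_dist:
  "\<lbrakk>f \<in> borel_measurable M; g \<in> borel_measurable M\<rbrakk> \<Longrightarrow>
    vdist (L2 M) (ae_class M f) (ae_class M g) = sqrt (\<integral>z. (cmod (f z - g z))\<^sup>2 \<partial>M)"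
  by (simp add: vdist_def L2_diff L2_norm)

lemma pre_hilbert_L2: "pre_hilbert (L2 M)"
proof -
  let ?H = "L2 M"
  show ?thesis
  proof
    fix x y z c d
    note eqs = L2_vecs L2_zero L2_add L2_scale square_integrable_add square_integrable_scale
      square_integrable_measurable square_integrable_zero
    show "vzero ?H \<in> vecs ?H" by (auto simp: eqs)
    assume "x \<in> vecs ?H"
    then obtain f where x: "x = ae_class M f" "square_integrable M f" by (auto simp: L2_vecs)
    note m = square_integrable_measurable[OF x(2)]
    show "vscale ?H c x \<in> vecs ?H"
      using x(2) unfolding x(1) by (auto simp: eqs)
    show "vadd ?H x (vzero ?H) = x" "vdiff ?H x x = vzero ?H"
      "vscale ?H (c + d) x = vadd ?H (vscale ?H c x) (vscale ?H d x)"
      "vscale ?H c (vscale ?H d x) = vscale ?H (c * d) x" "vscale ?H 1 x = x"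
      using m unfolding x(1) by (simp_all add: L2_zero L2_add L2_scale L2_diff algebra_simps)
    have "(\<integral>z. f z * cnj (f z) \<partial>M) = of_real (\<integral>z. (cmod (f z))\<^sup>2 \<partial>M)"
      by (simp only: complex_norm_square[symmetric] integral_complex_of_real)
    then show "Re (vinner ?H x x) \<ge> 0" using m unfolding x(1) by (simp add: L2_inner)
    assume "y \<in> vecs ?H"
    then obtain g where y: "y = ae_class M g" "square_integrable M g" by (auto simp: L2_vecs)
    note m = m square_integrable_measurable[OF y(2)]
    show "vadd ?H x y \<in> vecs ?H" using x(2) y(2) unfolding x(1) y(1) by (auto simp: eqs)
    show "vscale ?H c (vadd ?H x y) = vadd ?H (vscale ?H c x) (vscale ?H c y)"
      "vadd ?H x y = vadd ?H y x"
      using m unfolding x(1) y(1) by (simp_all add: L2_zero L2_add L2_scale algebra_simps)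
    show "vinner ?H (vscale ?H c x) y = c * vinner ?H x y"
      using m unfolding x(1) y(1) by (simp add: L2_scale L2_inner mult.assoc)
    have "(\<integral>z. f z * cnj (g z) \<partial>M) = (\<integral>z. cnj (g z * cnj (f z)) \<partial>M)"
      by (simp add: mult.commute)
    also have "\<dots> = cnj (\<integral>z. g z * cnj (f z) \<partial>M)" by (rule Bochner_Integration.integral_cnj)
    finally show "vinner ?H x y = cnj (vinner ?H y x)"
      using m unfolding x(1) y(1) by (simp add: L2_inner)
    assume "z \<in> vecs ?H"
    then obtain h where z: "z = ae_class M h" "square_integrable M h" by (auto simp: L2_vecs)
    note m = m square_integrable_measurable[OF z(2)]
    show "vadd ?H (vadd ?H x y) z = vadd ?H x (vadd ?H y z)"
      using m unfolding x(1) y(1) z(1) by (simp add: L2_add add.assoc)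
    show "vinner ?H (vadd ?H x y) z = vinner ?H x z + vinner ?H y z"
      using m square_integrable_mult_cnj[OF x(2) z(2)] square_integrable_mult_cnj[OF y(2) z(2)]
      unfolding x(1) y(1) z(1) by (simp add: L2_add L2_inner distrib_right)
  qed
qed

lemma square_integrable_bounded:
  assumes "finite_measure M" "f \<in> borel_measurable M" "\<And>z. z \<in> space M \<Longrightarrow> cmod (f z) \<le> B"
  shows "square_integrable M f"
proof -
  interpret finite_measure M by fact
  have "integrable M (\<lambda>z. (cmod (f z))\<^sup>2)"
    using assms by (intro integrable_const_bound[of _ "B\<^sup>2"]) (auto intro!: AE_I2 power_mono)
  then show ?thesis using assms by (simp add: square_integrable_def)
qed

text \<open>Cauchy-Schwarz against the constant function 1. It turns Cauchy sequences in
  \<open>L2\<close> into Cauchy sequences in \<open>L1\<close>, for which almost everywhere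
  convergent subsequences are available.\<close>

lemma L1_le_L2:
  assumes "finite_measure M" "square_integrable M f"
  shows "integrable M f"
    and "(\<integral>z. cmod (f z) \<partial>M) \<le> sqrt (\<integral>z. (cmod (f z))\<^sup>2 \<partial>M) * sqrt (measure M (space M))"
proof -
  interpret finite_measure M by fact
  interpret pre_hilbert "L2 M" by (rule pre_hilbert_L2)
  have [measurable]: "f \<in> borel_measurable M" using assms(2) by (rule square_integrable_measurable)
  let ?a = "\<lambda>z. complex_of_real (cmod (f z))"
  have a: "square_integrable M ?a"
    using assms(2) by (simp add: square_integrable_def)
  have one: "square_integrable M (\<lambda>_. 1)"
    by (rule square_integrable_bounded[OF assms(1), of _ 1]) auto
  have "integrable M (\<lambda>z. complex_of_real (cmod (f z)))"
    using square_integrable_mult_cnj[OF a one] by simp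
  then have "integrable M (\<lambda>z. cmod (f z))" by (simp only: complex_of_real_integrable_eq)
  then show "integrable M f" by (simp add: integrable_norm_iff)
  have "cmod (vinner (L2 M) (ae_class M ?a) (ae_class M (\<lambda>_. 1))) \<le>
      vnorm (L2 M) (ae_class M ?a) * vnorm (L2 M) (ae_class M (\<lambda>_. 1))"
    using a one by (intro Cauchy_Schwarz) (auto simp: L2_vecs)
  moreover have "0 \<le> (\<integral>z. cmod (f z) \<partial>M)" by (intro Bochner_Integration.integral_nonneg) auto
  ultimately show "(\<integral>z. cmod (f z) \<partial>M) \<le> sqrt (\<integral>z. (cmod (f z))\<^sup>2 \<partial>M) * sqrt (measure M (space M))"
    by (simp add: L2_inner L2_norm integral_complex_of_real)
qed

text \<open>Riesz-Fischer: a subsequence converges almost everywhere, and Fatou's lemma carries the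
  Cauchy estimate over to its limit.\<close>

lemma hilbert_space_L2:
  assumes fin: "finite_measure M"
  shows "hilbert_space (L2 M)"
  unfolding hilbert_space_iff
proof (intro conjI ballI allI impI)
  let ?H = "L2 M"
  interpret finite_measure M by fact
  interpret H: pre_hilbert ?H by (rule pre_hilbert_L2)
  show "pre_hilbert ?H" by (rule pre_hilbert_L2)
  show "x = vzero ?H" if x: "x \<in> vecs ?H" "vinner ?H x x = 0" for x
  proof -
    obtain f where f: "x = ae_class M f" "square_integrable M f" using x(1) by (auto simp: L2_vecs)
    note m = square_integrable_measurable[OF f(2)]
    have "vnorm ?H x = 0" using x(2) by (simp add: vnorm_def)
    then have "(\<integral>z. (cmod (f z))\<^sup>2 \<partial>M) = 0" using m by (simp add: f(1) L2_norm)
    then have "AE z in M. f z = 0"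
      using f(2) by (subst (asm) integral_nonneg_eq_0_iff_AE) (auto simp: square_integrable_def)
    then show ?thesis unfolding f(1) L2_zero using m by (intro ae_class_eqI) auto
  qed
  fix X assume X: "vcauchy ?H X"
  have "\<forall>n. \<exists>f. square_integrable M f \<and> X n = ae_class M f"
    using H.vcauchy_closed[OF X] by (auto simp: L2_vecs)
  then obtain F where F: "\<And>n. square_integrable M (F n)" "\<And>n. X n = ae_class M (F n)" by metis
  have [measurable]: "F n \<in> borel_measurable M" for n by (rule square_integrable_measurable[OF F(1)])
  have cauchy: "\<exists>N. \<forall>i\<ge>N. \<forall>j\<ge>N. sqrt (\<integral>z. (cmod (F i z - F j z))\<^sup>2 \<partial>M) < e" if "e > 0" for e
    using H.vcauchyD[OF X that] by (simp add: F(2) L2_dist)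
  \<comment> \<open>The constant of the comparison of \<open>L1\<close> with \<open>L2\<close>, made
    positive so that it can be divided by even if the measure is 0.\<close>
  define C where "C = sqrt (measure M (space M)) + 1"
  have C: "C > 0" unfolding C_def by (simp add: add_nonneg_pos)
  obtain r where r: "strict_mono r" "AE x in M. Cauchy (\<lambda>i. F (r i) x)"
  proof (rule cauchy_L1_AE_cauchy_subseq[of M F])
    show "integrable M (F n)" for n by (rule L1_le_L2(1)[OF fin F(1)])
    fix e :: real assume "e > 0"
    then obtain N where N: "\<And>i j. i \<ge> N \<Longrightarrow> j \<ge> N \<Longrightarrow> sqrt (\<integral>z. (cmod (F i z - F j z))\<^sup>2 \<partial>M) < e / C"
      using cauchy[of "e / C"] C by auto
    have "(\<integral>z. cmod (F i z - F j z) \<partial>M) < e" if "i \<ge> N" "j \<ge> N" for i j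
    proof -
      have "(\<integral>z. cmod (F i z - F j z) \<partial>M) \<le>
          sqrt (\<integral>z. (cmod (F i z - F j z))\<^sup>2 \<partial>M) * sqrt (measure M (space M))"
        by (rule L1_le_L2(2)[OF fin square_integrable_diff[OF F(1) F(1)]])
      also have "\<dots> \<le> sqrt (\<integral>z. (cmod (F i z - F j z))\<^sup>2 \<partial>M) * C"
        by (intro mult_left_mono) (auto simp: C_def)
      also have "\<dots> < e" using N[OF that] C by (simp add: field_simps)
      finally show ?thesis .
    qed
    then show "\<exists>N. \<forall>i\<ge>N. \<forall>j\<ge>N. (\<integral>z. norm (F i z - F j z) \<partial>M) < e" by blast
  qed
  \<comment> \<open>Where the subsequence diverges, this value is arbitrary; such points form a null
    set.\<close>
  define f where "f z = lim (\<lambda>i. F (r i) z)" for z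
  have [measurable]: "f \<in> borel_measurable M" unfolding f_def by measurable
  have lim: "AE z in M. (\<lambda>i. F (r i) z) \<longlonglongrightarrow> f z"
    using r(2) by eventually_elim (simp add: f_def Cauchy_convergent_iff convergent_LIMSEQ_iff)
  \<comment> \<open>The bound holds for \<open>F (r i)\<close> once \<open>i \<ge> N\<close>,
    because \<open>r i \<ge> i\<close>. The limit inferior over \<open>i\<close> then gives it for
    \<open>f\<close>, whose square integrability is not known yet; hence the integrals with values
    in \<open>ennreal\<close>.\<close>
  have Fatou: "(\<integral>\<^sup>+z. ennreal ((cmod (F n z - f z))\<^sup>2) \<partial>M) \<le> ennreal (e\<^sup>2)"
    if N: "\<And>i. i \<ge> N \<Longrightarrow> sqrt (\<integral>z. (cmod (F n z - F i z))\<^sup>2 \<partial>M) \<le> e" for n N e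
  proof -
    have le: "(\<integral>\<^sup>+z. ennreal ((cmod (F n z - F (r i) z))\<^sup>2) \<partial>M) \<le> ennreal (e\<^sup>2)" if "i \<ge> N" for i
    proof -
      have "r i \<ge> N" using that seq_suble[OF r(1), of i] by simp
      then have "(\<integral>z. (cmod (F n z - F (r i) z))\<^sup>2 \<partial>M) \<le> e\<^sup>2"
        using N[of "r i"] by (simp add: sqrt_le_D)
      moreover have "integrable M (\<lambda>z. (cmod (F n z - F (r i) z))\<^sup>2)"
        using square_integrable_diff[OF F(1) F(1), of n "r i"] by (simp add: square_integrable_def)
      ultimately show ?thesis by (subst nn_integral_eq_integral) (auto intro!: ennreal_leI)
    qed
    have "(\<integral>\<^sup>+z. ennreal ((cmod (F n z - f z))\<^sup>2) \<partial>M) =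
        (\<integral>\<^sup>+z. liminf (\<lambda>i. ennreal ((cmod (F n z - F (r i) z))\<^sup>2)) \<partial>M)"
    proof (rule nn_integral_cong_AE)
      show "AE z in M. ennreal ((cmod (F n z - f z))\<^sup>2) =
          liminf (\<lambda>i. ennreal ((cmod (F n z - F (r i) z))\<^sup>2))"
        using lim
      proof eventually_elim
        case (elim z)
        have "(\<lambda>i. ennreal ((cmod (F n z - F (r i) z))\<^sup>2)) \<longlonglongrightarrow> ennreal ((cmod (F n z - f z))\<^sup>2)"
          by (intro tendsto_ennrealI tendsto_intros elim)
        then show ?case by (intro lim_imp_Liminf[symmetric]) simp_all
      qed
    qed
    also have "\<dots> \<le> liminf (\<lambda>i. \<integral>\<^sup>+z. ennreal ((cmod (F n z - F (r i) z))\<^sup>2) \<partial>M)"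
      by (rule nn_integral_liminf) measurable
    also have "\<dots> \<le> ennreal (e\<^sup>2)"
    proof -
      have "liminf (\<lambda>i. \<integral>\<^sup>+z. ennreal ((cmod (F n z - F (r i) z))\<^sup>2) \<partial>M) \<le> liminf (\<lambda>i. ennreal (e\<^sup>2))"
        by (rule Liminf_mono) (auto simp: eventually_sequentially intro!: exI[of _ N] le)
      then show ?thesis by (simp add: Liminf_const)
    qed
    finally show ?thesis .
  qed
  have dist: "\<exists>N. \<forall>n\<ge>N. integrable M (\<lambda>z. (cmod (F n z - f z))\<^sup>2) \<and>
      sqrt (\<integral>z. (cmod (F n z - f z))\<^sup>2 \<partial>M) \<le> e" if e: "e > 0" for e
  proof -
    obtain N where N: "\<And>i j. i \<ge> N \<Longrightarrow> j \<ge> N \<Longrightarrow> sqrt (\<integral>z. (cmod (F i z - F j z))\<^sup>2 \<partial>M) < e"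
      using cauchy[OF e] by auto
    have "integrable M (\<lambda>z. (cmod (F n z - f z))\<^sup>2) \<and> sqrt (\<integral>z. (cmod (F n z - f z))\<^sup>2 \<partial>M) \<le> e"
      if "n \<ge> N" for n
    proof -
      have le: "(\<integral>\<^sup>+z. ennreal ((cmod (F n z - f z))\<^sup>2) \<partial>M) \<le> ennreal (e\<^sup>2)"
        by (rule Fatou[of N]) (rule less_imp_le[OF N[OF that]])
      have int: "integrable M (\<lambda>z. (cmod (F n z - f z))\<^sup>2)"
        using le by (intro integrableI_nonneg) (auto simp: le_less_trans)
      then have "ennreal (\<integral>z. (cmod (F n z - f z))\<^sup>2 \<partial>M) \<le> ennreal (e\<^sup>2)"
        using le by (simp add: nn_integral_eq_integral)
      then have "(\<integral>z. (cmod (F n z - f z))\<^sup>2 \<partial>M) \<le> e\<^sup>2" by (simp add: ennreal_le_iff)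
      then show ?thesis using int e by (simp add: real_le_lsqrt)
    qed
    then show ?thesis by blast
  qed
  obtain n where "integrable M (\<lambda>z. (cmod (F n z - f z))\<^sup>2)" using dist[of 1] by auto
  then have "square_integrable M (\<lambda>z. F n z - f z)" by (simp add: square_integrable_def)
  from square_integrable_diff[OF F(1)[of n] this] have f: "square_integrable M f" by simp
  have "(\<lambda>n. vdist ?H (X n) (ae_class M f)) \<longlonglongrightarrow> 0"
  proof (rule LIMSEQ_I)
    fix e :: real assume "e > 0"
    then obtain N where "\<And>n. n \<ge> N \<Longrightarrow> sqrt (\<integral>z. (cmod (F n z - f z))\<^sup>2 \<partial>M) \<le> e / 2"
      using dist[of "e / 2"] by auto
    then show "\<exists>N. \<forall>n\<ge>N. norm (vdist ?H (X n) (ae_class M f) - 0) < e"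
      using \<open>e > 0\<close> by (intro exI[of _ N]) (fastforce simp: F(2) L2_dist)
  qed
  then show "\<exists>x\<in>vecs ?H. (\<lambda>n. vdist ?H (X n) x) \<longlonglongrightarrow> 0"
    using f by (intro bexI[of _ "ae_class M f"]) (auto simp: L2_vecs)
qed

end

section \<open>Integration in polar coordinates\<close>

text \<open>An isometry maps a ball to a ball of the same radius, hence of the same measure, and by Vitali's
  theorem disjoint balls exhaust an open set up to a null set.\<close>

lemma emeasure_isometry_image_ge:
  fixes T :: "'a::euclidean_space \<Rightarrow> 'a"
  assumes iso: "\<And>x y. dist (T x) (T y) = dist x y" and surj: "surj T" and U: "open U"
  shows "emeasure lborel U \<le> emeasure lborel (T ` U)"
proof -
  have inj: "inj T" by (rule injI) (metis iso dist_eq_0_iff)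
  have ball: "T ` ball c r = ball (T c) r" for c r
  proof
    show "ball (T c) r \<subseteq> T ` ball c r"
    proof
      fix y assume "y \<in> ball (T c) r"
      moreover obtain x where "y = T x" using surj by (metis surjD)
      ultimately show "y \<in> T ` ball c r" using iso by auto
    qed
  qed (auto simp: iso)
  let ?K = "{(c, r). r > 0 \<and> ball c r \<subseteq> U}"
  obtain C where C: "countable C" "C \<subseteq> ?K"
     "pairwise (\<lambda>i j. disjnt (ball (fst i) (snd i)) (ball (fst j) (snd j))) C"
     "negligible (U - (\<Union>i \<in> C. ball (fst i) (snd i)))"
  proof (rule Vitali_covering_theorem_balls[of U ?K fst snd])
    fix x and d :: real assume x: "x \<in> U" "0 < d"
    then obtain e where "e > 0" "ball x e \<subseteq> U" using U openE by blast
    then show "\<exists>i. i \<in> ?K \<and> x \<in> ball (fst i) (snd i) \<and> snd i < d"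
      using x by (intro exI[of _ "(x, min e (d / 2))"]) auto
  qed
  let ?B = "\<lambda>i. ball (fst i) (snd i)" and ?B' = "\<lambda>i. ball (T (fst i)) (snd i)"
  have dis: "disjoint_family_on ?B C"
    using C(3) by (auto simp: disjoint_family_on_def pairwise_def disjnt_def)
  have dis': "disjoint_family_on ?B' C"
    using C(3) inj unfolding disjoint_family_on_def pairwise_def disjnt_def ball[symmetric]
    by (metis image_Int image_empty)
  have null: "U - (\<Union>i\<in>C. ?B i) \<in> null_sets lborel"
  proof -
    have "U - (\<Union>i\<in>C. ?B i) \<in> sets lborel"
      using U by (intro sets.Diff) (auto intro!: borel_open open_UN)
    then show ?thesis
      using C(4) by (simp add: null_sets_completion_iff negligible_iff_null_sets)
  qed
  have "emeasure lborel U \<le> emeasure lborel ((\<Union>i\<in>C. ?B i) \<union> (U - (\<Union>i\<in>C. ?B i)))"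
    using U by (intro emeasure_mono) (auto intro!: borel_open sets.Un sets.Diff open_UN)
  also have "\<dots> = emeasure lborel (\<Union>i\<in>C. ?B i)"
    using null by (intro emeasure_Un_null_set) (auto intro!: borel_open open_UN)
  also have "\<dots> = (\<integral>\<^sup>+i. emeasure lborel (?B i) \<partial>count_space C)"
    by (rule emeasure_UN_countable) (use C dis in auto)
  also have "\<dots> = (\<integral>\<^sup>+i. emeasure lborel (?B' i) \<partial>count_space C)"
    using C(2) by (intro nn_integral_cong) (auto simp: emeasure_ball)
  also have "\<dots> = emeasure lborel (\<Union>i\<in>C. ?B' i)"
    by (rule emeasure_UN_countable[symmetric]) (use C dis' in auto)
  also have "\<dots> \<le> emeasure lborel (T ` U)"
  proof (rule emeasure_mono)
    have "?B i \<subseteq> U" if "i \<in> C" for i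
      using subsetD[OF C(2) that] by (simp add: case_prod_beta)
    then show "(\<Union>i\<in>C. ?B' i) \<subseteq> T ` U"
      unfolding ball[symmetric] by (intro UN_least image_mono)
    have "dist (inv T x) (inv T y) = dist x y" for x y
      using iso[of "inv T x" "inv T y"] surj by (simp add: surj_f_inv_f)
    then have "continuous_on UNIV (inv T)" by (intro continuous_onI) auto
    then have "open (inv T -` U)" using U by (simp add: open_vimage)
    moreover have "inv T -` U = T ` U"
      using bij_vimage_eq_inv_image[OF bij_imp_bij_inv] inv_inv_eq inj surj
      by (metis bijI)
    ultimately show "T ` U \<in> sets lborel" by simp
  qed
  finally show ?thesis .
qed

text \<open>The preceding inequality holds for \<open>T\<close> and for its inverse, and Lebesgue
  measure is determined by its values on boxes.\<close>

lemma lborel_distr_isometry: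
  fixes T :: "'a::euclidean_space \<Rightarrow> 'a"
  assumes iso: "\<And>x y. dist (T x) (T y) = dist x y" and surj: "surj T"
  shows "distr lborel borel T = lborel"
proof (rule lborel_eqI[symmetric])
  have inj: "inj T" by (rule injI) (metis iso dist_eq_0_iff)
  have cont: "continuous_on UNIV T" using iso by (intro continuous_onI) auto
  then have [measurable]: "T \<in> borel \<rightarrow>\<^sub>M borel" by (rule borel_measurable_continuous_onI)
  fix l u :: 'a assume le: "\<And>b. b \<in> Basis \<Longrightarrow> l \<bullet> b \<le> u \<bullet> b"
  have inv: "dist (inv T x) (inv T y) = dist x y" for x y
    using iso[of "inv T x" "inv T y"] surj by (simp add: surj_f_inv_f)
  have open': "open (T -` box l u)" using cont by (simp add: open_vimage open_box)
  have "T ` (T -` box l u) = box l u" using surj by simp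
  moreover have "inv T ` box l u = T -` box l u" using inj surj by (simp add: bij_def bij_vimage_eq_inv_image)
  ultimately have "emeasure lborel (T -` box l u) = emeasure lborel (box l u)"
    using emeasure_isometry_image_ge[OF iso surj open']
      emeasure_isometry_image_ge[of "inv T" "box l u", OF inv inj_imp_surj_inv[OF inj] open_box]
    by (intro antisym) simp_all
  then show "emeasure (distr lborel borel T) (box l u) = (\<Prod>b\<in>Basis. (u - l) \<bullet> b)"
    using le by (simp add: emeasure_distr)
qed simp

section \<open>Angular characters \<open>(z / |z|)^n\<close>\<close>

definition ang :: "int \<Rightarrow> complex \<Rightarrow> complex" where
  "ang n z = cis (of_int n * Arg z)"

lemma ang_zero [simp]: "ang 0 z = 1"
  by (simp add: ang_def)

lemma norm_ang [simp]: "cmod (ang n z) = 1"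
  by (simp add: ang_def)

lemma ang_add: "ang (m + n) z = ang m z * ang n z"
  by (simp add: ang_def cis_mult algebra_simps)

lemma cnj_ang: "cnj (ang n z) = ang (- n) z"
  by (simp add: ang_def cis_cnj)

lemma ang_of_nat: "ang (int n) z = ang 1 z ^ n"
  by (induction n) (simp_all add: ang_add)

lemma ang_1: "z \<noteq> 0 \<Longrightarrow> ang 1 z = sgn z"
  by (simp add: ang_def cis_Arg)

text \<open>\<open>Arg\<close> is additive only up to multiples of \<open>2 * pi\<close>. The case
  \<open>n = 1\<close> therefore uses \<open>sgn\<close>, which is multiplicative; powers and
  conjugates give the other exponents.\<close>

lemma ang_rotate:
  assumes "cmod u = 1" "z \<noteq> 0"
  shows "ang n (u * z) = ang n u * ang n z"
proof -
  have u: "u \<noteq> 0" using assms by auto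
  have 1: "ang 1 (u * z) = ang 1 u * ang 1 z" using assms u by (simp add: ang_1 sgn_mult)
  have nat: "ang (int m) (u * z) = ang (int m) u * ang (int m) z" for m
    by (simp only: ang_of_nat 1 power_mult_distrib)
  show ?thesis
  proof (cases "n \<ge> 0")
    case True
    then show ?thesis using nat[of "nat n"] by simp
  next
    case False
    then have "ang n (u * z) = cnj (ang (int (nat (- n))) (u * z))" by (simp add: cnj_ang)
    also have "\<dots> = ang n u * ang n z" unfolding nat using False by (simp add: cnj_ang)
    finally show ?thesis .
  qed
qed

text \<open>\<open>Arg\<close> jumps along the negative axis, so that measurability is read off from
  the closed form of the first character. Its value at the origin is 1 because
  \<open>Arg 0 = 0\<close>.\<close>

lemma ang_measurable [measurable]: "ang n \<in> borel_measurable borel"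
proof -
  have "ang 1 = (\<lambda>z. if z = 0 then 1 else z / of_real (cmod z))"
    by (rule ext) (simp add: ang_1 sgn_eq, simp add: ang_def Arg_zero)
  also have "\<dots> \<in> borel_measurable borel" by measurable
  finally have [measurable]: "ang 1 \<in> borel_measurable borel" .
  show ?thesis
  proof (cases "n \<ge> 0")
    case True
    have "ang n = (\<lambda>z. ang 1 z ^ nat n)" using True by (auto simp: ang_of_nat[symmetric])
    then show ?thesis by simp
  next
    case False
    have "ang n = (\<lambda>z. cnj (ang 1 z ^ nat (- n)))"
      using False by (auto simp: ang_of_nat[symmetric] cnj_ang simp del: complex_cnj_power)
    also have "\<dots> \<in> borel_measurable borel" by measurable
    finally show ?thesis .
  qed
qed

section \<open>Normalized area on an annulus, or on a disk if \<open>wm = 0\<close>\<close>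

locale annulus =
  fixes wm wp :: real
  assumes wm_nonneg: "0 \<le> wm" and wm_less_wp: "wm < wp"
begin

definition A :: "complex set" where "A = {z. wm \<le> cmod z \<and> cmod z \<le> wp}"

abbreviation D :: "complex measure" where "D \<equiv> disk_measure wm wp"

lemma A_eq: "A = cball 0 wp - ball 0 wm"
  by (auto simp: A_def)

lemma compact_A: "compact A"
  unfolding A_eq by (intro compact_diff compact_cball open_ball)

lemma A_borel [measurable]: "A \<in> sets borel"
  using compact_A by (intro borel_closed compact_imp_closed)

lemma D_def: "D = scale_measure (ennreal (1 / pi)) (lebesgue_on A)"
  by (simp add: disk_measure_def A_def)

lemma space_D [simp]: "space D = A"
  by (simp add: D_def space_scale_measure)

lemma sets_D: "sets D = sets (lebesgue_on A)"
  by (simp add: D_def)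

lemma borel_measurable_D: "borel_measurable D = borel_measurable (lebesgue_on A)"
  by (intro measurable_cong_sets sets_D refl)

text \<open>\<open>D\<close> is a measure on Lebesgue sets. Borel functions are measurable for it,
  and pushing \<open>D\<close> forward along them allows its computation with Borel sets
  only.\<close>

lemma measurable_D_borel:
  assumes "f \<in> borel \<rightarrow>\<^sub>M N"
  shows "f \<in> D \<rightarrow>\<^sub>M N"
proof -
  have "f \<in> lborel \<rightarrow>\<^sub>M N" using assms by (simp add: measurable_lborel2)
  then have "f \<in> lebesgue_on A \<rightarrow>\<^sub>M N"
    by (intro measurable_restrict_space1 measurable_completion)
  then show ?thesis by (subst measurable_cong_sets[OF sets_D refl])
qed

lemma emeasure_distr_D:
  assumes "f \<in> borel \<rightarrow>\<^sub>M N" "B \<in> sets N"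
  shows "emeasure (distr D N f) B = emeasure D (A \<inter> f -` B)"
  using emeasure_distr[OF measurable_D_borel[OF assms(1)] assms(2)] by (simp add: Int_commute)

lemma integral_distr_D:
  fixes g :: "'b \<Rightarrow> 'c::{banach, second_countable_topology}"
  assumes "f \<in> borel \<rightarrow>\<^sub>M N" "g \<in> borel_measurable N"
  shows "(\<integral>x. g x \<partial>(distr D N f)) = (\<integral>z. g (f z) \<partial>D)"
  by (rule integral_distr[OF measurable_D_borel[OF assms(1)] assms(2)])

lemma emeasure_D: "B \<in> sets borel \<Longrightarrow> emeasure D (A \<inter> B) = ennreal (1 / pi) * emeasure lborel (A \<inter> B)"
  by (simp add: D_def emeasure_restrict_space)

lemma emeasure_lborel_ball: "0 \<le> r \<Longrightarrow> emeasure lborel (ball (0::complex) r) = ennreal (pi * r\<^sup>2)"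
  and emeasure_lborel_cball: "0 \<le> r \<Longrightarrow> emeasure lborel (cball (0::complex) r) = ennreal (pi * r\<^sup>2)"
  by (simp_all add: emeasure_ball emeasure_cball unit_ball_vol_2)

lemma emeasure_lborel_A: "emeasure lborel A = ennreal (pi * (wp\<^sup>2 - wm\<^sup>2))"
proof -
  have "emeasure lborel A = emeasure lborel (cball (0::complex) wp) - emeasure lborel (ball (0::complex) wm)"
    unfolding A_eq using wm_nonneg wm_less_wp
    by (intro emeasure_Diff) (auto simp: emeasure_lborel_ball)
  then show ?thesis
    using wm_nonneg wm_less_wp
    by (simp add: emeasure_lborel_ball emeasure_lborel_cball ennreal_minus algebra_simps)
qed

lemma finite_measure_D: "finite_measure D"
proof
  show "emeasure D (space D) \<noteq> \<infinity>"
    using emeasure_D[of UNIV] by (simp add: emeasure_lborel_A ennreal_mult_eq_top_iff)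
qed

lemma AE_D_nonzero: "AE z in D. z \<noteq> 0"
proof (rule AE_I)
  show "{z \<in> space D. \<not> z \<noteq> 0} \<subseteq> A \<inter> {0}" by auto
  have "emeasure lborel (A \<inter> {0}) \<le> emeasure lborel {0::complex}" by (intro emeasure_mono) auto
  then show "emeasure D (A \<inter> {0}) = 0" by (simp add: emeasure_D)
  show "A \<inter> {0} \<in> sets D"
    by (simp add: sets_D sets_restrict_space_iff)
qed

text \<open>The radial half of polar coordinates. A disk of radius \<open>r\<close> has area
  \<open>pi * r^2\<close>, so that after division by \<open>pi\<close> the squared modulus has
  Lebesgue measure as its law. Rays determine a measure that is finite on them.\<close>

lemma distr_D_cmod_square:
  "distr D borel (\<lambda>z. (cmod z)\<^sup>2) = density lborel (indicator {wm\<^sup>2..wp\<^sup>2})"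
proof (rule measure_eqI_lessThan)
  have [measurable]: "(\<lambda>z. (cmod z)\<^sup>2) \<in> borel_measurable borel" by measurable
  interpret finite_measure D by (rule finite_measure_D)
  fix x :: real
  have dist: "emeasure (distr D borel (\<lambda>z. (cmod z)\<^sup>2)) {x<..} = emeasure D (A \<inter> {z. x < (cmod z)\<^sup>2})"
    by (subst emeasure_distr_D) (simp_all add: vimage_def greaterThan_def)
  then show "emeasure (distr D borel (\<lambda>z. (cmod z)\<^sup>2)) {x<..} < \<infinity>"
    by (simp add: less_top[symmetric])
  have sq: "wm\<^sup>2 < wp\<^sup>2" using wm_nonneg wm_less_wp by (simp add: power_strict_mono)
  have dens: "emeasure (density lborel (indicator {wm\<^sup>2..wp\<^sup>2})) {x<..} =
      emeasure lborel ({wm\<^sup>2..wp\<^sup>2} \<inter> {x<..})"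
    by (subst emeasure_density) (simp_all add: indicator_inter_arith[symmetric])
  have pi: "ennreal (1 / pi) * ennreal (pi * y) = ennreal y" if "y \<ge> 0" for y
    using that by (simp add: ennreal_mult[symmetric])
  consider "x < wm\<^sup>2" | "wm\<^sup>2 \<le> x" "x < wp\<^sup>2" | "wp\<^sup>2 \<le> x" by linarith
  then show "emeasure (distr D borel (\<lambda>z. (cmod z)\<^sup>2)) {x<..} =
      emeasure (density lborel (indicator {wm\<^sup>2..wp\<^sup>2})) {x<..}"
  proof cases
    case 1
    have "A \<inter> {z. x < (cmod z)\<^sup>2} = A \<inter> UNIV"
      using 1 wm_nonneg by (auto simp: A_def intro: less_le_trans power_mono)
    moreover have "{wm\<^sup>2..wp\<^sup>2} \<inter> {x<..} = {wm\<^sup>2..wp\<^sup>2}" using 1 by auto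
    ultimately show ?thesis
      unfolding dist dens using sq emeasure_D[of UNIV] by (simp add: emeasure_lborel_A pi)
  next
    case 2
    have x: "0 \<le> x" using 2(1) by (rule order_trans[rotated]) simp
    have less: "x < (cmod z)\<^sup>2 \<longleftrightarrow> sqrt x < cmod z" for z
      by (metis real_sqrt_less_iff real_sqrt_abs abs_norm_cancel)
    have "wm \<le> sqrt x" using 2(1) by (rule real_le_rsqrt)
    then have "A \<inter> {z. x < (cmod z)\<^sup>2} = cball 0 wp - cball 0 (sqrt x)" (is "_ = ?R")
      by (auto simp: A_def less)
    moreover have "emeasure lborel ?R = ennreal (pi * (wp\<^sup>2 - x))"
    proof -
      have le: "sqrt x \<le> wp" using 2(2) wm_nonneg wm_less_wp by (intro real_le_lsqrt) auto
      have "emeasure lborel ?R = emeasure lborel (cball (0::complex) wp) - emeasure lborel (cball (0::complex) (sqrt x))"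
        using x le by (intro emeasure_Diff) (auto simp: emeasure_lborel_cball)
      then show ?thesis
        using x wm_nonneg wm_less_wp
        by (simp add: emeasure_lborel_cball ennreal_minus algebra_simps)
    qed
    moreover have "{wm\<^sup>2..wp\<^sup>2} \<inter> {x<..} = {x<..wp\<^sup>2}" using 2 by auto
    ultimately show ?thesis
      unfolding dist dens using 2 emeasure_D[of "{z. x < (cmod z)\<^sup>2}"] by (simp add: pi)
  next
    case 3
    have "A \<inter> {z. x < (cmod z)\<^sup>2} = A \<inter> {}"
    proof -
      have "(cmod z)\<^sup>2 \<le> x" if "z \<in> A" for z
        using that 3 power_mono[of "cmod z" wp 2] by (simp add: A_def)
      then show ?thesis by (force simp: not_less[symmetric])
    qed
    moreover have "{wm\<^sup>2..wp\<^sup>2} \<inter> {x<..} = {}" using 3 by auto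
    ultimately show ?thesis unfolding dist dens by simp
  qed
qed auto

lemma integral_D_radial:
  fixes H :: "real \<Rightarrow> real"
  assumes "continuous_on {wm\<^sup>2..wp\<^sup>2} H"
  shows "(\<integral>z. H ((cmod z)\<^sup>2) \<partial>D) = integral {wm\<^sup>2..wp\<^sup>2} H"
proof -
  let ?J = "{wm\<^sup>2..wp\<^sup>2}"
  have sq: "(cmod z)\<^sup>2 \<in> ?J" if "z \<in> A" for z
    using that wm_nonneg by (auto simp: A_def intro!: power_mono)
  \<comment> \<open>\<open>H\<close> is constrained on the interval only; the indicator makes it a
    Borel function on the line.\<close>
  have [measurable]: "(\<lambda>u. indicator ?J u * H u) \<in> borel_measurable borel"
    using borel_measurable_continuous_on_indicator[OF _ assms] by simp
  have "(\<integral>z. H ((cmod z)\<^sup>2) \<partial>D) = (\<integral>z. indicator ?J ((cmod z)\<^sup>2) * H ((cmod z)\<^sup>2) \<partial>D)"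
    by (intro Bochner_Integration.integral_cong) (use sq in \<open>auto simp: indicator_def\<close>)
  also have "\<dots> = (\<integral>u. indicator ?J u * H u \<partial>(distr D borel (\<lambda>z. (cmod z)\<^sup>2)))"
    by (rule integral_distr_D[symmetric]) simp_all
  also have "\<dots> = (\<integral>u. indicator ?J u * H u \<partial>(density lborel (\<lambda>u. ennreal (indicator ?J u))))"
    by (simp add: distr_D_cmod_square ennreal_indicator[abs_def] del: ennreal_indicator)
  also have "\<dots> = (\<integral>u. indicator ?J u *\<^sub>R (indicator ?J u * H u) \<partial>lborel)"
    by (subst integral_density) auto
  also have "\<dots> = set_lebesgue_integral lborel ?J H"
    unfolding set_lebesgue_integral_def
    by (intro Bochner_Integration.integral_cong) (auto simp: indicator_def)
  also have "\<dots> = integral ?J H"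
    using assms by (intro set_borel_integral_eq_integral borel_integrable_compact) (auto simp: set_integrable_def[symmetric] borel_integrable_atLeastAtMost')
  finally show ?thesis .
qed

text \<open>Multiplication by \<open>u\<close> is a surjective isometry of the plane that preserves
  the modulus, hence both Lebesgue measure and the annulus.\<close>

lemma distr_D_rotate:
  assumes u: "cmod u = 1"
  shows "distr D borel (\<lambda>z. u * z) = distr D borel (\<lambda>z. z)"
proof (rule measure_eqI)
  fix B assume "B \<in> sets (distr D borel (\<lambda>z. u * z))"
  then have [measurable]: "B \<in> sets borel" by simp
  have rot: "distr lborel borel (\<lambda>z. u * z) = lborel"
  proof (rule lborel_distr_isometry)
    show "dist (u * x) (u * y) = dist x y" for x y
      using u by (simp add: dist_norm norm_mult flip: right_diff_distrib)
    have "u \<noteq> 0" using u by auto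
    then show "surj ((*) u)" by (intro surjI[of _ "\<lambda>z. z / u"]) simp
  qed
  have [measurable]: "(\<lambda>z. u * z) \<in> borel \<rightarrow>\<^sub>M borel" "(\<lambda>z::complex. z) \<in> borel \<rightarrow>\<^sub>M borel" by measurable
  have "emeasure (distr D borel (\<lambda>z. u * z)) B = emeasure D (A \<inter> (\<lambda>z. u * z) -` B)"
    by (rule emeasure_distr_D) simp_all
  also have "\<dots> = ennreal (1 / pi) * emeasure lborel (A \<inter> (\<lambda>z. u * z) -` B)"
    using measurable_sets[of "\<lambda>z. u * z" borel borel B] by (intro emeasure_D) auto
  also have "A \<inter> (\<lambda>z. u * z) -` B = (\<lambda>z. u * z) -` (A \<inter> B) \<inter> space lborel"
    using u by (auto simp: A_def norm_mult)
  also have "emeasure lborel \<dots> = emeasure (distr lborel borel (\<lambda>z. u * z)) (A \<inter> B)"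
    by (subst emeasure_distr) auto
  also have "\<dots> = emeasure lborel (A \<inter> B)" by (simp add: rot)
  also have "ennreal (1 / pi) * \<dots> = emeasure D (A \<inter> B)" by (simp add: emeasure_D)
  also have "\<dots> = emeasure (distr D borel (\<lambda>z. z)) B"
    by (subst emeasure_distr_D) simp_all
  finally show "emeasure (distr D borel (\<lambda>z. u * z)) B = emeasure (distr D borel (\<lambda>z. z)) B" .
qed simp

text \<open>The rotation by \<open>\<pi> / \<bar>n\<bar>\<close> preserves the measure and changes the sign of the integrand.\<close>

lemma integral_D_ang_zero:
  fixes H :: "real \<Rightarrow> complex"
  assumes [measurable]: "H \<in> borel_measurable borel" and n: "n \<noteq> 0"
  shows "(\<integral>z. H ((cmod z)\<^sup>2) * ang n z \<partial>D) = 0" (is "?I = 0")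
proof -
  define u where "u = cis (pi / of_int \<bar>n\<bar>)"
  have u: "cmod u = 1" by (simp add: u_def)
  have "pi / of_int \<bar>n\<bar> \<le> pi / 1" using n by (intro divide_left_mono) auto
  moreover have "pi / of_int \<bar>n\<bar> > 0" using n by simp
  ultimately have "Arg u = pi / of_int \<bar>n\<bar>"
    unfolding u_def by (intro Arg_cis) (auto intro: less_trans[of _ 0])
  then have "ang n u = cis (sgn (of_int n) * pi)"
    using n by (simp add: ang_def sgn_if)
  moreover have "cis (- pi) = -1" using cis_cnj[of pi] by simp
  ultimately have ang_u: "ang n u = -1" using n by (simp add: sgn_if)
  let ?G = "\<lambda>z. H ((cmod z)\<^sup>2) * ang n z"
  have [measurable]: "?G \<in> borel_measurable borel" by measurable
  have "?I = (\<integral>z. ?G z \<partial>(distr D borel (\<lambda>z. z)))"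
    by (rule integral_distr_D[symmetric]) simp_all
  also have "\<dots> = (\<integral>z. ?G z \<partial>(distr D borel (\<lambda>z. u * z)))"
    by (simp only: distr_D_rotate[OF u])
  also have "\<dots> = (\<integral>z. ?G (u * z) \<partial>D)"
    by (rule integral_distr_D) simp_all
  also have "\<dots> = (\<integral>z. - ?G z \<partial>D)"
  proof (rule integral_cong_AE)
    show "AE z in D. ?G (u * z) = - ?G z"
      using AE_D_nonzero by eventually_elim (simp add: ang_rotate u ang_u norm_mult)
  qed (rule measurable_D_borel, measurable)+
  also have "\<dots> = - ?I" by simp
  finally show ?thesis by simp
qed

abbreviation J :: "real set" where "J \<equiv> {wm\<^sup>2..wp\<^sup>2}"

lemma cmod_square_in_J: "z \<in> A \<Longrightarrow> (cmod z)\<^sup>2 \<in> J"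
  using wm_nonneg by (auto simp: A_def intro!: power_mono)

lemma J_nonempty: "wm\<^sup>2 < wp\<^sup>2"
  using wm_nonneg wm_less_wp by (simp add: power_strict_mono)

text \<open>Coefficients are arbitrary outside \<open>J\<close>. Clamping the argument to
  \<open>J\<close> replaces them by Borel functions that agree with them over the annulus.\<close>

lemma continuous_extension_J:
  fixes h :: "real \<Rightarrow> complex"
  assumes "continuous_on J h"
  obtains h' where "h' \<in> borel_measurable borel" "\<And>u. u \<in> J \<Longrightarrow> h' u = h u"
proof
  let ?h = "\<lambda>u. h (max (wm\<^sup>2) (min u (wp\<^sup>2)))"
  have "continuous_on UNIV ?h"
    by (rule continuous_on_compose2[OF assms]) (use J_nonempty in \<open>auto intro!: continuous_intros\<close>)
  then show "?h \<in> borel_measurable borel" by (rule borel_measurable_continuous_onI)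
qed auto

lemma radial_ang_measurable:
  assumes "continuous_on J h"
  shows "(\<lambda>z. h ((cmod z)\<^sup>2) * ang n z) \<in> borel_measurable D"
proof -
  obtain h' where [measurable]: "h' \<in> borel_measurable borel" and h': "\<And>u. u \<in> J \<Longrightarrow> h' u = h u"
    using continuous_extension_J[OF assms] by blast
  have "(\<lambda>z. h' ((cmod z)\<^sup>2) * ang n z) \<in> borel_measurable D"
    by (rule measurable_D_borel) measurable
  then show ?thesis
    by (rule measurable_cong[THEN iffD1, rotated]) (simp add: h'[OF cmod_square_in_J])
qed

lemma radial_ang_square_integrable:
  assumes "continuous_on J h"
  shows "square_integrable D (\<lambda>z. h ((cmod z)\<^sup>2) * ang n z)"
proof -
  have "bounded (h ` J)"
    using assms by (intro compact_imp_bounded compact_continuous_image) auto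
  then obtain B where "\<forall>u\<in>J. cmod (h u) \<le> B" by (auto simp: bounded_iff)
  then have "cmod (h ((cmod z)\<^sup>2)) \<le> B" if "z \<in> A" for z
    using cmod_square_in_J[OF that] by blast
  then show ?thesis
    by (intro square_integrable_bounded[OF finite_measure_D radial_ang_measurable[OF assms], of _ B])
      (simp add: norm_mult)
qed

section \<open>Trigonometric polynomials with radial coefficients\<close>

definition trig_poly :: "nat \<Rightarrow> (int \<Rightarrow> real \<Rightarrow> complex) \<Rightarrow> complex \<Rightarrow> complex" where
  "trig_poly N c z = (\<Sum>n\<in>{- int N..int N}. c n ((cmod z)\<^sup>2) * ang n z)"

lemma square_integrable_sum:
  "(\<And>i. i \<in> I \<Longrightarrow> square_integrable M (f i)) \<Longrightarrow> square_integrable M (\<lambda>z. \<Sum>i\<in>I. f i z)"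
  by (induction I rule: infinite_finite_induct)
    (simp_all add: square_integrable_zero square_integrable_add)

lemma trig_poly_square_integrable:
  "(\<And>n. continuous_on J (c n)) \<Longrightarrow> square_integrable D (trig_poly N c)"
  unfolding trig_poly_def[abs_def] by (intro square_integrable_sum radial_ang_square_integrable)

text \<open>Parseval: the product of one term with the conjugate of another is a radial function
  times a character, which integrates to 0 unless the two exponents agree.\<close>

lemma integral_trig_poly:
  assumes c: "\<And>n. continuous_on J (c n)"
  shows "(\<integral>z. (cmod (trig_poly N c z))\<^sup>2 \<partial>D) =
    (\<Sum>n\<in>{- int N..int N}. integral J (\<lambda>u. (cmod (c n u))\<^sup>2))"
proof -
  let ?N = "{- int N..int N}"
  let ?t = "\<lambda>n z. c n ((cmod z)\<^sup>2) * ang n z"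
  have entry: "(\<integral>z. ?t m z * cnj (?t n z) \<partial>D) =
      (if n = m then of_real (integral J (\<lambda>u. (cmod (c n u))\<^sup>2)) else 0)" for m n
  proof (cases "n = m")
    case True
    have "(\<integral>z. ?t m z * cnj (?t n z) \<partial>D) = (\<integral>z. of_real ((cmod (c m ((cmod z)\<^sup>2)))\<^sup>2) \<partial>D)"
      unfolding True complex_norm_square[symmetric] by (simp add: norm_mult)
    also have "\<dots> = of_real (integral J (\<lambda>u. (cmod (c m u))\<^sup>2))"
      by (simp only: integral_complex_of_real)
        (subst integral_D_radial, auto intro!: continuous_intros c)
    finally show ?thesis using True by simp
  next
    case False
    obtain h where [measurable]: "h \<in> borel_measurable borel" and h: "\<And>u. u \<in> J \<Longrightarrow> h u = c m u"
      using continuous_extension_J[OF c] by blast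
    obtain k where [measurable]: "k \<in> borel_measurable borel" and k: "\<And>u. u \<in> J \<Longrightarrow> k u = c n u"
      using continuous_extension_J[OF c] by blast
    have "(\<integral>z. ?t m z * cnj (?t n z) \<partial>D) =
        (\<integral>z. (\<lambda>u. h u * cnj (k u)) ((cmod z)\<^sup>2) * ang (m - n) z \<partial>D)"
      using ang_add[of m "- n"]
      by (intro Bochner_Integration.integral_cong refl)
        (simp add: h[OF cmod_square_in_J] k[OF cmod_square_in_J] cnj_ang)
    also have "\<dots> = 0" by (rule integral_D_ang_zero) (use False in auto)
    finally show ?thesis using False by simp
  qed
  have sq: "square_integrable D (?t n)" for n by (rule radial_ang_square_integrable[OF c])
  have "complex_of_real (\<integral>z. (cmod (trig_poly N c z))\<^sup>2 \<partial>D) =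
      (\<integral>z. trig_poly N c z * cnj (trig_poly N c z) \<partial>D)"
    by (simp only: complex_norm_square[symmetric] integral_complex_of_real)
  also have "\<dots> = (\<integral>z. (\<Sum>m\<in>?N. \<Sum>n\<in>?N. ?t m z * cnj (?t n z)) \<partial>D)"
    by (simp only: trig_poly_def cnj_sum sum_product)
  also have "\<dots> = (\<Sum>m\<in>?N. \<Sum>n\<in>?N. \<integral>z. ?t m z * cnj (?t n z) \<partial>D)"
    using square_integrable_mult_cnj[OF sq sq]
    by (subst Bochner_Integration.integral_sum
        | (rule sum.cong Bochner_Integration.integrable_sum refl; assumption?)+ | blast)+
  also have "\<dots> = of_real (\<Sum>n\<in>?N. integral J (\<lambda>u. (cmod (c n u))\<^sup>2))"
    unfolding entry by simp
  finally show ?thesis by (simp only: of_real_eq_iff)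
qed

text \<open>Coefficients vanish beyond the degree so that two degrees can be raised to a common one.
  Equality is asked on the annulus only, since the coefficients are unconstrained elsewhere.\<close>

definition trig :: "(complex \<Rightarrow> complex) \<Rightarrow> bool" where
  "trig p \<longleftrightarrow> (\<exists>N c. (\<forall>n. continuous_on J (c n)) \<and> (\<forall>n. int N < \<bar>n\<bar> \<longrightarrow> c n = (\<lambda>_. 0)) \<and>
     (\<forall>z\<in>A. p z = trig_poly N c z))"

lemma trig_poly_mono:
  assumes "N \<le> M" "\<And>n. int N < \<bar>n\<bar> \<Longrightarrow> c n = (\<lambda>_. 0)"
  shows "trig_poly M c z = trig_poly N c z"
  unfolding trig_poly_def
  using assms by (intro sum.mono_neutral_right) auto

lemma trig_monomial:
  assumes "continuous_on J h"
  shows "trig (\<lambda>z. h ((cmod z)\<^sup>2) * ang n z)"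
  unfolding trig_def
proof (intro exI conjI allI impI ballI)
  let ?c = "\<lambda>m. if m = n then h else (\<lambda>_. 0)"
  show "continuous_on J (?c m)" for m using assms by auto
  show "?c m = (\<lambda>_. 0)" if "int (nat \<bar>n\<bar>) < \<bar>m\<bar>" for m using that by auto
  show "h ((cmod z)\<^sup>2) * ang n z = trig_poly (nat \<bar>n\<bar>) ?c z" for z
  proof -
    have "trig_poly (nat \<bar>n\<bar>) ?c z = (\<Sum>m\<in>{- int (nat \<bar>n\<bar>)..int (nat \<bar>n\<bar>)}.
        if m = n then h ((cmod z)\<^sup>2) * ang n z else 0)"
      unfolding trig_poly_def by (intro sum.cong) auto
    then show ?thesis by (auto simp: sum.delta)
  qed
qed

lemma trig_add:
  assumes "trig p" "trig q"
  shows "trig (\<lambda>z. p z + q z)"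
proof -
  obtain N c where p: "\<And>n. continuous_on J (c n)" "\<And>n. int N < \<bar>n\<bar> \<Longrightarrow> c n = (\<lambda>_. 0)"
    "\<And>z. z \<in> A \<Longrightarrow> p z = trig_poly N c z" using assms(1) unfolding trig_def by blast
  obtain M d where q: "\<And>n. continuous_on J (d n)" "\<And>n. int M < \<bar>n\<bar> \<Longrightarrow> d n = (\<lambda>_. 0)"
    "\<And>z. z \<in> A \<Longrightarrow> q z = trig_poly M d z" using assms(2) unfolding trig_def by blast
  show ?thesis
    unfolding trig_def
  proof (intro exI conjI allI impI ballI)
    show "continuous_on J (\<lambda>u. c n u + d n u)" for n by (intro continuous_intros p q)
    show "(\<lambda>u. c n u + d n u) = (\<lambda>_. 0)" if "int (max N M) < \<bar>n\<bar>" for n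
      using that p(2)[of n] q(2)[of n] by auto
    fix z assume z: "z \<in> A"
    have "p z + q z = trig_poly (max N M) c z + trig_poly (max N M) d z"
      using trig_poly_mono[of N "max N M" c z] trig_poly_mono[of M "max N M" d z] p q z by simp
    then show "p z + q z = trig_poly (max N M) (\<lambda>n u. c n u + d n u) z"
      by (simp add: trig_poly_def sum.distrib algebra_simps)
  qed
qed

lemma trig_const: "trig (\<lambda>_. a)"
  using trig_monomial[of "\<lambda>_. a" 0] by simp

lemma trig_sum: "(\<And>i. i \<in> I \<Longrightarrow> trig (p i)) \<Longrightarrow> trig (\<lambda>z. \<Sum>i\<in>I. p i z)"
  by (induction I rule: infinite_finite_induct) (simp_all add: trig_const trig_add)

lemma trig_cong: "trig p \<Longrightarrow> (\<And>z. z \<in> A \<Longrightarrow> p z = q z) \<Longrightarrow> trig q"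
  unfolding trig_def by simp

lemma trig_mult:
  assumes "trig p" "trig q"
  shows "trig (\<lambda>z. p z * q z)"
proof -
  obtain N c where p: "\<And>n. continuous_on J (c n)"
    "\<And>z. z \<in> A \<Longrightarrow> p z = trig_poly N c z" using assms(1) unfolding trig_def by blast
  obtain M d where q: "\<And>n. continuous_on J (d n)"
    "\<And>z. z \<in> A \<Longrightarrow> q z = trig_poly M d z" using assms(2) unfolding trig_def by blast
  have "trig (\<lambda>z. \<Sum>m\<in>{- int N..int N}. \<Sum>n\<in>{- int M..int M}.
      (\<lambda>u. c m u * d n u) ((cmod z)\<^sup>2) * ang (m + n) z)"
    by (intro trig_sum trig_monomial continuous_intros p q)
  then show ?thesis
  proof (rule trig_cong)
    fix z assume z: "z \<in> A"
    show "(\<Sum>m\<in>{- int N..int N}. \<Sum>n\<in>{- int M..int M}.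
      (\<lambda>u. c m u * d n u) ((cmod z)\<^sup>2) * ang (m + n) z) = p z * q z"
      using z by (simp add: p q trig_poly_def sum_product ang_add algebra_simps)
  qed
qed

text \<open>In polar form \<open>z\<close> is the radial function \<open>sqrt u\<close>, taken at
  \<open>u = |z|^2\<close>, times the first character. As sums and products stay in the class, all
  polynomials in \<open>z\<close> and its conjugate do.\<close>

lemma trig_ident: "trig (\<lambda>z. z)" and trig_cnj: "trig cnj"
proof -
  have 1: "of_real (cmod z) * ang 1 z = z" for z
    by (cases "z = 0") (auto simp: ang_1 sgn_eq)
  have "trig (\<lambda>z. of_real (sqrt ((cmod z)\<^sup>2)) * ang n z)" for n
    by (rule trig_monomial[of "\<lambda>u. of_real (sqrt u)"]) (intro continuous_intros)
  then have *: "trig (\<lambda>z. of_real (cmod z) * ang n z)" for n by simp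
  show "trig (\<lambda>z. z)" using *[of 1] by (simp add: 1)
  have "of_real (cmod z) * ang (- 1) z = cnj z" for z
    using arg_cong[OF 1[of z], of cnj] by (simp add: cnj_ang)
  then show "trig cnj" using *[of "- 1"] by simp
qed

text \<open>A real linear functional on the plane is a complex combination of \<open>z\<close> and
  \<open>cnj z\<close>; sums and products come from the closure properties.\<close>

lemma trig_real_polynomial:
  assumes "real_polynomial_function p"
  shows "trig (\<lambda>z. of_real (p z))"
  using assms
proof induction
  case (linear f)
  interpret bounded_linear f by fact
  have eq: "(\<lambda>z. complex_of_real (f z)) = (\<lambda>z. (of_real (f 1) / 2) * (z + cnj z) +
      (of_real (f \<i>) / (2 * \<i>)) * (z + (- 1) * cnj z))"
  proof
    fix z
    have "f z = f (Re z *\<^sub>R 1 + Im z *\<^sub>R \<i>)"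
      by (rule arg_cong[of _ _ f]) (simp add: complex_eq_iff)
    also have "\<dots> = Re z * f 1 + Im z * f \<i>" by (simp only: add scale real_scaleR_def)
    finally show "complex_of_real (f z) = (of_real (f 1) / 2) * (z + cnj z) +
      (of_real (f \<i>) / (2 * \<i>)) * (z + (- 1) * cnj z)"
      using complex_add_cnj[of z] complex_diff_cnj[of z]
      by (simp add: mult.commute mult.left_commute)
  qed
  show ?case
    unfolding eq by (intro trig_add trig_mult trig_const trig_ident trig_cnj)
qed (simp_all add: trig_const trig_add trig_mult)

lemma trig_polynomial:
  fixes p :: "complex \<Rightarrow> complex"
  assumes "polynomial_function p"
  shows "trig p"
proof -
  have "real_polynomial_function (Re \<circ> p)" "real_polynomial_function (Im \<circ> p)"
    using assms bounded_linear_Re bounded_linear_Im unfolding polynomial_function_def by blast+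
  then have "trig (\<lambda>z. of_real ((Re \<circ> p) z) + \<i> * of_real ((Im \<circ> p) z))"
    by (intro trig_add trig_mult trig_const trig_real_polynomial)
  then show ?thesis by (simp add: complex_eq[symmetric])
qed

lemma AE_D_not_null:
  assumes "negligible Z"
  shows "AE z in D. z \<notin> Z"
proof (rule AE_I)
  have Z: "Z \<in> null_sets lebesgue" using assms by (simp add: negligible_iff_null_sets)
  then have sets: "A \<inter> Z \<in> sets lebesgue" by auto
  show "{z \<in> space D. \<not> z \<notin> Z} \<subseteq> A \<inter> Z" by auto
  have "emeasure lebesgue (A \<inter> Z) = 0"
    using Z by (intro null_setsD1 null_set_Int1) auto
  then show "emeasure D (A \<inter> Z) = 0"
    using sets by (simp add: D_def emeasure_restrict_space)
  show "A \<inter> Z \<in> sets D" using sets by (simp add: sets_D sets_restrict_space_iff)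
qed

text \<open>Three approximations with error at most \<open>e / 3\<close>: a bounded function, a
  bounded continuous function, and a polynomial by Stone-Weierstrass on the compact annulus.\<close>

lemma trig_dense:
  assumes f: "square_integrable D f" and e: "e > 0"
  shows "\<exists>N c. (\<forall>n. continuous_on J (c n)) \<and> (\<forall>n. int N < \<bar>n\<bar> \<longrightarrow> c n = (\<lambda>_. 0)) \<and>
    sqrt (\<integral>z. (cmod (trig_poly N c z - f z))\<^sup>2 \<partial>D) < e"
proof -
  interpret finite_measure D by (rule finite_measure_D)
  interpret L: pre_hilbert "L2 D" by (rule pre_hilbert_L2)
  have fm[measurable]: "f \<in> borel_measurable D" using f by (rule square_integrable_measurable)
  \<comment> \<open>The metric projection onto the disk of radius \<open>b\<close>. Unlike a cut-off
    by an indicator it is continuous, so that it can also be composed with continuous functions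
    below.\<close>
  define clamp :: "real \<Rightarrow> complex \<Rightarrow> complex" where "clamp b = closest_point (cball 0 b)" for b
  have clamp_cont: "continuous_on UNIV (clamp b)" if "b \<ge> 0" for b
    unfolding clamp_def using that by (intro continuous_on_closest_point) auto
  have clamp_le: "cmod (clamp b z) \<le> b" if "b \<ge> 0" for b z
    using closest_point_in_set[of "cball 0 b" z] that by (simp add: clamp_def)
  have clamp_id: "clamp b z = z" if "cmod z \<le> b" for b z
    unfolding clamp_def using that by (intro closest_point_self) simp
  have clamp_dist: "cmod (clamp b z - z) \<le> cmod z" if "b \<ge> 0" for b z
    using closest_point_le[of "cball 0 b" 0 z] that by (simp add: clamp_def dist_norm norm_minus_commute)
  have clamp_m: "clamp b \<in> borel_measurable borel" if "b \<ge> 0" for b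
    using clamp_cont[OF that] by (rule borel_measurable_continuous_onI)
  have m1[measurable]: "(\<lambda>z. clamp (real k) (f z)) \<in> borel_measurable D" for k
    by (rule measurable_compose[OF fm clamp_m]) simp
  have "(\<lambda>k. \<integral>z. (cmod (clamp (real k) (f z) - f z))\<^sup>2 \<partial>D) \<longlonglongrightarrow> (\<integral>z. 0 \<partial>D)"
  proof (rule integral_dominated_convergence[where w = "\<lambda>z. (cmod (f z))\<^sup>2"])
    show "integrable D (\<lambda>z. (cmod (f z))\<^sup>2)" using f by (simp add: square_integrable_def)
    show "AE z in D. (\<lambda>k. (cmod (clamp (real k) (f z) - f z))\<^sup>2) \<longlonglongrightarrow> 0"
    proof (rule always_eventually, rule allI, rule tendsto_eventually)
      fix z
      obtain k0 where k0: "cmod (f z) \<le> real k0" using real_arch_simple by blast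
      show "\<forall>\<^sub>F k in sequentially. (cmod (clamp (real k) (f z) - f z))\<^sup>2 = 0"
        unfolding eventually_sequentially
        by (intro exI[of _ k0]) (use k0 in \<open>auto simp: clamp_id\<close>)
    qed
    show "AE z in D. norm ((cmod (clamp (real k) (f z) - f z))\<^sup>2) \<le> (cmod (f z))\<^sup>2" for k
      by (auto intro!: always_eventually power_mono clamp_dist)
  qed measurable
  then have "(\<lambda>k. sqrt (\<integral>z. (cmod (clamp (real k) (f z) - f z))\<^sup>2 \<partial>D)) \<longlonglongrightarrow> 0"
    using tendsto_real_sqrt by fastforce
  then have "\<forall>\<^sub>F k in sequentially. sqrt (\<integral>z. (cmod (clamp (real k) (f z) - f z))\<^sup>2 \<partial>D) < e / 3"
    using e by (intro order_tendstoD) auto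
  then obtain k where k: "sqrt (\<integral>z. (cmod (clamp (real k) (f z) - f z))\<^sup>2 \<partial>D) < e / 3"
    by (auto simp: eventually_sequentially)
  \<comment> \<open>This form of measurability supplies continuous functions converging to
    \<open>f\<close> off a null set. They need not be bounded; clamping gives the bound for
    dominated convergence.\<close>
  have "f measurable_on A"
    using fm by (subst measurable_on_iff_borel_measurable) (auto simp: borel_measurable_D)
  then obtain Z g where Z: "negligible Z" and g: "\<And>n. continuous_on UNIV (g n)"
    and lim: "\<And>z. z \<notin> Z \<Longrightarrow> (\<lambda>n. g n z) \<longlonglongrightarrow> (if z \<in> A then f z else 0)"
    unfolding measurable_on_def by blast
  have cg: "continuous_on UNIV (\<lambda>z. clamp (real k) (g n z))" for n
    by (rule continuous_on_compose2[OF clamp_cont g]) auto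
  have m2[measurable]: "(\<lambda>z. clamp (real k) (g n z)) \<in> borel_measurable D" for n
    by (intro measurable_D_borel borel_measurable_continuous_onI cg)
  have "(\<lambda>n. \<integral>z. (cmod (clamp (real k) (g n z) - clamp (real k) (f z)))\<^sup>2 \<partial>D) \<longlonglongrightarrow> (\<integral>z. 0 \<partial>D)"
  proof (rule integral_dominated_convergence[where w = "\<lambda>z. (2 * real k)\<^sup>2"])
    show "AE z in D. (\<lambda>n. (cmod (clamp (real k) (g n z) - clamp (real k) (f z)))\<^sup>2) \<longlonglongrightarrow> 0"
      using AE_D_not_null[OF Z] AE_space
    proof eventually_elim
      case (elim z)
      then have "(\<lambda>n. g n z) \<longlonglongrightarrow> f z" using lim[of z] by simp
      then have "(\<lambda>n. clamp (real k) (g n z)) \<longlonglongrightarrow> clamp (real k) (f z)"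
        using clamp_cont[of "real k"] by (auto intro: continuous_on_tendsto_compose)
      then have "(\<lambda>n. (cmod (clamp (real k) (g n z) - clamp (real k) (f z)))\<^sup>2) \<longlonglongrightarrow>
          (cmod (clamp (real k) (f z) - clamp (real k) (f z)))\<^sup>2"
        by (intro tendsto_intros)
      then show ?case by simp
    qed
    show "AE z in D. norm ((cmod (clamp (real k) (g n z) - clamp (real k) (f z)))\<^sup>2) \<le> (2 * real k)\<^sup>2" for n
    proof (intro always_eventually allI)
      fix z
      have "cmod (clamp (real k) (g n z) - clamp (real k) (f z)) \<le> real k + real k"
        by (rule order_trans[OF norm_triangle_ineq4]) (intro add_mono clamp_le; simp)
      then show "norm ((cmod (clamp (real k) (g n z) - clamp (real k) (f z)))\<^sup>2) \<le> (2 * real k)\<^sup>2"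
        using power_mono[of "cmod (clamp (real k) (g n z) - clamp (real k) (f z))" "2 * real k" 2]
        by simp
    qed
  qed (auto intro!: borel_measurable_power borel_measurable_norm borel_measurable_diff m1 m2)
  then have "(\<lambda>n. sqrt (\<integral>z. (cmod (clamp (real k) (g n z) - clamp (real k) (f z)))\<^sup>2 \<partial>D)) \<longlonglongrightarrow> 0"
    using tendsto_real_sqrt by fastforce
  then have "\<forall>\<^sub>F n in sequentially.
      sqrt (\<integral>z. (cmod (clamp (real k) (g n z) - clamp (real k) (f z)))\<^sup>2 \<partial>D) < e / 3"
    using e by (intro order_tendstoD) auto
  then obtain n where n: "sqrt (\<integral>z. (cmod (clamp (real k) (g n z) - clamp (real k) (f z)))\<^sup>2 \<partial>D) < e / 3"
    by (auto simp: eventually_sequentially)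
  let ?h = "\<lambda>z. clamp (real k) (g n z)"
  \<comment> \<open>Converts a uniform error into an \<open>L2\<close> error.\<close>
  define C where "C = sqrt (measure D (space D)) + 1"
  have C: "C > 0" unfolding C_def by (simp add: add_nonneg_pos)
  have "e / (3 * C) > 0" using e C by simp
  then have "\<exists>p. polynomial_function p \<and> (\<forall>z\<in>A. cmod (?h z - p z) < e / (3 * C))"
    by (rule Stone_Weierstrass_polynomial_function[OF compact_A continuous_on_subset[OF cg subset_UNIV]])
  then obtain p where p: "polynomial_function p" "\<And>z. z \<in> A \<Longrightarrow> cmod (?h z - p z) < e / (3 * C)"
    by auto
  obtain N c where c: "\<And>n. continuous_on J (c n)" "\<And>n. int N < \<bar>n\<bar> \<Longrightarrow> c n = (\<lambda>_. 0)"
      "\<And>z. z \<in> A \<Longrightarrow> p z = trig_poly N c z"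
    using trig_polynomial[OF p(1)] unfolding trig_def by blast
  let ?p = "trig_poly N c"
  have pm[measurable]: "?p \<in> borel_measurable D"
    by (intro square_integrable_measurable trig_poly_square_integrable c)
  have "(\<integral>z. (cmod (?p z - ?h z))\<^sup>2 \<partial>D) \<le> (\<integral>z. (e / (3 * C))\<^sup>2 \<partial>D)"
  proof (rule integral_mono')
    fix z assume "z \<in> space D"
    then show "(cmod (?p z - ?h z))\<^sup>2 \<le> (e / (3 * C))\<^sup>2"
      using p(2)[of z] c(3)[of z] by (intro power_mono) (auto simp: norm_minus_commute less_imp_le)
  qed auto
  also have "\<dots> = (e / (3 * C))\<^sup>2 * measure D (space D)" by simp
  finally have "sqrt (\<integral>z. (cmod (?p z - ?h z))\<^sup>2 \<partial>D) \<le> e / (3 * C) * sqrt (measure D (space D))"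
    using real_sqrt_le_mono[of _ "(e / (3 * C))\<^sup>2 * measure D (space D)"] e C
    by (simp add: real_sqrt_mult)
  also have "\<dots> \<le> e / (3 * C) * C" using e C by (intro mult_left_mono) (auto simp: C_def)
  also have "\<dots> = e / 3" using C by simp
  finally have 1: "sqrt (\<integral>z. (cmod (?p z - ?h z))\<^sup>2 \<partial>D) \<le> e / 3" .
  have sq: "square_integrable D ?p" "square_integrable D ?h" "square_integrable D (\<lambda>z. clamp (real k) (f z))"
    by (rule trig_poly_square_integrable[OF c(1)],
        (rule square_integrable_bounded[OF finite_measure_D, of _ "real k"]; simp add: clamp_le)+)
  have v: "ae_class D g \<in> vecs (L2 D)" if "square_integrable D g" for g
    using that by (simp add: L2_vecs)
  have "vdist (L2 D) (ae_class D ?p) (ae_class D f) < e"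
    using L.dist_triangle[OF v[OF sq(1)] v[OF sq(2)] v[OF f]]
      L.dist_triangle[OF v[OF sq(2)] v[OF sq(3)] v[OF f]] 1 k n
    by (simp add: L2_dist)
  then show ?thesis using c by (intro exI[of _ N] exI[of _ c]) (simp add: L2_dist)
qed

end

text \<open>Connects the two sums that define a section, over powers of the shift and of its
  adjoint, with one sum over signed diagonals.\<close>

lemma sum_int_split:
  fixes R :: "int \<Rightarrow> 'a::comm_monoid_add"
  shows "(\<Sum>d\<in>{- int N..int N}. R d) = (\<Sum>n=0..N. R (int n)) + (\<Sum>n=1..N. R (- int n))"
proof (induction N)
  case (Suc N)
  have "{- int (Suc N)..int (Suc N)} = insert (int (Suc N)) (insert (- int (Suc N)) {- int N..int N})"
    by auto
  then show ?case using Suc by (simp add: add_ac)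
qed simp

section \<open>Weighted square summable families\<close>

lemma weighted_square_summable_add:
  fixes f g :: "'i \<Rightarrow> complex" and W :: "'i \<Rightarrow> real"
  assumes "(\<lambda>i. W i * (cmod (f i))\<^sup>2) summable_on I" "(\<lambda>i. W i * (cmod (g i))\<^sup>2) summable_on I"
    and W: "\<And>i. i \<in> I \<Longrightarrow> W i \<ge> 0"
  shows "(\<lambda>i. W i * (cmod (f i + g i))\<^sup>2) summable_on I"
proof (rule summable_on_comparison_test)
  show "(\<lambda>i. 2 * (W i * (cmod (f i))\<^sup>2) + 2 * (W i * (cmod (g i))\<^sup>2)) summable_on I"
    by (intro summable_on_add summable_on_cmult_right assms)
  fix i assume i: "i \<in> I"
  have "(cmod (f i + g i))\<^sup>2 \<le> (cmod (f i) + cmod (g i))\<^sup>2"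
    by (intro power_mono norm_triangle_ineq) simp
  also have "\<dots> \<le> 2 * (cmod (f i))\<^sup>2 + 2 * (cmod (g i))\<^sup>2"
    using sum_squares_bound[of "cmod (f i)" "cmod (g i)"] by (simp add: power2_sum)
  finally show "W i * (cmod (f i + g i))\<^sup>2 \<le> 2 * (W i * (cmod (f i))\<^sup>2) + 2 * (W i * (cmod (g i))\<^sup>2)"
    using mult_left_mono[OF _ W[OF i]] by (fastforce simp: algebra_simps)
qed (simp add: W)

lemma weighted_square_summable_scale:
  fixes f :: "'i \<Rightarrow> complex" and W :: "'i \<Rightarrow> real"
  assumes "(\<lambda>i. W i * (cmod (f i))\<^sup>2) summable_on I"
  shows "(\<lambda>i. W i * (cmod (c * f i))\<^sup>2) summable_on I"
  using summable_on_cmult_right[OF assms, of "(cmod c)\<^sup>2"]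
  by (simp add: norm_mult power_mult_distrib mult_ac)

text \<open>The weight is 1 for the inner product of \<open>ell2\<close> and \<open>W\<close> for
  the trace form on operators.\<close>

lemma weighted_product_summable:
  fixes f g :: "'i \<Rightarrow> complex" and W :: "'i \<Rightarrow> real"
  assumes "(\<lambda>i. W i * (cmod (f i))\<^sup>2) summable_on I" "(\<lambda>i. W i * (cmod (g i))\<^sup>2) summable_on I"
    and W: "\<And>i. i \<in> I \<Longrightarrow> W i \<ge> 0"
  shows "(\<lambda>i. of_real (W i) * (f i * cnj (g i))) summable_on I"
proof (rule abs_summable_summable, rule summable_on_comparison_test)
  show "(\<lambda>i. W i * (cmod (f i))\<^sup>2 + W i * (cmod (g i))\<^sup>2) summable_on I"
    by (intro summable_on_add assms)
  fix i assume i: "i \<in> I"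
  have "2 * cmod (f i) * cmod (g i) \<le> (cmod (f i))\<^sup>2 + (cmod (g i))\<^sup>2" by (rule sum_squares_bound)
  moreover have "0 \<le> cmod (f i) * cmod (g i)" by simp
  ultimately have "cmod (f i) * cmod (g i) \<le> (cmod (f i))\<^sup>2 + (cmod (g i))\<^sup>2" by linarith
  from mult_left_mono[OF this W[OF i]]
  show "norm (of_real (W i) * (f i * cnj (g i))) \<le> W i * (cmod (f i))\<^sup>2 + W i * (cmod (g i))\<^sup>2"
    using W[OF i] by (simp add: norm_mult algebra_simps)
qed simp

section \<open>The space $\ell^2$ and its bounded operators\<close>

context
  fixes S :: "int set"
begin

abbreviation V :: "(int \<Rightarrow> complex) cspace" where "V \<equiv> ell2 S"

lemma ell2_vecs_iff:
  "x \<in> vecs V \<longleftrightarrow> (\<forall>k. k \<notin> S \<longrightarrow> x k = 0) \<and> (\<lambda>k. (cmod (x k))\<^sup>2) summable_on S"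
  and ell2_zero: "vzero V = (\<lambda>_. 0)"
  and ell2_add: "vadd V x y = (\<lambda>k. x k + y k)"
  and ell2_scale: "vscale V c x = (\<lambda>k. c * x k)"
  and ell2_inner: "vinner V x y = (\<Sum>\<^sub>\<infinity>k\<in>S. x k * cnj (y k))"
  by (simp_all add: ell2_def)

lemma ell2_diff: "vdiff V x y = (\<lambda>k. x k - y k)"
  by (simp add: vdiff_def ell2_add ell2_scale)

lemma ell2_summable: "x \<in> vecs V \<Longrightarrow> (\<lambda>k. (cmod (x k))\<^sup>2) summable_on S"
  and ell2_outside: "x \<in> vecs V \<Longrightarrow> k \<notin> S \<Longrightarrow> x k = 0"
  by (simp_all add: ell2_vecs_iff)

lemma ell2_product_summable:
  "\<lbrakk>x \<in> vecs V; y \<in> vecs V\<rbrakk> \<Longrightarrow> (\<lambda>k. x k * cnj (y k)) summable_on S"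
  using weighted_product_summable[of "\<lambda>_. 1" x S y] by (simp add: ell2_vecs_iff)

lemma ell2_norm: "(\<lambda>k. (cmod (x k))\<^sup>2) summable_on S \<Longrightarrow> vnorm V x = sqrt (\<Sum>\<^sub>\<infinity>k\<in>S. (cmod (x k))\<^sup>2)"
  unfolding vnorm_def ell2_inner complex_norm_square[symmetric]
  by (subst infsum_Re[symmetric]) (simp_all add: summable_on_of_real del: of_real_power)

lemma pre_hilbert_ell2: "pre_hilbert V"
proof
  fix x y z :: "int \<Rightarrow> complex" and c d :: complex
  note ops = ell2_zero ell2_add ell2_scale ell2_diff
  show "vzero V \<in> vecs V" by (simp add: ell2_vecs_iff ops)
  assume x: "x \<in> vecs V"
  show "vscale V c x \<in> vecs V"
    using weighted_square_summable_scale[of "\<lambda>_. 1" x S c] x by (simp add: ell2_vecs_iff ops)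
  show "vadd V x (vzero V) = x" "vdiff V x x = vzero V"
    "vscale V (c + d) x = vadd V (vscale V c x) (vscale V d x)"
    "vscale V c (vscale V d x) = vscale V (c * d) x" "vscale V 1 x = x"
    by (simp_all add: ops algebra_simps)
  show "0 \<le> Re (vinner V x x)"
    unfolding ell2_inner complex_norm_square[symmetric] using x
    by (subst infsum_Re[symmetric])
      (auto simp: ell2_vecs_iff summable_on_of_real infsum_nonneg simp del: of_real_power)
  assume y: "y \<in> vecs V"
  show "vadd V x y \<in> vecs V"
    using weighted_square_summable_add[of "\<lambda>_. 1" x S y] x y by (simp add: ell2_vecs_iff ops)
  show "vadd V x y = vadd V y x"
    "vscale V c (vadd V x y) = vadd V (vscale V c x) (vscale V c y)"
    by (simp_all add: ops algebra_simps)
  show "vinner V (vscale V c x) y = c * vinner V x y"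
    using infsum_cmult_right[OF ell2_product_summable[OF x y], of c]
    by (simp add: ell2_inner ops mult.assoc)
  show "vinner V x y = cnj (vinner V y x)"
    by (simp add: ell2_inner infsum_cnj[symmetric] mult.commute del: infsum_cnj)
  assume z: "z \<in> vecs V"
  show "vadd V (vadd V x y) z = vadd V x (vadd V y z)" by (simp add: ops add.assoc)
  show "vinner V (vadd V x y) z = vinner V x z + vinner V y z"
    using infsum_add[OF ell2_product_summable[OF x z] ell2_product_summable[OF y z]]
    by (simp add: ell2_inner ops distrib_right)
qed

interpretation V: pre_hilbert V by (rule pre_hilbert_ell2)

lemma ell2_norm_square:
  "x \<in> vecs V \<Longrightarrow> (vnorm V x)\<^sup>2 = (\<Sum>\<^sub>\<infinity>k\<in>S. (cmod (x k))\<^sup>2)"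
  by (simp add: ell2_norm ell2_summable infsum_nonneg)

lemma ell2_finite_sum_le:
  "\<lbrakk>x \<in> vecs V; finite F; F \<subseteq> S\<rbrakk> \<Longrightarrow> (\<Sum>k\<in>F. (cmod (x k))\<^sup>2) \<le> (vnorm V x)\<^sup>2"
  by (simp add: ell2_norm_square finite_sum_le_infsum ell2_summable)

text \<open>Bounds on finite partial sums give membership and the norm estimate at once; adjoints
  and band operators are handled this way.\<close>

lemma ell2_boundedI:
  assumes "\<And>k. k \<notin> S \<Longrightarrow> x k = 0" "B \<ge> 0"
    and "\<And>F. finite F \<Longrightarrow> F \<subseteq> S \<Longrightarrow> (\<Sum>k\<in>F. (cmod (x k))\<^sup>2) \<le> B\<^sup>2"
  shows "x \<in> vecs V" and "vnorm V x \<le> B"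
proof -
  have "(\<lambda>k. (cmod (x k))\<^sup>2) summable_on S"
    using assms(3) by (intro nonneg_bdd_above_summable_on) (auto simp: bdd_above_def)
  then show x: "x \<in> vecs V" using assms by (simp add: ell2_vecs_iff)
  have "(vnorm V x)\<^sup>2 \<le> B\<^sup>2"
    unfolding ell2_norm_square[OF x] by (intro infsum_le_finite_sums ell2_summable x assms)
  then show "vnorm V x \<le> B" using assms(2) by (rule power2_le_imp_le)
qed

section \<open>Truncation to finitely many coordinates\<close>

definition trunc :: "int set \<Rightarrow> (int \<Rightarrow> complex) \<Rightarrow> int \<Rightarrow> complex" where
  "trunc F x = (\<lambda>k. if k \<in> F then x k else 0)"

lemma trunc_vecs:
  assumes "finite F" "F \<subseteq> S"
  shows "trunc F x \<in> vecs V" and "(vnorm V (trunc F x))\<^sup>2 = (\<Sum>k\<in>F. (cmod (x k))\<^sup>2)"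
proof -
  have "(\<lambda>k. (cmod (trunc F x k))\<^sup>2) summable_on S"
    by (rule finite_nonzero_values_imp_summable_on)
      (rule finite_subset[OF _ assms(1)], auto simp: trunc_def)
  then show t: "trunc F x \<in> vecs V" using assms by (auto simp: ell2_vecs_iff trunc_def)
  have "(\<Sum>\<^sub>\<infinity>k\<in>S. (cmod (trunc F x k))\<^sup>2) = (\<Sum>\<^sub>\<infinity>k\<in>F. (cmod (x k))\<^sup>2)"
    using assms by (intro infsum_cong_neutral) (auto simp: trunc_def)
  then show "(vnorm V (trunc F x))\<^sup>2 = (\<Sum>k\<in>F. (cmod (x k))\<^sup>2)"
    using assms by (simp add: ell2_norm_square[OF t])
qed

lemma basis_vecs: "k \<in> S \<Longrightarrow> basis_vec k \<in> vecs V"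
proof -
  assume "k \<in> S"
  moreover have "basis_vec k = trunc {k} (\<lambda>_. 1)" by (auto simp: basis_vec_def trunc_def)
  ultimately show ?thesis by (simp add: trunc_vecs)
qed

lemma inner_basis: "k \<in> S \<Longrightarrow> vinner V x (basis_vec k) = x k"
proof -
  assume k: "k \<in> S"
  have "vinner V x (basis_vec k) = (\<Sum>\<^sub>\<infinity>j\<in>{k}. x j)"
    unfolding ell2_inner using k by (intro infsum_cong_neutral) (auto simp: basis_vec_def)
  then show ?thesis by simp
qed

lemma inner_basis_left: "k \<in> S \<Longrightarrow> vinner V (basis_vec k) x = cnj (x k)"
proof -
  assume k: "k \<in> S"
  have "vinner V (basis_vec k) x = (\<Sum>\<^sub>\<infinity>j\<in>{k}. cnj (x j))"
    unfolding ell2_inner using k by (intro infsum_cong_neutral) (auto simp: basis_vec_def)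
  then show ?thesis by simp
qed

lemma ell2_eqI:
  "\<lbrakk>x \<in> vecs V; y \<in> vecs V; \<And>k. k \<in> S \<Longrightarrow> x k = y k\<rbrakk> \<Longrightarrow> x = y"
  by (rule ext) (metis ell2_outside)

text \<open>By Pythagoras the squared distance is the squared norm minus the partial sum over
  \<open>F\<close>.\<close>

lemma trunc_tendsto:
  assumes x: "x \<in> vecs V"
  shows "((\<lambda>F. vdist V x (trunc F x)) \<longlongrightarrow> 0) (finite_subsets_at_top S)"
proof -
  have ev: "\<forall>\<^sub>F F in finite_subsets_at_top S. finite F \<and> F \<subseteq> S"
    by (rule eventually_finite_subsets_at_top_weakI) simp
  have "((\<lambda>F. sqrt ((vnorm V x)\<^sup>2 - (\<Sum>k\<in>F. (cmod (x k))\<^sup>2))) \<longlongrightarrow> sqrt ((vnorm V x)\<^sup>2 - (vnorm V x)\<^sup>2))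
      (finite_subsets_at_top S)"
    using infsum_tendsto[OF ell2_summable[OF x]] unfolding ell2_norm_square[OF x]
    by (intro tendsto_intros)
  then have "((\<lambda>F. sqrt ((vnorm V x)\<^sup>2 - (\<Sum>k\<in>F. (cmod (x k))\<^sup>2))) \<longlongrightarrow> 0) (finite_subsets_at_top S)"
    by simp
  then show ?thesis
  proof (rule Lim_transform_eventually)
    show "\<forall>\<^sub>F F in finite_subsets_at_top S.
        sqrt ((vnorm V x)\<^sup>2 - (\<Sum>k\<in>F. (cmod (x k))\<^sup>2)) = vdist V x (trunc F x)"
      using ev
    proof eventually_elim
      case (elim F)
      then have F: "finite F" "F \<subseteq> S" by auto
      have eq: "vinner V x (trunc F x) = of_real (\<Sum>k\<in>F. (cmod (x k))\<^sup>2)"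
      proof -
        have "vinner V x (trunc F x) = (\<Sum>\<^sub>\<infinity>k\<in>F. x k * cnj (x k))"
          unfolding ell2_inner using F by (intro infsum_cong_neutral) (auto simp: trunc_def)
        then show ?thesis using F by (simp add: complex_norm_square del: of_real_power)
      qed
      have "(vdist V x (trunc F x))\<^sup>2 =
          (vnorm V x)\<^sup>2 + (vnorm V (trunc F x))\<^sup>2 - 2 * Re (vinner V x (trunc F x))"
        using x trunc_vecs(1)[OF F, of x] V.inner_cnj[of "trunc F x" x]
        by (simp add: vdist_def V.norm_sq V.inner_simps)
      also have "\<dots> = (vnorm V x)\<^sup>2 - (\<Sum>k\<in>F. (cmod (x k))\<^sup>2)"
        by (simp add: eq trunc_vecs(2)[OF F] del: of_real_sum)
      finally show ?case
        by (intro real_sqrt_unique V.dist_nonneg x trunc_vecs(1)[OF F])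
    qed
  qed
qed

section \<open>Bounded operators and their adjoints\<close>

lemma bounded_opsE:
  assumes "B \<in> bounded_ops V"
  obtains C where "C \<ge> 0" "\<And>x. x \<in> vecs V \<Longrightarrow> vnorm V (B x) \<le> C * vnorm V x"
proof -
  have "\<exists>C. \<forall>x\<in>vecs V. vnorm V (B x) \<le> C * vnorm V x"
    using assms by (simp add: bounded_ops_def)
  then obtain C where C: "\<And>x. x \<in> vecs V \<Longrightarrow> vnorm V (B x) \<le> C * vnorm V x" by blast
  have "vnorm V (B x) \<le> \<bar>C\<bar> * vnorm V x" if "x \<in> vecs V" for x
    by (rule order_trans[OF C[OF that]]) (intro mult_right_mono V.norm_nonneg that; simp)
  then show thesis using that[of "\<bar>C\<bar>"] by simp
qed

lemma bounded_ops_ext: "B \<in> bounded_ops V \<Longrightarrow> B \<in> extensional (vecs V)"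
  and bounded_ops_closed: "\<lbrakk>B \<in> bounded_ops V; x \<in> vecs V\<rbrakk> \<Longrightarrow> B x \<in> vecs V"
  and bounded_ops_add:
    "\<lbrakk>B \<in> bounded_ops V; x \<in> vecs V; y \<in> vecs V\<rbrakk> \<Longrightarrow> B (vadd V x y) = vadd V (B x) (B y)"
  and bounded_ops_scale:
    "\<lbrakk>B \<in> bounded_ops V; x \<in> vecs V\<rbrakk> \<Longrightarrow> B (vscale V c x) = vscale V c (B x)"
  by (auto simp: bounded_ops_def PiE_def)

lemma bounded_ops_diff:
  "\<lbrakk>B \<in> bounded_ops V; x \<in> vecs V; y \<in> vecs V\<rbrakk> \<Longrightarrow> B (vdiff V x y) = vdiff V (B x) (B y)"
  unfolding vdiff_def by (simp add: bounded_ops_add bounded_ops_scale V.scale_closed)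

lemma bounded_opsI:
  assumes "B \<in> extensional (vecs V)" "\<And>x. x \<in> vecs V \<Longrightarrow> B x \<in> vecs V"
    "\<And>x y. x \<in> vecs V \<Longrightarrow> y \<in> vecs V \<Longrightarrow> B (vadd V x y) = vadd V (B x) (B y)"
    "\<And>c x. x \<in> vecs V \<Longrightarrow> B (vscale V c x) = vscale V c (B x)"
    "\<And>x. x \<in> vecs V \<Longrightarrow> vnorm V (B x) \<le> C * vnorm V x"
  shows "B \<in> bounded_ops V"
  using assms unfolding bounded_ops_def by (intro CollectI conjI PiE_I exI[of _ C]) (auto simp: extensional_def)

lemma op_eqI:
  assumes "A \<in> bounded_ops V" "B \<in> bounded_ops V" "\<And>x k. x \<in> vecs V \<Longrightarrow> k \<in> S \<Longrightarrow> A x k = B x k"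
  shows "A = B"
proof (rule extensionalityI[OF bounded_ops_ext[OF assms(1)] bounded_ops_ext[OF assms(2)]])
  fix x assume x: "x \<in> vecs V"
  show "A x = B x"
    using assms(3)[OF x] by (rule ell2_eqI[OF bounded_ops_closed[OF assms(1) x] bounded_ops_closed[OF assms(2) x]])
qed

text \<open>Linearity reaches finite combinations of basis vectors; the bound and the defining
  identity of the adjoint are extended from them to all vectors.\<close>

lemma inner_trunc:
  assumes B: "B \<in> bounded_ops V" and y: "y \<in> vecs V" and F: "finite F" "F \<subseteq> S"
  shows "vinner V (B (trunc F c)) y = (\<Sum>k\<in>F. c k * vinner V (B (basis_vec k)) y)"
  using F
proof (induction F)
  case empty
  have "trunc {} c = vzero V" by (simp add: trunc_def ell2_zero)
  also have "\<dots> = vscale V 0 (vzero V)" by (simp add: ell2_scale ell2_zero)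
  finally have "B (trunc {} c) = vscale V 0 (B (vzero V))"
    using bounded_ops_scale[OF B V.zero_closed] by simp
  then show ?case
    using y bounded_ops_closed[OF B V.zero_closed] by (simp add: V.inner_scale)
next
  case (insert j F)
  then have j: "basis_vec j \<in> vecs V" and t: "trunc F c \<in> vecs V" by (simp_all add: basis_vecs trunc_vecs)
  have "trunc (insert j F) c = vadd V (vscale V (c j) (basis_vec j)) (trunc F c)"
    using insert.hyps(2) by (auto simp: trunc_def ell2_add ell2_scale basis_vec_def)
  then have "B (trunc (insert j F) c) = vadd V (vscale V (c j) (B (basis_vec j))) (B (trunc F c))"
    using j t B by (simp add: bounded_ops_add bounded_ops_scale V.scale_closed)
  then show ?case
    using insert j t y B by (simp add: V.inner_add V.inner_scale V.scale_closed bounded_ops_closed)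
qed

text \<open>The coordinates of an adjoint are forced by testing with basis vectors.
  \<open>op_adj\<close> is a definite description and needs such a witness.\<close>

definition adj :: "((int \<Rightarrow> complex) \<Rightarrow> int \<Rightarrow> complex) \<Rightarrow> (int \<Rightarrow> complex) \<Rightarrow> int \<Rightarrow> complex" where
  "adj B = (\<lambda>y\<in>vecs V. \<lambda>k. if k \<in> S then vinner V y (B (basis_vec k)) else 0)"

text \<open>If \<open>t\<close> is a finite truncation of \<open>adj B y\<close>, then
  \<open>vinner V (B t) y\<close> equals the squared norm of \<open>t\<close>. Cauchy-Schwarz and
  the bound on \<open>B\<close> allow one factor to be cancelled, which bounds all partial
  sums.\<close>

lemma adj_bound:
  assumes B: "B \<in> bounded_ops V" and C: "C \<ge> 0" "\<And>x. x \<in> vecs V \<Longrightarrow> vnorm V (B x) \<le> C * vnorm V x"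
    and y: "y \<in> vecs V"
  shows "adj B y \<in> vecs V" and "vnorm V (adj B y) \<le> C * vnorm V y"
proof -
  have sum: "(\<Sum>k\<in>F. (cmod (adj B y k))\<^sup>2) \<le> (C * vnorm V y)\<^sup>2" if F: "finite F" "F \<subseteq> S" for F
  proof -
    let ?t = "trunc F (adj B y)"
    have t: "?t \<in> vecs V" using trunc_vecs(1)[OF F] .
    have eq: "vinner V (B (basis_vec k)) y = cnj (adj B y k)" if "k \<in> F" for k
      using that F y V.inner_cnj[of "B (basis_vec k)" y]
      by (auto simp: adj_def bounded_ops_closed[OF B] basis_vecs)
    have "vinner V (B ?t) y = (\<Sum>k\<in>F. adj B y k * cnj (adj B y k))"
      unfolding inner_trunc[OF B y F] by (intro sum.cong) (simp_all add: eq)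
    also have "\<dots> = of_real ((vnorm V ?t)\<^sup>2)"
      unfolding trunc_vecs(2)[OF F] by (simp add: complex_norm_square del: of_real_power)
    finally have "(vnorm V ?t)\<^sup>2 \<le> vnorm V (B ?t) * vnorm V y"
      using V.Cauchy_Schwarz[OF bounded_ops_closed[OF B t] y] by (simp add: norm_power)
    also have "\<dots> \<le> (C * vnorm V ?t) * vnorm V y"
      by (intro mult_right_mono C t V.norm_nonneg y)
    finally have *: "vnorm V ?t * vnorm V ?t \<le> vnorm V ?t * (C * vnorm V y)"
      by (simp add: power2_eq_square mult_ac)
    have "vnorm V ?t \<le> C * vnorm V y"
    proof (cases "vnorm V ?t = 0")
      case False
      then show ?thesis using * V.norm_nonneg[OF t] by (simp add: mult_le_cancel_left)
    qed (use C V.norm_nonneg[OF y] in simp)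
    then show ?thesis
      unfolding trunc_vecs(2)[OF F, symmetric] using V.norm_nonneg[OF t] by (intro power_mono)
  qed
  have "adj B y k = 0" if "k \<notin> S" for k using that y by (simp add: adj_def)
  from ell2_boundedI[OF this _ sum] show "adj B y \<in> vecs V" "vnorm V (adj B y) \<le> C * vnorm V y"
    using C V.norm_nonneg[OF y] by simp_all
qed

text \<open>Both sides are limits of their values at truncations of \<open>x\<close>: the left one
  by boundedness, the right one as an infinite sum.\<close>

lemma adj_inner:
  assumes B: "B \<in> bounded_ops V" and x: "x \<in> vecs V" and y: "y \<in> vecs V"
  shows "vinner V (B x) y = vinner V x (adj B y)"
proof -
  obtain C where C: "C \<ge> 0" "\<And>x. x \<in> vecs V \<Longrightarrow> vnorm V (B x) \<le> C * vnorm V x"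
    using bounded_opsE[OF B] by blast
  note a = adj_bound(1)[OF B C y]
  let ?T = "finite_subsets_at_top S"
  have ev: "\<forall>\<^sub>F F in ?T. finite F \<and> F \<subseteq> S"
    by (rule eventually_finite_subsets_at_top_weakI) simp
  have "((\<lambda>F. vinner V (B x) y - vinner V (B (trunc F x)) y) \<longlongrightarrow> 0) ?T"
  proof (rule Lim_null_comparison)
    show "((\<lambda>F. C * vdist V x (trunc F x) * vnorm V y) \<longlongrightarrow> 0) ?T"
      using tendsto_mult_right[OF tendsto_mult_left[OF trunc_tendsto[OF x]], of C "vnorm V y"] by simp
    show "\<forall>\<^sub>F F in ?T. norm (vinner V (B x) y - vinner V (B (trunc F x)) y) \<le>
        C * vdist V x (trunc F x) * vnorm V y"
      using ev
    proof eventually_elim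
      case (elim F)
      then have t: "trunc F x \<in> vecs V" by (simp add: trunc_vecs)
      have "vinner V (B x) y - vinner V (B (trunc F x)) y = vinner V (B (vdiff V x (trunc F x))) y"
        by (simp add: bounded_ops_diff[OF B x t] V.inner_diff bounded_ops_closed[OF B] x t y)
      also have "cmod \<dots> \<le> vnorm V (B (vdiff V x (trunc F x))) * vnorm V y"
        by (intro V.Cauchy_Schwarz bounded_ops_closed[OF B] V.diff_closed x t y)
      also have "\<dots> \<le> C * vdist V x (trunc F x) * vnorm V y"
        unfolding vdist_def by (intro mult_right_mono C V.norm_nonneg V.diff_closed x t y)
      finally show ?case .
    qed
  qed
  from tendsto_diff[OF tendsto_const[of "vinner V (B x) y"] this]
  have "((\<lambda>F. vinner V (B (trunc F x)) y) \<longlongrightarrow> vinner V (B x) y) ?T" by simp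
  moreover have "((\<lambda>F. vinner V (B (trunc F x)) y) \<longlongrightarrow> vinner V x (adj B y)) ?T"
  proof (rule Lim_transform_eventually)
    show "((\<lambda>F. \<Sum>k\<in>F. x k * cnj (adj B y k)) \<longlongrightarrow> vinner V x (adj B y)) ?T"
      unfolding ell2_inner by (rule infsum_tendsto[OF ell2_product_summable[OF x a]])
    show "\<forall>\<^sub>F F in ?T. (\<Sum>k\<in>F. x k * cnj (adj B y k)) = vinner V (B (trunc F x)) y"
      using ev
    proof eventually_elim
      case (elim F)
      have "vinner V (B (basis_vec k)) y = cnj (adj B y k)" if "k \<in> F" for k
        using that elim y V.inner_cnj[of "B (basis_vec k)" y]
        by (auto simp: adj_def bounded_ops_closed[OF B] basis_vecs)
      then show ?case using elim by (simp add: inner_trunc[OF B y])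
    qed
  qed
  ultimately show ?thesis by (rule tendsto_unique[rotated]) simp
qed

lemma adj_bounded_ops: "B \<in> bounded_ops V \<Longrightarrow> adj B \<in> bounded_ops V"
proof -
  assume B: "B \<in> bounded_ops V"
  obtain C where C: "C \<ge> 0" "\<And>x. x \<in> vecs V \<Longrightarrow> vnorm V (B x) \<le> C * vnorm V x"
    using bounded_opsE[OF B] by blast
  note cl = bounded_ops_closed[OF B basis_vecs]
  show ?thesis
  proof (rule bounded_opsI[of _ C])
    show "adj B \<in> extensional (vecs V)" by (simp add: adj_def)
    fix x y c assume x: "x \<in> vecs V"
    show "adj B x \<in> vecs V" by (rule adj_bound(1)[OF B C x])
    show "vnorm V (adj B x) \<le> C * vnorm V x" by (rule adj_bound(2)[OF B C x])
    show "adj B (vscale V c x) = vscale V c (adj B x)"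
      using x V.scale_closed[OF x]
      by (intro ext) (simp add: adj_def V.inner_scale cl ell2_scale[of c "\<lambda>k. if k \<in> S then _ k else _"])
    assume y: "y \<in> vecs V"
    show "adj B (vadd V x y) = vadd V (adj B x) (adj B y)"
      using x y V.add_closed[OF x y]
      by (intro ext) (simp add: adj_def V.inner_add cl ell2_add[of "\<lambda>k. if k \<in> S then _ k else _"])
  qed
qed

lemma op_adj_eq:
  assumes B: "B \<in> bounded_ops V"
  shows "op_adj V B = adj B"
  unfolding op_adj_def
proof (rule the_equality)
  show "adj B \<in> bounded_ops V \<and> (\<forall>x\<in>vecs V. \<forall>y\<in>vecs V. vinner V (B x) y = vinner V x (adj B y))"
    using adj_bounded_ops[OF B] adj_inner[OF B] by blast
  fix B' assume B': "B' \<in> bounded_ops V \<and> (\<forall>x\<in>vecs V. \<forall>y\<in>vecs V. vinner V (B x) y = vinner V x (B' y))"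
  show "B' = adj B"
  proof (rule op_eqI)
    fix y k assume "y \<in> vecs V" "k \<in> S"
    then have "vinner V (basis_vec k) (B' y) = vinner V (basis_vec k) (adj B y)"
      using B' adj_inner[OF B basis_vecs] by (metis basis_vecs)
    then show "B' y k = adj B y k" using \<open>k \<in> S\<close> by (simp add: inner_basis_left)
  qed (use B' adj_bounded_ops[OF B] in auto)
qed

lemma op_adj_bounded: "B \<in> bounded_ops V \<Longrightarrow> op_adj V B \<in> bounded_ops V"
  by (simp add: op_adj_eq adj_bounded_ops)

lemma op_adj_apply:
  "\<lbrakk>B \<in> bounded_ops V; y \<in> vecs V; k \<in> S\<rbrakk> \<Longrightarrow> op_adj V B y k = vinner V y (B (basis_vec k))"
  by (simp add: op_adj_eq adj_def)

lemma op_adj_basis: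
  "\<lbrakk>B \<in> bounded_ops V; k \<in> S; j \<in> S\<rbrakk> \<Longrightarrow> op_adj V B (basis_vec k) j = cnj (B (basis_vec j) k)"
  by (simp add: op_adj_apply basis_vecs inner_basis_left)

text \<open>A coordinate of \<open>B x\<close> is the inner product of \<open>x\<close> with the
  adjoint applied to a basis vector, so that no limit has to be exchanged with
  \<open>B\<close>.\<close>

lemma bounded_op_apply:
  assumes B: "B \<in> bounded_ops V" and x: "x \<in> vecs V" and k: "k \<in> S"
  shows "B x k = (\<Sum>\<^sub>\<infinity>j\<in>S. B (basis_vec j) k * x j)"
proof -
  have "B x k = vinner V x (op_adj V B (basis_vec k))"
    using adj_inner[OF B x basis_vecs[OF k]] k by (simp add: inner_basis op_adj_eq[OF B])
  also have "\<dots> = (\<Sum>\<^sub>\<infinity>j\<in>S. B (basis_vec j) k * x j)"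
    unfolding ell2_inner by (intro infsum_cong) (simp add: op_adj_basis B k)
  finally show ?thesis .
qed

lemma op_zero_bounded: "op_zero V \<in> bounded_ops V"
proof (rule bounded_opsI[of _ 0])
  fix x y c assume x: "x \<in> vecs V"
  show "vnorm V (op_zero V x) \<le> 0 * vnorm V x" "op_zero V x \<in> vecs V"
    using x by (simp_all add: op_zero_def V.norm_zero V.zero_closed)
  show "op_zero V (vscale V c x) = vscale V c (op_zero V x)"
    using x V.scale_closed[OF x] by (simp add: op_zero_def) (simp add: ell2_zero ell2_scale)
  assume y: "y \<in> vecs V"
  show "op_zero V (vadd V x y) = vadd V (op_zero V x) (op_zero V y)"
    using x y V.add_closed[OF x y] by (simp add: op_zero_def V.add_zero V.zero_closed)
qed (simp add: op_zero_def)

lemma op_add_bounded: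
  assumes A: "A \<in> bounded_ops V" and B: "B \<in> bounded_ops V"
  shows "op_add V A B \<in> bounded_ops V"
proof -
  obtain C where C: "C \<ge> 0" "\<And>x. x \<in> vecs V \<Longrightarrow> vnorm V (A x) \<le> C * vnorm V x"
    using bounded_opsE[OF A] by blast
  obtain D where D: "D \<ge> 0" "\<And>x. x \<in> vecs V \<Longrightarrow> vnorm V (B x) \<le> D * vnorm V x"
    using bounded_opsE[OF B] by blast
  note cl = bounded_ops_closed[OF A] bounded_ops_closed[OF B]
  show ?thesis
  proof (rule bounded_opsI[of _ "C + D"])
    fix x y c assume x: "x \<in> vecs V"
    show "vnorm V (op_add V A B x) \<le> (C + D) * vnorm V x"
      using V.norm_triangle[OF cl(1)[OF x] cl(2)[OF x]] C(2)[OF x] D(2)[OF x] x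
      by (simp add: op_add_def distrib_right)
    show "op_add V A B (vscale V c x) = vscale V c (op_add V A B x)"
      using x A B by (simp add: op_add_def V.scale_closed bounded_ops_scale V.scale_add_right cl)
    assume y: "y \<in> vecs V"
    show "op_add V A B (vadd V x y) = vadd V (op_add V A B x) (op_add V A B y)"
      using x y A B by (simp add: op_add_def V.add_closed bounded_ops_add) (simp add: ell2_add add_ac)
  qed (auto simp: op_add_def cl V.add_closed)
qed

lemma op_scale_bounded:
  assumes A: "A \<in> bounded_ops V"
  shows "op_scale V c A \<in> bounded_ops V"
proof -
  obtain C where C: "C \<ge> 0" "\<And>x. x \<in> vecs V \<Longrightarrow> vnorm V (A x) \<le> C * vnorm V x"
    using bounded_opsE[OF A] by blast
  note cl = bounded_ops_closed[OF A]
  show ?thesis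
  proof (rule bounded_opsI[of _ "cmod c * C"])
    fix x y d assume x: "x \<in> vecs V"
    show "vnorm V (op_scale V c A x) \<le> cmod c * C * vnorm V x"
      using mult_left_mono[OF C(2)[OF x], of "cmod c"] x cl
      by (simp add: op_scale_def V.norm_scale mult.assoc)
    show "op_scale V c A (vscale V d x) = vscale V d (op_scale V c A x)"
      using x A by (simp add: op_scale_def V.scale_closed bounded_ops_scale) (simp add: ell2_scale mult_ac)
    assume y: "y \<in> vecs V"
    show "op_scale V c A (vadd V x y) = vadd V (op_scale V c A x) (op_scale V c A y)"
      using x y A by (simp add: op_scale_def V.add_closed bounded_ops_add V.scale_add_right cl)
  qed (auto simp: op_scale_def cl V.scale_closed)
qed

lemma op_mult_bounded:
  assumes A: "A \<in> bounded_ops V" and B: "B \<in> bounded_ops V"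
  shows "op_mult V A B \<in> bounded_ops V"
proof -
  obtain C where C: "C \<ge> 0" "\<And>x. x \<in> vecs V \<Longrightarrow> vnorm V (A x) \<le> C * vnorm V x"
    using bounded_opsE[OF A] by blast
  obtain D where D: "D \<ge> 0" "\<And>x. x \<in> vecs V \<Longrightarrow> vnorm V (B x) \<le> D * vnorm V x"
    using bounded_opsE[OF B] by blast
  note cl = bounded_ops_closed[OF A] bounded_ops_closed[OF B]
  show ?thesis
  proof (rule bounded_opsI[of _ "C * D"])
    fix x y c assume x: "x \<in> vecs V"
    show "vnorm V (op_mult V A B x) \<le> C * D * vnorm V x"
      using order_trans[OF C(2)[OF cl(2)[OF x]] mult_left_mono[OF D(2)[OF x] C(1)]] x
      by (simp add: compose_eq mult.assoc)
  qed (auto simp: compose_eq cl V.scale_closed V.add_closed bounded_ops_scale[OF A]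
      bounded_ops_scale[OF B] bounded_ops_add[OF A] bounded_ops_add[OF B])
qed

lemma cstar_subalgebra_bounded_ops: "cstar_subalgebra V (bounded_ops V)"
  unfolding cstar_subalgebra_def
  by (auto simp: op_zero_bounded op_add_bounded op_scale_bounded op_mult_bounded op_adj_bounded)

text \<open>An intersection inherits the closure conditions. The bounded operators are one member of
  the family, which keeps the intersection inside them.\<close>

lemma cstar_generated_subalgebra:
  assumes "A \<in> bounded_ops V"
  shows "cstar_subalgebra V (cstar_generated V A)"
proof -
  have sub: "cstar_generated V A \<subseteq> bounded_ops V"
    using assms cstar_subalgebra_bounded_ops by (auto simp: cstar_generated_def)
  have cl: "A' \<in> cstar_generated V A"
    if "A' \<in> bounded_ops V"
      "\<And>\<epsilon>. \<epsilon> > 0 \<Longrightarrow> \<exists>B\<in>cstar_generated V A. \<forall>x\<in>vecs V. vdist V (A' x) (B x) \<le> \<epsilon> * vnorm V x" for A'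
    unfolding cstar_generated_def
  proof safe
    fix \<A> assume \<A>: "cstar_subalgebra V \<A>" "A \<in> \<A>"
    then have "\<forall>\<epsilon>>0. \<exists>B\<in>\<A>. \<forall>x\<in>vecs V. vdist V (A' x) (B x) \<le> \<epsilon> * vnorm V x"
      using that(2) unfolding cstar_generated_def by blast
    then show "A' \<in> \<A>" using \<A> that(1) unfolding cstar_subalgebra_def by blast
  qed
  show ?thesis
    unfolding cstar_subalgebra_def
  proof (intro conjI sub)
    show "\<forall>A'\<in>bounded_ops V. (\<forall>\<epsilon>>0. \<exists>B\<in>cstar_generated V A.
        \<forall>x\<in>vecs V. vdist V (A' x) (B x) \<le> \<epsilon> * vnorm V x) \<longrightarrow> A' \<in> cstar_generated V A"
      using cl by blast
  qed (auto simp: cstar_generated_def cstar_subalgebra_def)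
qed

lemma cstar_generated_contains: "A \<in> cstar_generated V A"
  by (simp add: cstar_generated_def)

end

section \<open>Band operators\<close>

text \<open>The matrix with \<open>F k\<close> in row \<open>k\<close> and column
  \<open>k - d\<close> and zeros off this diagonal. Shifts, diagonal operators and their products
  all have this shape.\<close>

definition band :: "int set \<Rightarrow> int \<Rightarrow> (int \<Rightarrow> complex) \<Rightarrow> (int \<Rightarrow> complex) \<Rightarrow> int \<Rightarrow> complex" where
  "band S d F = (\<lambda>x\<in>vecs (ell2 S). \<lambda>k. if k \<in> S then F k * x (k - d) else 0)"

lemma band_apply: "x \<in> vecs (ell2 S) \<Longrightarrow> band S d F x k = (if k \<in> S then F k * x (k - d) else 0)"
  by (simp add: band_def)

lemma band_closed_bound:
  assumes x: "x \<in> vecs (ell2 S)" and F: "\<And>k. k \<in> S \<Longrightarrow> cmod (F k) \<le> C" and C: "C \<ge> 0"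
  shows "band S d F x \<in> vecs (ell2 S)" and "vnorm (ell2 S) (band S d F x) \<le> C * vnorm (ell2 S) x"
proof -
  interpret V: pre_hilbert "ell2 S" by (rule pre_hilbert_ell2)
  have sum: "(\<Sum>k\<in>K. (cmod (band S d F x k))\<^sup>2) \<le> (C * vnorm (ell2 S) x)\<^sup>2" if K: "finite K" "K \<subseteq> S" for K
  proof -
    have "(\<Sum>k\<in>K. (cmod (band S d F x k))\<^sup>2) \<le> (\<Sum>k\<in>K. C\<^sup>2 * (cmod (x (k - d)))\<^sup>2)"
    proof (rule sum_mono)
      fix k assume "k \<in> K"
      then have "cmod (F k) * cmod (x (k - d)) \<le> C * cmod (x (k - d))"
        using F K by (intro mult_right_mono) auto
      then have "(cmod (F k) * cmod (x (k - d)))\<^sup>2 \<le> (C * cmod (x (k - d)))\<^sup>2"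
        by (intro power_mono) auto
      then show "(cmod (band S d F x k))\<^sup>2 \<le> C\<^sup>2 * (cmod (x (k - d)))\<^sup>2"
        using \<open>k \<in> K\<close> K by (auto simp: band_apply[OF x] norm_mult power_mult_distrib)
    qed
    also have "\<dots> = C\<^sup>2 * (\<Sum>j\<in>(\<lambda>k. k - d) ` K. (cmod (x j))\<^sup>2)"
      by (simp add: sum.reindex inj_on_def sum_distrib_left)
    also have "(\<Sum>j\<in>(\<lambda>k. k - d) ` K. (cmod (x j))\<^sup>2) = (\<Sum>j\<in>(\<lambda>k. k - d) ` K \<inter> S. (cmod (x j))\<^sup>2)"
      using K by (intro sum.mono_neutral_right) (auto simp: ell2_outside[OF x])
    also have "C\<^sup>2 * \<dots> \<le> C\<^sup>2 * (vnorm (ell2 S) x)\<^sup>2"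
      using K by (intro mult_left_mono ell2_finite_sum_le x) auto
    finally show ?thesis by (simp add: power_mult_distrib)
  qed
  have "band S d F x k = 0" if "k \<notin> S" for k using that by (simp add: band_apply[OF x])
  from ell2_boundedI[OF this _ sum]
  show "band S d F x \<in> vecs (ell2 S)" "vnorm (ell2 S) (band S d F x) \<le> C * vnorm (ell2 S) x"
    using C V.norm_nonneg[OF x] by simp_all
qed

lemma band_bounded:
  assumes F: "\<And>k. k \<in> S \<Longrightarrow> cmod (F k) \<le> C"
  shows "band S d F \<in> bounded_ops (ell2 S)"
proof -
  interpret V: pre_hilbert "ell2 S" by (rule pre_hilbert_ell2)
  have F': "cmod (F k) \<le> \<bar>C\<bar>" if "k \<in> S" for k using F[OF that] by linarith
  show ?thesis
  proof (rule bounded_opsI[of _ _ "\<bar>C\<bar>"])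
    fix x y c assume x: "x \<in> vecs (ell2 S)"
    show "band S d F x \<in> vecs (ell2 S)" by (rule band_closed_bound(1)[OF x F']) auto
    show "vnorm (ell2 S) (band S d F x) \<le> \<bar>C\<bar> * vnorm (ell2 S) x"
      by (rule band_closed_bound(2)[OF x F']) auto
    show "band S d F (vscale (ell2 S) c x) = vscale (ell2 S) c (band S d F x)"
      by (intro ext) (simp add: band_apply x V.scale_closed, simp add: ell2_scale band_apply x)
    assume y: "y \<in> vecs (ell2 S)"
    show "band S d F (vadd (ell2 S) x y) = vadd (ell2 S) (band S d F x) (band S d F y)"
      by (intro ext) (simp add: band_apply x y V.add_closed, simp add: ell2_add band_apply x y distrib_left)
  qed (simp add: band_def)
qed

text \<open>Vectors vanish outside \<open>S\<close>, so that rows whose column index leaves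
  \<open>S\<close> impose nothing on \<open>F\<close>. This absorbs the boundary cases of the
  unilateral shift.\<close>

lemma band_cong:
  assumes "\<And>k. k \<in> S \<Longrightarrow> k - d \<in> S \<Longrightarrow> F k = G k"
  shows "band S d F = band S d G"
  unfolding band_def
proof (intro restrict_ext ext)
  fix x k assume "x \<in> vecs (ell2 S)"
  then show "(if k \<in> S then F k * x (k - d) else 0) = (if k \<in> S then G k * x (k - d) else 0)"
    using assms[of k] ell2_outside[of x S "k - d"] by auto
qed

lemma band_add: "op_add (ell2 S) (band S d F) (band S d G) = band S d (\<lambda>k. F k + G k)"
  unfolding op_add_def
  by (subst (3) band_def) (intro restrict_ext ext, simp add: ell2_add band_apply distrib_right)

lemma band_scale: "op_scale (ell2 S) c (band S d F) = band S d (\<lambda>k. c * F k)"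
  unfolding op_scale_def
  by (subst (2) band_def) (intro restrict_ext ext, simp add: ell2_scale band_apply)

lemma band_mult:
  assumes G: "\<And>k. k \<in> S \<Longrightarrow> cmod (G k) \<le> C"
  shows "op_mult (ell2 S) (band S d F) (band S e G) =
    band S (d + e) (\<lambda>k. if k - d \<in> S then F k * G (k - d) else 0)"
  unfolding compose_def
  by (subst (3) band_def)
    (intro restrict_ext ext, simp add: band_apply bounded_ops_closed[OF band_bounded[OF G]] algebra_simps)

lemma band_basis:
  assumes "j \<in> S"
  shows "band S d F (basis_vec j) k = (if k \<in> S \<and> k - d = j then F k else 0)"
  using assms by (simp add: band_apply basis_vecs) (simp add: basis_vec_def)

lemma band_adj:
  assumes F: "\<And>k. k \<in> S \<Longrightarrow> cmod (F k) \<le> C"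
  shows "op_adj (ell2 S) (band S d F) = band S (- d) (\<lambda>k. if k + d \<in> S then cnj (F (k + d)) else 0)"
    (is "_ = ?B")
proof (rule op_eqI)
  show "op_adj (ell2 S) (band S d F) \<in> bounded_ops (ell2 S)"
    by (rule op_adj_bounded[OF band_bounded[OF F]])
  have "cmod (F k) \<le> \<bar>C\<bar>" if "k \<in> S" for k using F[OF that] by linarith
  then show "?B \<in> bounded_ops (ell2 S)" by (intro band_bounded[of _ _ "\<bar>C\<bar>"]) auto
  fix y k assume y: "y \<in> vecs (ell2 S)" and k: "k \<in> S"
  have "op_adj (ell2 S) (band S d F) y k = vinner (ell2 S) y (band S d F (basis_vec k))"
    by (rule op_adj_apply[OF band_bounded[OF F] y k])
  also have "\<dots> = (\<Sum>\<^sub>\<infinity>m\<in>{k + d} \<inter> S. y m * cnj (F m))"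
    unfolding ell2_inner by (intro infsum_cong_neutral) (auto simp: band_basis[OF k])
  also have "\<dots> = ?B y k" using k by (auto simp: band_apply[OF y] mult.commute)
  finally show "op_adj (ell2 S) (band S d F) y k = ?B y k" .
qed

lemma diag_op_band: "diag_op S F = band S 0 F"
  unfolding diag_op_def band_def by (intro restrict_ext ext) (simp add: ell2_outside)

section \<open>The inner product on the quantum algebra\<close>

text \<open>One parameter value is frozen. The positive bound \<open>lo\<close> keeps the spectrum
  of the modulus of the weighted shift away from 0; in the disk case the squared inner radius would
  not do so.\<close>

locale weight =
  fixes S :: "int set" and v :: "int \<Rightarrow> real" and lo hi :: real
  assumes index: "S = {0..} \<or> S = UNIV"
    and strict: "strict_mono_on S v"
    and pos: "\<And>k. k \<in> S \<Longrightarrow> v k > 0"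
    and lo_pos: "lo > 0"
    and range: "\<And>k. k \<in> S \<Longrightarrow> (v k)\<^sup>2 \<in> {lo..hi}"
begin

lemma succ_closed: "k \<in> S \<Longrightarrow> 0 \<le> n \<Longrightarrow> k + n \<in> S"
  using index by auto

lemma upward_closed: "i \<in> S \<Longrightarrow> i \<le> k \<Longrightarrow> k \<in> S"
  using index by auto

lemma zero_mem: "0 \<in> S"
  using index by auto

text \<open>With the extension by 0 the weight differences are the increments of \<open>E\<close>
  over all integers, and both index sets telescope in the same way.\<close>

definition E :: "int \<Rightarrow> real" where "E k = (weight_ext S v k)\<^sup>2"

lemma E_eq: "k \<in> S \<Longrightarrow> E k = (v k)\<^sup>2"
  by (simp add: E_def weight_ext_def)

lemma E_nonneg: "0 \<le> E k"
  by (simp add: E_def)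

lemma hi_pos: "0 < hi"
  using range[OF zero_mem] lo_pos by simp

lemma E_le: "E k \<le> hi"
  using range[of k] hi_pos by (auto simp: E_def weight_ext_def)

lemma weight_diff_eq: "weight_diff S v k = E k - E (k - 1)"
  by (simp add: weight_diff_def E_def)

lemma E_strict: "k \<in> S \<Longrightarrow> E (k - 1) < E k"
proof -
  assume k: "k \<in> S"
  show ?thesis
  proof (cases "k - 1 \<in> S")
    case True
    then have "v (k - 1) < v k" using strict k by (auto simp: strict_mono_on_def)
    then show ?thesis
      using True k pos[OF True] by (simp add: E_eq power_strict_mono)
  next
    case False
    then show ?thesis using k pos[OF k] by (simp add: E_def weight_ext_def)
  qed
qed

lemma weight_diff_outside: "k \<notin> S \<Longrightarrow> weight_diff S v k = 0"
  using succ_closed[of "k - 1" 1] by (auto simp: weight_diff_def weight_ext_def)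

lemma weight_diff_pos: "k \<in> S \<Longrightarrow> 0 < weight_diff S v k"
  using E_strict[of k] by (simp add: weight_diff_eq)

lemma weight_diff_nonneg: "0 \<le> weight_diff S v k"
  using weight_diff_pos[of k] weight_diff_outside[of k] by (cases "k \<in> S") auto

text \<open>The condition admits the empty interval \<open>b = a - 1\<close>, which starts the
  induction.\<close>

lemma sum_weight_diff: "a - 1 \<le> b \<Longrightarrow> (\<Sum>k\<in>{a..b}. weight_diff S v k) = E b - E (a - 1)"
proof (induction b rule: int_ge_induct)
  case base
  then show ?case by simp
next
  case (step i)
  have "{a..i + 1} = insert (i + 1) {a..i}" using step by auto
  then show ?case using step by (simp add: weight_diff_eq)
qed

text \<open>The differences are nonnegative, so \<open>F\<close> may be padded to an interval, over
  which the sum telescopes. Hence the diagonal operator \<open>S_t\<close> is of trace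
  class.\<close>

lemma sum_weight_diff_le: "finite F \<Longrightarrow> (\<Sum>k\<in>F. weight_diff S v k) \<le> hi"
proof (cases "F = {}")
  case False
  assume F: "finite F"
  have "(\<Sum>k\<in>F. weight_diff S v k) \<le> (\<Sum>k\<in>{Min F..Max F}. weight_diff S v k)"
    using F by (intro sum_mono2) (auto simp: weight_diff_nonneg)
  also have "\<dots> = E (Max F) - E (Min F - 1)"
    using Min_le[OF F Max_in[OF F False]] by (intro sum_weight_diff) linarith
  also have "\<dots> \<le> hi" using E_le[of "Max F"] E_nonneg[of "Min F - 1"] by simp
  finally show ?thesis .
qed (use hi_pos in simp)

lemma weight_diff_summable: "weight_diff S v summable_on A"
  by (rule nonneg_bdd_above_summable_on)
    (auto simp: weight_diff_nonneg bdd_above_def intro: sum_weight_diff_le)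

definition s :: "int \<Rightarrow> real" where "s k = sqrt (weight_diff S v k)"

lemma s_nonneg: "0 \<le> s k"
  by (simp add: s_def weight_diff_nonneg)

lemma s_square: "s k * s k = weight_diff S v k"
  by (simp add: s_def weight_diff_nonneg)

lemma s_le: "s k \<le> sqrt hi"
  using sum_weight_diff_le[of "{k}"] by (simp add: s_def)

text \<open>Separates row index from column index: each half is summable by itself.\<close>

lemma s_mult_le: "s j * s k \<le> (weight_diff S v j + weight_diff S v k) / 2"
  using sum_squares_bound[of "s j" "s k"] by (simp add: s_square power2_eq_square)

abbreviation V where "V \<equiv> ell2 S"

interpretation V: pre_hilbert V by (rule pre_hilbert_ell2)

lemma sqrt_S_eq: "sqrt_S S v = band S 0 (\<lambda>k. of_real (s k))"
  by (simp add: sqrt_S_def diag_op_band s_def)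

lemma sqrt_S_bounded: "sqrt_S S v \<in> bounded_ops V"
  unfolding sqrt_S_eq using s_le by (intro band_bounded[of _ _ "sqrt hi"]) (simp add: s_nonneg)

section \<open>Matrix entries and the trace form\<close>

definition entry :: "((int \<Rightarrow> complex) \<Rightarrow> int \<Rightarrow> complex) \<Rightarrow> int \<times> int \<Rightarrow> complex" where
  "entry a p = a (basis_vec (snd p)) (fst p)"

definition W :: "int \<times> int \<Rightarrow> real" where "W p = s (fst p) * s (snd p)"

lemma W_nonneg: "0 \<le> W p"
  by (simp add: W_def s_nonneg)

text \<open>The weights split by \<open>s_mult_le\<close> into a part depending on the row and a
  part depending on the column. Rows and columns of a bounded operator have squared norm at most
  \<open>C^2\<close>, and the remaining weights sum to at most \<open>hi\<close> each.\<close>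

lemma entry_summable:
  assumes a: "a \<in> bounded_ops V"
  shows "(\<lambda>p. W p * (cmod (entry a p))\<^sup>2) summable_on S \<times> S"
proof (rule nonneg_bdd_above_summable_on)
  obtain C where C: "C \<ge> 0" "\<And>x. x \<in> vecs V \<Longrightarrow> vnorm V (a x) \<le> C * vnorm V x"
    using bounded_opsE[OF a] by blast
  have one: "vnorm V (basis_vec k) = 1" if "k \<in> S" for k
    unfolding vnorm_def using that by (simp add: inner_basis) (simp add: basis_vec_def)
  have col: "(\<Sum>k\<in>F. (cmod (entry a (k, j)))\<^sup>2) \<le> C\<^sup>2" if "j \<in> S" "finite F" "F \<subseteq> S" for j F
  proof -
    note e = basis_vecs[OF that(1)]
    have "(\<Sum>k\<in>F. (cmod (entry a (k, j)))\<^sup>2) \<le> (vnorm V (a (basis_vec j)))\<^sup>2"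
      using ell2_finite_sum_le[OF bounded_ops_closed[OF a e] that(2,3)] by (simp add: entry_def)
    also have "\<dots> \<le> C\<^sup>2"
      using C(2)[OF e] one[OF that(1)] V.norm_nonneg[OF bounded_ops_closed[OF a e]]
      by (intro power_mono) auto
    finally show ?thesis .
  qed
  have row: "(\<Sum>j\<in>F. (cmod (entry a (k, j)))\<^sup>2) \<le> C\<^sup>2" if "k \<in> S" "finite F" "F \<subseteq> S" for k F
  proof -
    note e = basis_vecs[OF that(1)]
    have "(\<Sum>j\<in>F. (cmod (entry a (k, j)))\<^sup>2) = (\<Sum>j\<in>F. (cmod (op_adj V a (basis_vec k) j))\<^sup>2)"
      using that a by (intro sum.cong) (auto simp: entry_def op_adj_basis)
    also have "\<dots> \<le> (vnorm V (op_adj V a (basis_vec k)))\<^sup>2"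
      by (rule ell2_finite_sum_le[OF bounded_ops_closed[OF op_adj_bounded[OF a] e] that(2,3)])
    also have "\<dots> \<le> C\<^sup>2"
      using adj_bound(2)[OF a C e] one[OF that(1)]
        V.norm_nonneg[OF bounded_ops_closed[OF op_adj_bounded[OF a] e]]
      by (intro power_mono) (auto simp: op_adj_eq[OF a])
    finally show ?thesis .
  qed
  show "bdd_above (sum (\<lambda>p. W p * (cmod (entry a p))\<^sup>2) ` {F. F \<subseteq> S \<times> S \<and> finite F})"
  proof (rule bdd_aboveI2)
    fix F assume F: "F \<in> {F. F \<subseteq> S \<times> S \<and> finite F}"
    \<comment> \<open>Enlarging \<open>F\<close> to a rectangle allows complete rows and columns to
      be summed separately.\<close>
    define K L where "K = fst ` F" and "L = snd ` F"
    have KL: "finite K" "finite L" "K \<subseteq> S" "L \<subseteq> S" "F \<subseteq> K \<times> L"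
      using F by (auto simp: K_def L_def image_iff) force+
    let ?e = "\<lambda>k j. (cmod (entry a (k, j)))\<^sup>2"
    have "(\<Sum>p\<in>F. W p * (cmod (entry a p))\<^sup>2) \<le> (\<Sum>p\<in>K \<times> L. W p * (cmod (entry a p))\<^sup>2)"
      using KL by (intro sum_mono2) (auto simp: W_nonneg)
    also have "\<dots> = (\<Sum>k\<in>K. \<Sum>j\<in>L. s k * s j * ?e k j)"
      by (simp add: sum.cartesian_product W_def case_prod_beta)
    also have "\<dots> \<le> (\<Sum>k\<in>K. \<Sum>j\<in>L. (weight_diff S v k / 2) * ?e k j + (weight_diff S v j / 2) * ?e k j)"
    proof (intro sum_mono)
      fix k j
      show "s k * s j * ?e k j \<le> (weight_diff S v k / 2) * ?e k j + (weight_diff S v j / 2) * ?e k j"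
        using mult_right_mono[OF s_mult_le[of k j], of "?e k j"] by (simp add: algebra_simps add_divide_distrib)
    qed
    also have "\<dots> = (\<Sum>k\<in>K. (weight_diff S v k / 2) * (\<Sum>j\<in>L. ?e k j)) +
        (\<Sum>j\<in>L. (weight_diff S v j / 2) * (\<Sum>k\<in>K. ?e k j))"
      unfolding sum.distrib sum_distrib_left by (simp add: sum.swap[of _ K L])
    also have "\<dots> \<le> (\<Sum>k\<in>K. (weight_diff S v k / 2) * C\<^sup>2) + (\<Sum>j\<in>L. (weight_diff S v j / 2) * C\<^sup>2)"
      using KL by (intro add_mono sum_mono mult_left_mono row col) (auto simp: weight_diff_nonneg)
    also have "\<dots> = ((\<Sum>k\<in>K. weight_diff S v k) + (\<Sum>j\<in>L. weight_diff S v j)) * (C\<^sup>2 / 2)"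
      by (simp add: sum_distrib_right distrib_right)
    also have "\<dots> \<le> (hi + hi) * (C\<^sup>2 / 2)"
      using KL by (intro mult_right_mono add_mono sum_weight_diff_le) auto
    finally show "(\<Sum>p\<in>F. W p * (cmod (entry a p))\<^sup>2) \<le> (hi + hi) * (C\<^sup>2 / 2)" .
  qed
qed (simp add: W_nonneg)

definition ip where "ip a b = (\<Sum>\<^sub>\<infinity>p\<in>S \<times> S. of_real (W p) * (entry a p * cnj (entry b p)))"

lemma ip_summable:
  "\<lbrakk>a \<in> bounded_ops V; b \<in> bounded_ops V\<rbrakk> \<Longrightarrow>
    (\<lambda>p. of_real (W p) * (entry a p * cnj (entry b p))) summable_on S \<times> S"
  by (intro weighted_product_summable entry_summable W_nonneg)

text \<open>Each diagonal entry of the operator under the trace is a series over the columns of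
  \<open>a\<close>; joint summability merges the iterated series into one over pairs.\<close>

lemma quantum_inner:
  assumes a: "a \<in> bounded_ops V" and b: "b \<in> bounded_ops V"
  shows "vinner (quantum_pre S v) a b = ip a b"
proof -
  let ?R = "sqrt_S S v" and ?T = "op_mult V (sqrt_S S v) (op_mult V a (op_mult V (sqrt_S S v) (op_adj V b)))"
  have "vinner V (?T (basis_vec k)) (basis_vec k) =
      (\<Sum>\<^sub>\<infinity>j\<in>S. of_real (W (k, j)) * (entry a (k, j) * cnj (entry b (k, j))))" if k: "k \<in> S" for k
  proof -
    note e = basis_vecs[OF k]
    have b': "op_adj V b (basis_vec k) \<in> vecs V" using bounded_ops_closed[OF op_adj_bounded[OF b] e] .
    have r: "?R (op_adj V b (basis_vec k)) \<in> vecs V" using bounded_ops_closed[OF sqrt_S_bounded b'] .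
    have "vinner V (?T (basis_vec k)) (basis_vec k) = of_real (s k) * a (?R (op_adj V b (basis_vec k))) k"
      using k e bounded_ops_closed[OF a r] by (simp add: inner_basis compose_eq sqrt_S_eq band_apply)
    also have "a (?R (op_adj V b (basis_vec k))) k =
        (\<Sum>\<^sub>\<infinity>j\<in>S. a (basis_vec j) k * ?R (op_adj V b (basis_vec k)) j)"
      by (rule bounded_op_apply[OF a r k])
    also have "of_real (s k) * \<dots> =
        (\<Sum>\<^sub>\<infinity>j\<in>S. of_real (s k) * (a (basis_vec j) k * ?R (op_adj V b (basis_vec k)) j))"
      by (rule infsum_cmult_right'[symmetric])
    also have "\<dots> = (\<Sum>\<^sub>\<infinity>j\<in>S. of_real (W (k, j)) * (entry a (k, j) * cnj (entry b (k, j))))"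
      using b' k by (intro infsum_cong)
        (simp add: sqrt_S_eq band_apply op_adj_basis[OF b] W_def entry_def)
    finally show ?thesis .
  qed
  then have "vinner (quantum_pre S v) a b =
      (\<Sum>\<^sub>\<infinity>k\<in>S. \<Sum>\<^sub>\<infinity>j\<in>S. of_real (W (k, j)) * (entry a (k, j) * cnj (entry b (k, j))))"
    unfolding quantum_pre_def Let_def op_trace_def cspace.simps by (intro infsum_cong)
  also have "\<dots> = ip a b"
    unfolding ip_def using ip_summable[OF a b]
    by (subst infsum_Sigma_banach[symmetric]) (auto simp: case_prod_beta)
  finally show ?thesis .
qed

section \<open>The C*-algebra generated by the weighted shift\<close>

abbreviation alg where "alg \<equiv> cstar_generated V (weighted_shift S v)"

text \<open>The values of \<open>v\<close> outside \<open>S\<close> are arbitrary. The guard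
  replaces them by 0, which makes the coefficients of the band bounded.\<close>

lemma weighted_shift_band: "weighted_shift S v = band S 1 (\<lambda>k. if k - 1 \<in> S then of_real (v (k - 1)) else 0)"
  unfolding weighted_shift_def band_def
proof (intro restrict_ext ext)
  fix x k assume "x \<in> vecs V"
  then show "of_real (v (k - 1)) * x (k - 1) =
      (if k \<in> S then (if k - 1 \<in> S then of_real (v (k - 1)) else 0) * x (k - 1) else 0)"
    using succ_closed[of "k - 1" 1] ell2_outside[of x S "k - 1"] by auto
qed

lemma v_le: "k \<in> S \<Longrightarrow> v k \<le> sqrt hi"
  using range[of k] by (auto intro: real_le_rsqrt)

lemma weighted_shift_bound: "k \<in> S \<Longrightarrow> cmod (if k - 1 \<in> S then of_real (v (k - 1)) else 0) \<le> sqrt hi"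
  using v_le[of "k - 1"] pos[of "k - 1"] hi_pos by auto

lemma weighted_shift_bounded: "weighted_shift S v \<in> bounded_ops V"
  unfolding weighted_shift_band by (rule band_bounded[OF weighted_shift_bound])

lemma alg_subalgebra: "cstar_subalgebra V alg"
  by (rule cstar_generated_subalgebra[OF weighted_shift_bounded])

lemma alg_bounded: "a \<in> alg \<Longrightarrow> a \<in> bounded_ops V"
  and alg_zero: "op_zero V \<in> alg"
  and alg_add: "\<lbrakk>a \<in> alg; b \<in> alg\<rbrakk> \<Longrightarrow> op_add V a b \<in> alg"
  and alg_scale: "a \<in> alg \<Longrightarrow> op_scale V c a \<in> alg"
  and alg_mult: "\<lbrakk>a \<in> alg; b \<in> alg\<rbrakk> \<Longrightarrow> op_mult V a b \<in> alg"
  and alg_adj: "a \<in> alg \<Longrightarrow> op_adj V a \<in> alg"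
  and alg_closed: "\<lbrakk>a \<in> bounded_ops V;
    \<And>\<epsilon>. \<epsilon> > 0 \<Longrightarrow> \<exists>b\<in>alg. \<forall>x\<in>vecs V. vdist V (a x) (b x) \<le> \<epsilon> * vnorm V x\<rbrakk> \<Longrightarrow> a \<in> alg"
  using alg_subalgebra unfolding cstar_subalgebra_def by blast+

lemma quantum_vecs: "vecs (quantum_pre S v) = alg"
  and quantum_zero: "vzero (quantum_pre S v) = op_zero V"
  and quantum_add: "vadd (quantum_pre S v) = op_add V"
  and quantum_scale: "vscale (quantum_pre S v) = op_scale V"
  by (simp_all add: quantum_pre_def Let_def)

lemma entry_add: "p \<in> S \<times> S \<Longrightarrow> entry (op_add V a b) p = entry a p + entry b p"
  and entry_scale: "p \<in> S \<times> S \<Longrightarrow> entry (op_scale V c a) p = c * entry a p"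
  by (auto simp: entry_def op_add_def op_scale_def basis_vecs ell2_add ell2_scale)

lemma pre_hilbert_quantum: "pre_hilbert (quantum_pre S v)"
proof
  let ?Q = "quantum_pre S v"
  fix a b c :: "(int \<Rightarrow> complex) \<Rightarrow> int \<Rightarrow> complex" and \<alpha> \<beta> :: complex
  note q = quantum_vecs quantum_zero quantum_add quantum_scale
  note ops = op_zero_def op_add_def op_scale_def
  show "vzero ?Q \<in> vecs ?Q" by (simp add: q alg_zero)
  assume "a \<in> vecs ?Q"
  then have a: "a \<in> alg" and a': "a \<in> bounded_ops V" by (simp_all add: q alg_bounded)
  note ea = bounded_ops_ext[OF a', unfolded extensional_def]
  note cl = bounded_ops_closed[OF a']
  show "vscale ?Q \<alpha> a \<in> vecs ?Q" using a by (simp add: q alg_scale)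
  show "vadd ?Q a (vzero ?Q) = a" "vdiff ?Q a a = vzero ?Q" "vscale ?Q 1 a = a"
    "vscale ?Q (\<alpha> + \<beta>) a = vadd ?Q (vscale ?Q \<alpha> a) (vscale ?Q \<beta> a)"
    "vscale ?Q \<alpha> (vscale ?Q \<beta> a) = vscale ?Q (\<alpha> * \<beta>) a"
    using ea by (auto simp: q ops vdiff_def restrict_def V.scale_add_left V.scale_scale cl V.add_zero V.scale_one
        V.diff_self[unfolded vdiff_def] intro!: ext)
  have "Re (ip a a) = (\<Sum>\<^sub>\<infinity>p\<in>S \<times> S. Re (of_real (W p) * (entry a p * cnj (entry a p))))"
    unfolding ip_def by (rule infsum_Re[symmetric, OF ip_summable[OF a' a']])
  also have "\<dots> \<ge> 0"
    by (intro infsum_nonneg) (simp add: W_nonneg)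
  finally show "0 \<le> Re (vinner ?Q a a)" by (simp add: quantum_inner a')
  assume "b \<in> vecs ?Q"
  then have b: "b \<in> alg" and b': "b \<in> bounded_ops V" by (simp_all add: q alg_bounded)
  note eb = bounded_ops_ext[OF b', unfolded extensional_def]
  note cl = cl bounded_ops_closed[OF b']
  show "vadd ?Q a b \<in> vecs ?Q" using a b by (simp add: q alg_add)
  show "vadd ?Q a b = vadd ?Q b a"
    by (auto simp: q ops restrict_def V.add_commute[OF cl] intro!: ext)
  show "vscale ?Q \<alpha> (vadd ?Q a b) = vadd ?Q (vscale ?Q \<alpha> a) (vscale ?Q \<alpha> b)"
    by (auto simp: q ops restrict_def V.scale_add_right cl intro!: ext)
  show "vinner ?Q (vscale ?Q \<alpha> a) b = \<alpha> * vinner ?Q a b"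
  proof -
    have "ip (op_scale V \<alpha> a) b = (\<Sum>\<^sub>\<infinity>p\<in>S \<times> S. \<alpha> * (of_real (W p) * (entry a p * cnj (entry b p))))"
      unfolding ip_def by (intro infsum_cong) (simp add: entry_scale mult_ac)
    then show ?thesis
      using a' b' by (simp add: q quantum_inner op_scale_bounded infsum_cmult_right' ip_def)
  qed
  show "vinner ?Q a b = cnj (vinner ?Q b a)"
    using a' b' by (simp add: quantum_inner ip_def infsum_cnj[symmetric] mult_ac del: infsum_cnj)
  assume "c \<in> vecs ?Q"
  then have c: "c \<in> alg" and c': "c \<in> bounded_ops V" by (simp_all add: q alg_bounded)
  note cl = cl bounded_ops_closed[OF c']
  show "vadd ?Q (vadd ?Q a b) c = vadd ?Q a (vadd ?Q b c)"
    by (auto simp: q ops restrict_def V.add_assoc cl intro!: ext)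
  show "vinner ?Q (vadd ?Q a b) c = vinner ?Q a c + vinner ?Q b c"
  proof -
    have "ip (op_add V a b) c = (\<Sum>\<^sub>\<infinity>p\<in>S \<times> S. of_real (W p) * (entry a p * cnj (entry c p)) +
        of_real (W p) * (entry b p * cnj (entry c p)))"
      unfolding ip_def by (intro infsum_cong) (simp add: entry_add algebra_simps)
    then show ?thesis
      using a' b' c' by (simp add: q quantum_inner op_add_bounded ip_def infsum_add ip_summable)
  qed
qed

lemma quantum_norm:
  assumes "a \<in> bounded_ops V"
  shows "vnorm (quantum_pre S v) a = sqrt (\<Sum>\<^sub>\<infinity>p\<in>S \<times> S. W p * (cmod (entry a p))\<^sup>2)"
proof -
  have "ip a a = of_real (\<Sum>\<^sub>\<infinity>p\<in>S \<times> S. W p * (cmod (entry a p))\<^sup>2)"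
    unfolding ip_def complex_norm_square[symmetric] of_real_mult[symmetric]
    by (intro infsumI has_sum_of_real has_sum_infsum entry_summable assms)
  then show ?thesis using assms by (simp add: vnorm_def quantum_inner)
qed

section \<open>Functions of the squared modulus of the weighted shift\<close>

definition calc :: "(real \<Rightarrow> complex) \<Rightarrow> (int \<Rightarrow> complex) \<Rightarrow> int \<Rightarrow> complex" where
  "calc \<phi> = band S 0 (\<lambda>k. \<phi> ((v k)\<^sup>2))"

text \<open>The bound on the spectrum is carried along because the product formula for band
  operators asks for it.\<close>

definition calc_in_alg :: "(real \<Rightarrow> complex) \<Rightarrow> bool" where
  "calc_in_alg \<phi> \<longleftrightarrow> (\<exists>C. \<forall>k\<in>S. cmod (\<phi> ((v k)\<^sup>2)) \<le> C) \<and> calc \<phi> \<in> alg"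

lemma calc_in_alg_mult:
  assumes "calc_in_alg \<phi>" "calc_in_alg \<psi>"
  shows "calc_in_alg (\<lambda>u. \<phi> u * \<psi> u)"
proof -
  obtain C D where C: "\<And>k. k \<in> S \<Longrightarrow> cmod (\<phi> ((v k)\<^sup>2)) \<le> C" and D: "\<And>k. k \<in> S \<Longrightarrow> cmod (\<psi> ((v k)\<^sup>2)) \<le> D"
    using assms unfolding calc_in_alg_def by blast
  have "cmod (\<phi> ((v k)\<^sup>2) * \<psi> ((v k)\<^sup>2)) \<le> C * D" if "k \<in> S" for k
    unfolding norm_mult using C[OF that] D[OF that] by (intro mult_mono) (auto intro: order_trans[OF norm_ge_zero])
  moreover have "calc (\<lambda>u. \<phi> u * \<psi> u) = op_mult V (calc \<phi>) (calc \<psi>)"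
    unfolding calc_def by (subst band_mult[OF D]) (auto intro!: band_cong)
  ultimately show ?thesis using assms unfolding calc_in_alg_def by (auto intro: alg_mult)
qed

lemma calc_in_alg_add:
  assumes "calc_in_alg \<phi>" "calc_in_alg \<psi>"
  shows "calc_in_alg (\<lambda>u. \<phi> u + \<psi> u)"
proof -
  obtain C D where "\<And>k. k \<in> S \<Longrightarrow> cmod (\<phi> ((v k)\<^sup>2)) \<le> C" and "\<And>k. k \<in> S \<Longrightarrow> cmod (\<psi> ((v k)\<^sup>2)) \<le> D"
    using assms unfolding calc_in_alg_def by blast
  then have "cmod (\<phi> ((v k)\<^sup>2) + \<psi> ((v k)\<^sup>2)) \<le> C + D" if "k \<in> S" for k
    using that by (intro norm_triangle_le add_mono) auto
  moreover have "calc (\<lambda>u. \<phi> u + \<psi> u) = op_add V (calc \<phi>) (calc \<psi>)"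
    unfolding calc_def by (simp add: band_add)
  ultimately show ?thesis using assms unfolding calc_in_alg_def by (auto intro: alg_add)
qed

lemma calc_in_alg_scale:
  assumes "calc_in_alg \<phi>"
  shows "calc_in_alg (\<lambda>u. c * \<phi> u)"
proof -
  obtain C where "\<And>k. k \<in> S \<Longrightarrow> cmod (\<phi> ((v k)\<^sup>2)) \<le> C"
    using assms unfolding calc_in_alg_def by blast
  then have "cmod (c * \<phi> ((v k)\<^sup>2)) \<le> cmod c * C" if "k \<in> S" for k
    unfolding norm_mult using that by (intro mult_left_mono) auto
  moreover have "calc (\<lambda>u. c * \<phi> u) = op_scale V c (calc \<phi>)"
    unfolding calc_def by (simp add: band_scale)
  ultimately show ?thesis using assms unfolding calc_in_alg_def by (auto intro: alg_scale)
qed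

text \<open>The adjoint of the weighted shift times the weighted shift is the diagonal operator of
  squared weights.\<close>

lemma calc_in_alg_ident: "calc_in_alg of_real"
proof -
  have "op_mult V (op_adj V (weighted_shift S v)) (weighted_shift S v) = calc of_real"
    unfolding weighted_shift_band calc_def
    by (subst band_adj[OF weighted_shift_bound], simp, subst band_mult[OF weighted_shift_bound], simp)
      (auto intro!: band_cong simp: succ_closed power2_eq_square)
  then have "calc of_real \<in> alg"
    using alg_mult[OF alg_adj[OF cstar_generated_contains] cstar_generated_contains, of] by metis
  then show ?thesis unfolding calc_in_alg_def using range by (auto intro!: exI[of _ hi] simp: norm_power)
qed

lemma calc_in_alg_times_polynomial:
  assumes "real_polynomial_function p" "calc_in_alg \<phi>"
  shows "calc_in_alg (\<lambda>u. \<phi> u * of_real (p u))"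
  using assms
proof (induction arbitrary: \<phi>)
  case (linear f)
  interpret bounded_linear f by fact
  have "f u = u * f 1" for u using scale[of u 1] by simp
  then have "(\<lambda>u. \<phi> u * of_real (f u)) = (\<lambda>u. of_real (f 1) * (\<phi> u * of_real u))"
    by (intro ext) (metis (no_types, opaque_lifting) mult.assoc mult.commute of_real_mult)
  then show ?case
    using calc_in_alg_scale[OF calc_in_alg_mult[OF linear.prems calc_in_alg_ident]] by simp
next
  case (const c)
  then show ?case using calc_in_alg_scale[of \<phi> "of_real c"] by (simp add: mult.commute)
next
  case (add p q)
  then show ?case using calc_in_alg_add by (simp add: distrib_left)
next
  case (mult p q)
  then show ?case by (simp add: mult.assoc[symmetric])
qed

lemma continuous_bounded_on_range:
  assumes "continuous_on {lo..hi} \<phi>"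
  obtains C where "\<And>k. k \<in> S \<Longrightarrow> cmod (\<phi> ((v k)\<^sup>2)) \<le> C"
proof -
  have "bounded (\<phi> ` {lo..hi})"
    using assms by (intro compact_imp_bounded compact_continuous_image) auto
  then obtain C where "\<forall>u\<in>{lo..hi}. cmod (\<phi> u) \<le> C" by (auto simp: bounded_iff)
  then show thesis using that range by blast
qed

text \<open>The C*-algebra is not assumed to be unital, so \<open>\<phi>\<close> is approximated by polynomials without
  constant term: \<open>\<phi> u / u\<close> is continuous because the spectrum stays away from \<open>0\<close>.\<close>

lemma calc_continuous:
  assumes \<phi>: "continuous_on {lo..hi} \<phi>"
  shows "calc \<phi> \<in> alg"
proof (rule alg_closed)
  obtain C where "\<And>k. k \<in> S \<Longrightarrow> cmod (\<phi> ((v k)\<^sup>2)) \<le> C" using continuous_bounded_on_range[OF \<phi>] by blast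
  then show "calc \<phi> \<in> bounded_ops V" unfolding calc_def by (rule band_bounded)
  fix \<epsilon> :: real assume \<epsilon>: "\<epsilon> > 0"
  have "continuous_on {lo..hi} (\<lambda>u. \<phi> u / of_real u)"
    using \<phi> lo_pos by (intro continuous_intros) auto
  moreover have "\<epsilon> / hi > 0" using \<epsilon> hi_pos by simp
  ultimately have "\<exists>g. polynomial_function g \<and> (\<forall>u\<in>{lo..hi}. cmod (\<phi> u / of_real u - g u) < \<epsilon> / hi)"
    by (intro Stone_Weierstrass_polynomial_function) auto
  then obtain g where g: "polynomial_function g" "\<And>u. u \<in> {lo..hi} \<Longrightarrow> cmod (\<phi> u / of_real u - g u) < \<epsilon> / hi"
    by blast
  have "real_polynomial_function (Re \<circ> g)" "real_polynomial_function (Im \<circ> g)"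
    using g(1) bounded_linear_Re bounded_linear_Im unfolding polynomial_function_def by blast+
  then have "calc_in_alg (\<lambda>u. of_real u * of_real ((Re \<circ> g) u) + \<i> * (of_real u * of_real ((Im \<circ> g) u)))"
    by (intro calc_in_alg_add calc_in_alg_scale calc_in_alg_times_polynomial calc_in_alg_ident)
  also have "(\<lambda>u. of_real u * of_real ((Re \<circ> g) u) + \<i> * (of_real u * of_real ((Im \<circ> g) u))) =
      (\<lambda>u. of_real u * g u)"
    by (auto simp: complex_eq_iff)
  finally have mem: "calc (\<lambda>u. of_real u * g u) \<in> alg" by (simp add: calc_in_alg_def)
  have close: "cmod (\<phi> u - of_real u * g u) \<le> \<epsilon>" if "u \<in> {lo..hi}" for u
  proof -
    have u: "u > 0" "u \<le> hi" using that lo_pos by auto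
    then have "\<phi> u - of_real u * g u = of_real u * (\<phi> u / of_real u - g u)" by (simp add: field_simps)
    then have "cmod (\<phi> u - of_real u * g u) = u * cmod (\<phi> u / of_real u - g u)"
      using u by (simp add: norm_mult)
    also have "\<dots> \<le> hi * (\<epsilon> / hi)"
      using u g(2)[OF that] by (intro mult_mono) auto
    finally show ?thesis using hi_pos by simp
  qed
  show "\<exists>b\<in>alg. \<forall>x\<in>vecs V. vdist V (calc \<phi> x) (b x) \<le> \<epsilon> * vnorm V x"
  proof (intro bexI[OF _ mem] ballI)
    fix x assume x: "x \<in> vecs V"
    have "vdiff V (calc \<phi> x) (calc (\<lambda>u. of_real u * g u) x) = band S 0 (\<lambda>k. \<phi> ((v k)\<^sup>2) - of_real ((v k)\<^sup>2) * g ((v k)\<^sup>2)) x"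
      by (intro ext) (simp add: ell2_diff calc_def band_apply[OF x] algebra_simps)
    then show "vdist V (calc \<phi> x) (calc (\<lambda>u. of_real u * g u) x) \<le> \<epsilon> * vnorm V x"
      unfolding vdist_def
      by (simp only:) (rule band_closed_bound(2)[OF x close[OF range] less_imp_le[OF \<epsilon>]])
  qed
qed

text \<open>Polar decomposition: the weighted shift times the inverse of its modulus. The inverse
  square root is continuous on the spectrum because \<open>lo\<close> is positive.\<close>

lemma shift_in_alg: "band S 1 (\<lambda>_. 1) \<in> alg"
proof -
  let ?\<phi> = "\<lambda>u. complex_of_real (1 / sqrt u)"
  have cont: "continuous_on {lo..hi} ?\<phi>" using lo_pos by (intro continuous_intros) auto
  obtain C where C: "\<And>k. k \<in> S \<Longrightarrow> cmod (?\<phi> ((v k)\<^sup>2)) \<le> C" using continuous_bounded_on_range[OF cont] by blast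
  have "v k \<noteq> 0" "\<bar>v k\<bar> = v k" if "k \<in> S" for k using pos[OF that] by auto
  then have "op_mult V (weighted_shift S v) (calc ?\<phi>) = band S 1 (\<lambda>_. 1)"
    unfolding weighted_shift_band calc_def by (subst band_mult[OF C]) (auto intro!: band_cong)
  then show ?thesis
    using alg_mult[OF cstar_generated_contains calc_continuous[OF cont]] by metis
qed

lemma shift_adj: "op_adj V (band S 1 (\<lambda>_. 1)) = band S (- 1) (\<lambda>_. 1)"
  by (subst band_adj[of S _ 1]) (auto intro!: band_cong simp: succ_closed)

text \<open>For \<open>d \<ge> 0\<close> this is a power of the shift after \<open>\<phi>\<close>,
  evaluated at the column \<open>k - d\<close>; for \<open>d < 0\<close> it is \<open>\<phi>\<close>
  after a power of the adjoint, evaluated at the row \<open>k\<close>. Either way the argument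
  belongs to the smaller index.\<close>

lemma band_in_alg:
  assumes \<phi>: "continuous_on {lo..hi} \<phi>"
  shows "band S d (\<lambda>k. \<phi> ((v (min k (k - d)))\<^sup>2)) \<in> alg"
proof -
  obtain C where C: "\<And>k. k \<in> S \<Longrightarrow> cmod (\<phi> ((v k)\<^sup>2)) \<le> C" using continuous_bounded_on_range[OF \<phi>] by blast
  have C0: "C \<ge> 0" using C[OF zero_mem] order_trans[OF norm_ge_zero] by blast
  have up: "band S (int n) (\<lambda>k. if k - int n \<in> S then \<phi> ((v (k - int n))\<^sup>2) else 0) \<in> alg" for n
  proof (induction n)
    case 0
    then show ?case using calc_continuous[OF \<phi>] unfolding calc_def
      by (rule back_subst[of "\<lambda>x. x \<in> alg"]) (auto intro!: band_cong)
  next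
    case (Suc n)
    have "op_mult V (band S 1 (\<lambda>_. 1)) (band S (int n) (\<lambda>k. if k - int n \<in> S then \<phi> ((v (k - int n))\<^sup>2) else 0)) =
        band S (int (Suc n)) (\<lambda>k. if k - int (Suc n) \<in> S then \<phi> ((v (k - int (Suc n)))\<^sup>2) else 0)"
      using C C0 upward_closed[of "_ - (1 + int n)" "_ - 1"]
      by (subst band_mult[of _ _ C]) (auto intro!: band_cong simp: algebra_simps)
    then show ?case using alg_mult[OF shift_in_alg Suc] by metis
  qed
  have down: "band S (- int n) (\<lambda>k. \<phi> ((v k)\<^sup>2)) \<in> alg" for n
  proof (induction n)
    case 0
    then show ?case using calc_continuous[OF \<phi>] by (simp add: calc_def)
  next
    case (Suc n)
    have index: "- int (Suc n) = - int n + - 1" by simp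
    have "op_mult V (band S (- int n) (\<lambda>k. \<phi> ((v k)\<^sup>2))) (band S (- 1) (\<lambda>_. 1)) =
        band S (- int (Suc n)) (\<lambda>k. \<phi> ((v k)\<^sup>2))"
      unfolding index
      by (subst band_mult[of _ _ 1], simp, rule band_cong) (simp add: succ_closed)
    then show ?case
      using alg_mult[OF Suc alg_adj[OF shift_in_alg]] unfolding shift_adj by metis
  qed
  show ?thesis
  proof (cases "d \<ge> 0")
    case True
    have "band S d (\<lambda>k. \<phi> ((v (min k (k - d)))\<^sup>2)) =
        band S (int (nat d)) (\<lambda>k. if k - int (nat d) \<in> S then \<phi> ((v (k - int (nat d)))\<^sup>2) else 0)"
      using True by (auto intro!: band_cong simp: min_def)
    then show ?thesis using up[of "nat d"] by metis
  next
    case False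
    have "band S d (\<lambda>k. \<phi> ((v (min k (k - d)))\<^sup>2)) = band S (- int (nat (- d))) (\<lambda>k. \<phi> ((v k)\<^sup>2))"
      using False by (auto intro!: band_cong simp: min_def)
    then show ?thesis using down[of "nat (- d)"] by metis
  qed
qed

section \<open>Finite sums of bands: the components of sections at a fixed parameter\<close>

definition qop :: "nat \<Rightarrow> (int \<Rightarrow> real \<Rightarrow> complex) \<Rightarrow> (int \<Rightarrow> complex) \<Rightarrow> int \<Rightarrow> complex" where
  "qop N c = (\<lambda>x\<in>vecs V. \<lambda>k. \<Sum>d\<in>{- int N..int N}. band S d (\<lambda>k. c d ((v (min k (k - d)))\<^sup>2)) x k)"

lemma op_sum_in_alg:
  "(\<And>i. i \<in> I \<Longrightarrow> A i \<in> alg) \<Longrightarrow> (\<lambda>x\<in>vecs V. \<lambda>k. \<Sum>i\<in>I. A i x k) \<in> alg"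
proof (induction I rule: infinite_finite_induct)
  case (insert i I)
  have "(\<lambda>x\<in>vecs V. \<lambda>k. \<Sum>i\<in>insert i I. A i x k) = op_add V (A i) (\<lambda>x\<in>vecs V. \<lambda>k. \<Sum>i\<in>I. A i x k)"
    using insert.hyps by (auto simp: op_add_def ell2_add intro!: restrict_ext)
  then show ?case using alg_add insert.IH insert.prems by (metis insertI1 insertI2)
qed (use alg_zero in \<open>simp_all add: op_zero_def ell2_zero\<close>)

lemma qop_in_alg: "(\<And>d. continuous_on {lo..hi} (c d)) \<Longrightarrow> qop N c \<in> alg"
  unfolding qop_def by (intro op_sum_in_alg band_in_alg)

lemma qop_cong: "(\<And>d. \<bar>d\<bar> \<le> int N \<Longrightarrow> c d = c' d) \<Longrightarrow> qop N c = qop N c'"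
  unfolding qop_def by (intro restrict_ext ext sum.cong refl) (simp add: abs_le_iff)

lemma qop_mono:
  assumes "N \<le> M" "\<And>d. int N < \<bar>d\<bar> \<Longrightarrow> c d = (\<lambda>_. 0)"
  shows "qop M c = qop N c"
  unfolding qop_def using assms
  by (intro restrict_ext ext sum.mono_neutral_right) (auto simp: band_apply)

lemma qop_apply:
  "x \<in> vecs V \<Longrightarrow> qop N c x k =
    (if k \<in> S then \<Sum>d\<in>{- int N..int N}. c d ((v (min k (k - d)))\<^sup>2) * x (k - d) else 0)"
  by (simp add: qop_def band_apply)

lemma qop_extensional: "qop N c \<in> extensional (vecs V)"
  by (simp add: qop_def)

lemma qop_add: "op_add V (qop N c) (qop N c') = qop N (\<lambda>d u. c d u + c' d u)"
  by (rule extensionalityI[OF _ qop_extensional])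
    (auto simp: op_add_def ell2_add qop_apply sum.distrib distrib_right)

lemma qop_scale: "op_scale V a (qop N c) = qop N (\<lambda>d u. a * c d u)"
  by (rule extensionalityI[OF _ qop_extensional])
    (auto simp: op_scale_def ell2_scale qop_apply sum_distrib_left mult.assoc)

lemma qop_zero: "qop 0 (\<lambda>_ _. 0) = op_zero V"
  unfolding qop_def op_zero_def by (intro restrict_ext ext) (simp add: band_apply ell2_zero)

lemma entry_qop:
  assumes supp: "\<And>d. int N < \<bar>d\<bar> \<Longrightarrow> c d = (\<lambda>_. 0)" and p: "p \<in> S \<times> S"
  shows "entry (qop N c) p = c (fst p - snd p) ((v (min (fst p) (snd p)))\<^sup>2)"
proof -
  obtain k j where kj: "p = (k, j)" "k \<in> S" "j \<in> S" using p by auto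
  have "entry (qop N c) p = (\<Sum>d\<in>{- int N..int N}. if k - j = d then c d ((v (min k j))\<^sup>2) else 0)"
    unfolding qop_def entry_def kj using kj(2,3)
    by (simp only: fst_conv snd_conv restrict_apply basis_vecs if_True band_basis)
      (intro sum.cong refl, auto)
  also have "\<dots> = c (k - j) ((v (min k j))\<^sup>2)" using supp[of "k - j"] by (auto simp: sum.delta)
  finally show ?thesis by (simp add: kj)
qed

text \<open>Only finitely many diagonals carry entries. Diagonal \<open>d\<close> is parametrized by
  the smaller index \<open>m\<close>, the larger one being \<open>m + |d|\<close>.\<close>

lemma qop_norm:
  assumes c: "\<And>d. continuous_on {lo..hi} (c d)" and supp: "\<And>d. int N < \<bar>d\<bar> \<Longrightarrow> c d = (\<lambda>_. 0)"
  shows "vnorm (quantum_pre S v) (qop N c) =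
    sqrt (\<Sum>d\<in>{- int N..int N}. \<Sum>\<^sub>\<infinity>m\<in>S. s m * s (m + \<bar>d\<bar>) * (cmod (c d ((v m)\<^sup>2)))\<^sup>2)"
proof -
  let ?f = "\<lambda>p. W p * (cmod (entry (qop N c) p))\<^sup>2"
  let ?L = "\<lambda>d. {p \<in> S \<times> S. fst p - snd p = d}"
  have bdd: "qop N c \<in> bounded_ops V" by (intro alg_bounded qop_in_alg c)
  have "infsum ?f (S \<times> S) = infsum ?f (\<Union>d\<in>{- int N..int N}. ?L d)"
  proof (rule infsum_cong_neutral)
    fix p assume "p \<in> S \<times> S - (\<Union>d\<in>{- int N..int N}. ?L d)"
    then have "p \<in> S \<times> S" "int N < \<bar>fst p - snd p\<bar>" by auto
    then show "?f p = 0" using supp by (simp add: entry_qop[OF supp])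
  qed auto
  also have "\<dots> = (\<Sum>d\<in>{- int N..int N}. infsum ?f (?L d))"
    by (rule sum_infsum[symmetric]) (auto intro: summable_on_subset_banach[OF entry_summable[OF bdd]])
  also have "\<dots> = (\<Sum>d\<in>{- int N..int N}. \<Sum>\<^sub>\<infinity>m\<in>S. s m * s (m + \<bar>d\<bar>) * (cmod (c d ((v m)\<^sup>2)))\<^sup>2)"
  proof (rule sum.cong[OF refl])
    fix d
    define h where "h m = (if d \<ge> 0 then (m + d, m) else (m, m - d))" for m :: int
    have "bij_betw h S (?L d)"
      by (rule bij_betw_byWitness[where f' = "\<lambda>p. min (fst p) (snd p)"])
        (auto simp: h_def succ_closed min_def, (use succ_closed[of _ "- d"] in force)+)
    then have "infsum ?f (?L d) = (\<Sum>\<^sub>\<infinity>m\<in>S. ?f (h m))"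
      by (rule infsum_reindex_bij_betw[symmetric])
    also have "\<dots> = (\<Sum>\<^sub>\<infinity>m\<in>S. s m * s (m + \<bar>d\<bar>) * (cmod (c d ((v m)\<^sup>2)))\<^sup>2)"
    proof (rule infsum_cong)
      fix m assume m: "m \<in> S"
      then have "h m \<in> S \<times> S" using succ_closed[of m d] succ_closed[of m "- d"] by (auto simp: h_def)
      then show "?f (h m) = s m * s (m + \<bar>d\<bar>) * (cmod (c d ((v m)\<^sup>2)))\<^sup>2"
        by (simp add: entry_qop[OF supp]) (auto simp: h_def W_def)
    qed
    finally show "infsum ?f (?L d) = (\<Sum>\<^sub>\<infinity>m\<in>S. s m * s (m + \<bar>d\<bar>) * (cmod (c d ((v m)\<^sup>2)))\<^sup>2)" .
  qed
  finally show ?thesis by (simp add: quantum_norm[OF bdd])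
qed

lemma E_mono: "i \<le> j \<Longrightarrow> E i \<le> E j"
  using sum_weight_diff[of "i + 1" j] sum_nonneg[of "{i + 1..j}" "weight_diff S v"] weight_diff_nonneg by simp

text \<open>A hat function around the squared weight at \<open>m\<close>, too narrow to reach any
  other squared weight.\<close>

lemma bump:
  assumes m: "m \<in> S"
  obtains \<phi> :: "real \<Rightarrow> complex"
    where "continuous_on UNIV \<phi>" "\<And>i. i \<in> S \<Longrightarrow> \<phi> ((v i)\<^sup>2) = (if i = m then 1 else 0)"
proof
  \<comment> \<open>The smaller gap to the two neighbouring squared weights. For
    \<open>S = {0..}\<close> and \<open>m = 0\<close> the left neighbour is the value 0 of
    \<open>E\<close>.\<close>
  define \<delta> where "\<delta> = min (E (m + 1) - E m) (E m - E (m - 1))"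
  have \<delta>: "\<delta> > 0" using E_strict[OF m] E_strict[OF succ_closed[OF m, of 1]] by (simp add: \<delta>_def)
  let ?\<phi> = "\<lambda>u. complex_of_real (max 0 (1 - \<bar>u - E m\<bar> / \<delta>))"
  show "continuous_on UNIV ?\<phi>" using \<delta> by (intro continuous_intros) auto
  fix i assume i: "i \<in> S"
  show "?\<phi> ((v i)\<^sup>2) = (if i = m then 1 else 0)"
  proof (cases "i = m")
    case False
    have "\<bar>E i - E m\<bar> \<ge> \<delta>"
      using E_mono[of "m + 1" i] E_mono[of i "m - 1"] False by (simp add: \<delta>_def) linarith
    then have "1 \<le> \<bar>E i - E m\<bar> / \<delta>" using \<delta> by simp
    then show ?thesis using False by (simp add: E_eq[OF i, symmetric])
  qed (use i in \<open>simp add: E_eq\<close>)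
qed

text \<open>Finitely many entries of \<open>a\<close> carry all of the weighted sum up to
  \<open>\<epsilon>^2\<close>, and bump functions reproduce them exactly. The approximation is in
  the trace norm, not in the operator norm.\<close>

lemma quantum_dense:
  assumes a: "a \<in> alg" and \<epsilon>: "\<epsilon> > 0"
  shows "\<exists>N c. (\<forall>d. continuous_on UNIV (c d)) \<and> (\<forall>d. int N < \<bar>d\<bar> \<longrightarrow> c d = (\<lambda>_. 0)) \<and>
    vdist (quantum_pre S v) (qop N c) a < \<epsilon>"
proof -
  let ?f = "\<lambda>p. W p * (cmod (entry a p))\<^sup>2"
  note summ = entry_summable[OF alg_bounded[OF a]]
  have "\<forall>\<^sub>F F in finite_subsets_at_top (S \<times> S). dist (sum ?f F) (infsum ?f (S \<times> S)) < \<epsilon>\<^sup>2"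
    using \<epsilon> by (intro tendstoD[OF infsum_tendsto[OF summ]]) simp
  then obtain F where F: "finite F" "F \<subseteq> S \<times> S" "dist (sum ?f F) (infsum ?f (S \<times> S)) < \<epsilon>\<^sup>2"
    unfolding eventually_finite_subsets_at_top by blast
  have "\<forall>m\<in>S. \<exists>\<phi>. continuous_on UNIV \<phi> \<and> (\<forall>i\<in>S. \<phi> ((v i)\<^sup>2) = (if i = m then 1 else 0 :: complex))"
    using bump by metis
  then obtain \<phi> where \<phi>: "\<And>m. m \<in> S \<Longrightarrow> continuous_on UNIV (\<phi> m)"
    "\<And>m i. m \<in> S \<Longrightarrow> i \<in> S \<Longrightarrow> \<phi> m ((v i)\<^sup>2) = (if i = m then 1 else 0 :: complex)" by metis
  \<comment> \<open>Each chosen entry on the diagonal \<open>d\<close> contributes a bump at its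
    smaller index.\<close>
  define c where "c d = (\<lambda>u. \<Sum>p\<in>{p \<in> F. fst p - snd p = d}. entry a p * \<phi> (min (fst p) (snd p)) u)" for d
  \<comment> \<open>The sum is a crude bound for every offset occurring in \<open>F\<close>, valid
    for empty \<open>F\<close> as well.\<close>
  define N where "N = nat (\<Sum>p\<in>F. \<bar>fst p - snd p\<bar>)"
  have minS: "min (fst p) (snd p) \<in> S" if "p \<in> F" for p
    using that F(2) by (auto simp: min_def)
  have cont: "continuous_on UNIV (c d)" for d
    unfolding c_def by (intro continuous_intros \<phi> minS) auto
  have supp: "c d = (\<lambda>_. 0)" if "int N < \<bar>d\<bar>" for d
  proof -
    have "\<bar>fst p - snd p\<bar> \<le> int N" if "p \<in> F" for p
      unfolding N_def using member_le_sum[OF that, of "\<lambda>p. \<bar>fst p - snd p\<bar>"] F(1) by (simp add: sum_nonneg)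
    then have "{p \<in> F. fst p - snd p = d} = {}" using that by force
    then show ?thesis unfolding c_def by (simp only: sum.empty)
  qed
  have q: "qop N c \<in> alg" using cont by (intro qop_in_alg) (auto intro: continuous_on_subset)
  have entry: "entry (qop N c) p = (if p \<in> F then entry a p else 0)" if p: "p \<in> S \<times> S" for p
  proof -
    have mp: "min (fst p) (snd p) \<in> S" using p by (auto simp: min_def)
    have "entry (qop N c) p = c (fst p - snd p) ((v (min (fst p) (snd p)))\<^sup>2)"
      by (rule entry_qop[OF supp p])
    also have "\<dots> = (\<Sum>r\<in>{r \<in> F. fst r - snd r = fst p - snd p}. if p = r then entry a r else 0)"
      unfolding c_def
    proof (rule sum.cong[OF refl])
      fix r assume r: "r \<in> {r \<in> F. fst r - snd r = fst p - snd p}"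
      \<comment> \<open>On a fixed diagonal the smaller index determines the pair, so that the bumps
        do not interfere.\<close>
      then have "min (fst p) (snd p) = min (fst r) (snd r) \<longleftrightarrow> p = r"
        by (cases p; cases r) (auto simp: min_def split: if_splits)
      then show "entry a r * \<phi> (min (fst r) (snd r)) ((v (min (fst p) (snd p)))\<^sup>2) = (if p = r then entry a r else 0)"
        using r \<phi>(2)[OF minS mp, of r] by auto
    qed
    also have "\<dots> = (if p \<in> F then entry a p else 0)" using F(1) by (auto simp: sum.delta)
    finally show ?thesis .
  qed
  define b where "b = op_add V (qop N c) (op_scale V (- 1) a)"
  have b: "b \<in> alg" unfolding b_def by (intro alg_add alg_scale q a)
  \<comment> \<open>The entries of \<open>b\<close> vanish on \<open>F\<close> and are those of
    \<open>a\<close> up to sign elsewhere.\<close>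
  have "(\<Sum>\<^sub>\<infinity>p\<in>S \<times> S. W p * (cmod (entry b p))\<^sup>2) = infsum ?f (S \<times> S - F)"
    by (intro infsum_cong_neutral) (auto simp: b_def entry_add entry_scale entry)
  also have "\<dots> = infsum ?f (S \<times> S) - sum ?f F"
    by (intro infsumI has_sum_Diff has_sum_infsum summ F) (use F in simp)
  also have "\<dots> < \<epsilon>\<^sup>2" using F(3) by (simp add: dist_real_def)
  finally have "sqrt (\<Sum>\<^sub>\<infinity>p\<in>S \<times> S. W p * (cmod (entry b p))\<^sup>2) < sqrt (\<epsilon>\<^sup>2)"
    by (rule real_sqrt_less_mono)
  then have "vnorm (quantum_pre S v) b < \<epsilon>" using \<epsilon> by (simp add: quantum_norm[OF alg_bounded[OF b]])
  then have "vdist (quantum_pre S v) (qop N c) a < \<epsilon>"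
    by (simp add: vdist_def vdiff_def quantum_add quantum_scale b_def)
  then show ?thesis using cont supp by blast
qed

section \<open>Powers of the shift and the operator form of sections\<close>

lemma shift_op_band: "shift_op S = band S 1 (\<lambda>_. 1)"
  unfolding shift_op_def band_def
proof (intro restrict_ext ext)
  fix x k assume "x \<in> vecs V"
  then show "x (k - 1) = (if k \<in> S then 1 * x (k - 1) else 0)"
    using succ_closed[of "k - 1" 1] ell2_outside[of x S "k - 1"] by auto
qed

lemma op_pow_shift: "op_pow V (band S 1 (\<lambda>_. 1)) n = band S (int n) (\<lambda>_. 1)"
proof (induction n)
  case 0
  have "band S 0 (\<lambda>_. 1) = (\<lambda>x\<in>vecs V. x)"
    unfolding band_def by (intro restrict_ext ext) (simp add: ell2_outside)
  then show ?case by simp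
next
  case (Suc n)
  then show ?case
    using upward_closed[of "_ - (1 + int n)" "_ - 1"]
    by simp (subst band_mult[of _ _ 1], auto intro!: band_cong simp: algebra_simps)
qed

lemma op_pow_shift_adj: "op_pow V (band S (- 1) (\<lambda>_. 1)) n = band S (- int n) (\<lambda>_. 1)"
proof (induction n)
  case 0
  then show ?case using op_pow_shift[of 0] by simp
next
  case (Suc n)
  then show ?case
    by simp (subst band_mult[of _ _ 1], auto intro!: band_cong simp: algebra_simps succ_closed)
qed

text \<open>In the first sum the right factor of each product is a diagonal operator, whose bound
  comes from continuity of \<open>f n\<close>; in the second it is a power of the adjoint shift,
  with bound 1.\<close>

lemma quantum_poly_eq:
  assumes f: "\<And>n. n \<le> N \<Longrightarrow> continuous_on {lo..hi} (f n)"
  shows "quantum_poly S v N f g = qop N (\<lambda>d. if d \<ge> 0 then f (nat d) else g (nat (- d)))"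
proof -
  let ?c = "\<lambda>d. if d \<ge> 0 then f (nat d) else g (nat (- d))"
  let ?B = "\<lambda>d x k. band S d (\<lambda>k. ?c d ((v (min k (k - d)))\<^sup>2)) x k"
  have up: "op_mult V (op_pow V (shift_op S) n) (diag_op S (\<lambda>j. f n ((v j)\<^sup>2))) x k = ?B (int n) x k"
    if n: "n \<le> N" for n x k
  proof -
    obtain C where C: "\<And>k. k \<in> S \<Longrightarrow> cmod (f n ((v k)\<^sup>2)) \<le> C"
      using continuous_bounded_on_range[OF f[OF n]] by blast
    have "op_mult V (op_pow V (shift_op S) n) (diag_op S (\<lambda>j. f n ((v j)\<^sup>2))) =
        band S (int n) (\<lambda>k. ?c (int n) ((v (min k (k - int n)))\<^sup>2))"
      unfolding shift_op_band op_pow_shift diag_op_band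
      by (subst band_mult[OF C]) (auto intro!: band_cong simp: min_def)
    then show ?thesis by simp
  qed
  have down: "op_mult V (diag_op S (\<lambda>j. g n ((v j)\<^sup>2))) (op_pow V (op_adj V (shift_op S)) n) x k = ?B (- int n) x k"
    if "n \<ge> 1" for n x k
  proof -
    have "op_mult V (diag_op S (\<lambda>j. g n ((v j)\<^sup>2))) (op_pow V (op_adj V (shift_op S)) n) =
        band S (- int n) (\<lambda>k. ?c (- int n) ((v (min k (k - - int n)))\<^sup>2))"
      unfolding shift_op_band shift_adj op_pow_shift_adj diag_op_band using that
      by (subst band_mult[of _ _ 1]) (auto intro!: band_cong simp: min_def)
    then show ?thesis by simp
  qed
  show ?thesis
    unfolding quantum_poly_def Let_def qop_def sum_int_split
    by (intro restrict_ext ext arg_cong2[where f = "(+)"] sum.cong refl up down) auto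
qed

end

section \<open>Riemann sums of the weights\<close>

text \<open>Symmetric intervals are cofinal among the finite sets of integers. Unordered sums thus
  become limits of sums over intervals, which telescope.\<close>

lemma filterlim_int_intervals:
  "filterlim (\<lambda>K. {- int K..int K}) (finite_subsets_at_top UNIV) sequentially"
  unfolding filterlim_finite_subsets_at_top
proof (intro allI impI)
  fix X :: "int set" assume X: "finite X \<and> X \<subseteq> UNIV"
  have "X \<subseteq> {- int K..int K}" if K: "nat (\<Sum>x\<in>X. \<bar>x\<bar>) \<le> K" for K
  proof
    fix x assume "x \<in> X"
    then have "\<bar>x\<bar> \<le> (\<Sum>x\<in>X. \<bar>x\<bar>)" using X member_le_sum[of x X abs] by simp
    then show "x \<in> {- int K..int K}" using K by (auto simp: abs_le_iff)
  qed
  then show "\<forall>\<^sub>F K in sequentially. finite {- int K..int K} \<and> X \<subseteq> {- int K..int K} \<and> {- int K..int K} \<subseteq> UNIV"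
    unfolding eventually_sequentially by (intro exI[of _ "nat (\<Sum>x\<in>X. \<bar>x\<bar>)"]) auto
qed

lemma sum_int_intervals_tendsto:
  fixes f :: "int \<Rightarrow> 'a::{comm_monoid_add, t2_space}"
  assumes "f summable_on UNIV"
  shows "(\<lambda>K. \<Sum>k\<in>{- int K..int K}. f k) \<longlonglongrightarrow> infsum f UNIV"
  using filterlim_compose[OF infsum_tendsto[OF assms] filterlim_int_intervals] by simp

lemma filterlim_int_add: "filterlim (\<lambda>K. int K + n) at_top sequentially"
  unfolding filterlim_at_top eventually_sequentially
proof
  fix Z show "\<exists>N. \<forall>K\<ge>N. Z \<le> int K + n" by (intro exI[of _ "nat (Z - n)"]) auto
qed

lemma filterlim_int_diff: "filterlim (\<lambda>K. n - int K) at_bot sequentially"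
  unfolding filterlim_at_bot eventually_sequentially
proof
  fix Z show "\<exists>N. \<forall>K\<ge>N. n - int K \<le> Z" by (intro exI[of _ "nat (n - Z)"]) auto
qed

locale weight_family =
  fixes S :: "int set" and w :: "real \<Rightarrow> int \<Rightarrow> real" and wm wp :: real
  assumes index: "S = {0..} \<or> S = UNIV"
    and cond1: "condition1 S w wm wp"
    and cond2: "condition2 S w wm wp"
    and cond3: "condition3 S w"
    and cond4: "condition4 S w"
begin

text \<open>In the disk case the positive lower bound of the squared weights is the first of them.
  It varies with \<open>t\<close>, in contrast to the interval \<open>J\<close> on which
  coefficients live.\<close>

definition lo :: "real \<Rightarrow> real" where
  "lo t = (if S = UNIV then wm\<^sup>2 else (w t 0)\<^sup>2)"

abbreviation J :: "real set" where "J \<equiv> {wm\<^sup>2..wp\<^sup>2}"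

lemma wp_pos: "wp > 0" and wm_nonneg: "wm \<ge> 0" and wm_pos: "S = UNIV \<Longrightarrow> wm > 0"
  and wm_zero: "S \<noteq> UNIV \<Longrightarrow> wm = 0"
  using cond1 by (auto simp: condition1_def split: if_splits)

section \<open>Tails and Riemann sums at a fixed parameter\<close>

context
  fixes t :: real
  assumes t: "t \<in> {0<..<1}"
begin

lemma w_pos: "k \<in> S \<Longrightarrow> w t k > 0"
  and w_strict: "strict_mono_on S (w t)"
  and w_top: "(w t \<longlongrightarrow> wp) at_top"
  and w_bot: "S = UNIV \<Longrightarrow> (w t \<longlongrightarrow> wm) at_bot"
  using cond1 t by (auto simp: condition1_def)

lemma S_upward: "i \<in> S \<Longrightarrow> i \<le> k \<Longrightarrow> k \<in> S"
  using index by auto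

lemma w_mono: "i \<in> S \<Longrightarrow> i < k \<Longrightarrow> w t i < w t k"
  using w_strict S_upward[of i k] by (auto simp: strict_mono_on_def)

lemma w_less_wp:
  assumes "k \<in> S" shows "w t k < wp"
proof -
  have "w t (k + 1) \<le> wp"
    using w_top
  proof (rule tendsto_lowerbound)
    show "\<forall>\<^sub>F j in at_top. w t (k + 1) \<le> w t j"
      unfolding eventually_at_top_linorder
      using w_mono[of "k + 1"] S_upward[OF assms, of "k + 1"]
      by (intro exI[of _ "k + 1"]) (auto simp: order_le_less)
  qed simp
  then show ?thesis using w_mono[OF assms, of "k + 1"] by simp
qed

lemma wm_less_w:
  assumes "k \<in> S" shows "wm < w t k"
proof (cases "S = UNIV")
  case True
  have "wm \<le> w t (k - 1)"
    using w_bot[OF True]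
  proof (rule tendsto_upperbound)
    show "\<forall>\<^sub>F j in at_bot. w t j \<le> w t (k - 1)"
      unfolding eventually_at_bot_linorder
      using w_mono True by (intro exI[of _ "k - 1"]) (auto simp: order_le_less)
  qed simp
  then show ?thesis using w_mono[of "k - 1" k] True by simp
next
  case False
  then show ?thesis using w_pos[OF assms] wm_zero by simp
qed

lemma weight_w: "weight S (w t) (lo t) (wp\<^sup>2)"
proof
  have 0: "0 \<in> S" using index by auto
  show "0 < lo t" using w_pos[OF 0] wm_pos by (auto simp: lo_def)
  fix k assume k: "k \<in> S"
  have "(w t k)\<^sup>2 \<le> wp\<^sup>2" using w_less_wp[OF k] w_pos[OF k] by (intro power_mono) auto
  moreover have "lo t \<le> (w t k)\<^sup>2"
  proof (cases "S = UNIV")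
    case True
    then show ?thesis unfolding lo_def using wm_less_w[OF k] wm_nonneg by (simp add: power_mono)
  next
    case False
    then have "0 \<le> k" using index k by auto
    then have "w t 0 \<le> w t k" using w_mono[OF 0, of k] by (cases "k = 0") auto
    then show ?thesis using False w_pos[OF 0] by (auto simp: lo_def intro!: power_mono)
  qed
  ultimately show "(w t k)\<^sup>2 \<in> {lo t..wp\<^sup>2}" by simp
qed (use index w_strict w_pos in auto)

interpretation weight S "w t" "lo t" "wp\<^sup>2" by (rule weight_w)

lemma lo_J: "{lo t..wp\<^sup>2} \<subseteq> J"
  using wm_less_w[OF zero_mem] wm_nonneg by (auto simp: lo_def intro: order_trans power_mono)

text \<open>Below the index set \<open>E\<close> is 0, which in the disk case is the left end
  \<open>wm^2\<close> of \<open>J\<close>.\<close>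

lemma E_J: "E k \<in> J"
proof (cases "k \<in> S")
  case True
  then show ?thesis using range[of k] lo_J by (auto simp: E_eq)
next
  case False
  then show ?thesis using wm_zero by (auto simp: E_def weight_ext_def)
qed

lemma E_top: "(E \<longlongrightarrow> wp\<^sup>2) at_top"
proof (rule Lim_transform_eventually)
  show "((\<lambda>k. (w t k)\<^sup>2) \<longlongrightarrow> wp\<^sup>2) at_top" by (intro tendsto_intros w_top)
  show "\<forall>\<^sub>F k in at_top. (w t k)\<^sup>2 = E k"
    unfolding eventually_at_top_linorder
    using S_upward[OF zero_mem] by (intro exI[of _ 0]) (simp add: E_eq)
qed

lemma E_bot: "(E \<longlongrightarrow> wm\<^sup>2) at_bot"
proof (cases "S = UNIV")
  case True
  then have "E k = (w t k)\<^sup>2" for k by (intro E_eq) simp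
  then have "E = (\<lambda>k. (w t k)\<^sup>2)" by blast
  moreover have "((\<lambda>k. (w t k)\<^sup>2) \<longlongrightarrow> wm\<^sup>2) at_bot" by (intro tendsto_intros w_bot True)
  ultimately show ?thesis by simp
next
  case False
  have "\<forall>\<^sub>F k in at_bot. wm\<^sup>2 = E k"
    unfolding eventually_at_bot_linorder E_def weight_ext_def
    using False index wm_zero by (intro exI[of _ "- 1"]) auto
  then show ?thesis by (rule Lim_transform_eventually[OF tendsto_const])
qed

abbreviation Sd :: "int \<Rightarrow> real" where "Sd \<equiv> weight_diff S (w t)"

lemma E_seq_top: "(\<lambda>K. E (int K + n)) \<longlonglongrightarrow> wp\<^sup>2"
  by (rule filterlim_compose[OF E_top filterlim_int_add])

lemma E_seq_bot: "(\<lambda>K. E (n - int K)) \<longlonglongrightarrow> wm\<^sup>2"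
  by (rule filterlim_compose[OF E_bot filterlim_int_diff])

lemma E_seq_bot': "(\<lambda>K. E (- int K - 1)) \<longlonglongrightarrow> wm\<^sup>2"
proof -
  have "- 1 - int K = - int K - 1" for K by simp
  then show ?thesis using E_seq_bot[of "- 1"] by (simp only:)
qed

text \<open>Telescoping leaves the two limits of \<open>E\<close>. The total mass is the length of
  \<open>J\<close> and the same for all \<open>t\<close>.\<close>

lemma Sd_has_sum: "(Sd has_sum (wp\<^sup>2 - wm\<^sup>2)) UNIV"
proof -
  have "(\<lambda>K. \<Sum>k\<in>{- int K..int K}. Sd k) \<longlonglongrightarrow> infsum Sd UNIV"
    by (rule sum_int_intervals_tendsto[OF weight_diff_summable])
  moreover have "(\<lambda>K. \<Sum>k\<in>{- int K..int K}. Sd k) = (\<lambda>K. E (int K + 0) - E (- int K - 1))"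
    by (subst sum_weight_diff) (auto simp: algebra_simps)
  moreover have "(\<lambda>K. E (int K + 0) - E (- int K - 1)) \<longlonglongrightarrow> wp\<^sup>2 - wm\<^sup>2"
    by (intro tendsto_diff E_seq_top E_seq_bot')
  ultimately have "infsum Sd UNIV = wp\<^sup>2 - wm\<^sup>2" by (metis LIMSEQ_unique)
  then show ?thesis using has_sum_infsum[OF weight_diff_summable, of UNIV] by simp
qed

lemma Sd_shift_has_sum: "((\<lambda>k. Sd (k + n)) has_sum (wp\<^sup>2 - wm\<^sup>2)) UNIV"
proof -
  have "bij_betw (\<lambda>k. k + n) UNIV UNIV" by (rule bij_betw_byWitness[where f' = "\<lambda>k. k - n"]) auto
  from has_sum_reindex_bij_betw[OF this, of Sd "wp\<^sup>2 - wm\<^sup>2"] show ?thesis using Sd_has_sum by simp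
qed

lemma pair_bound: "\<bar>s m * s (m + n) * y\<bar> \<le> (Sd m + Sd (m + n)) / 2 * \<bar>y\<bar>"
  using mult_right_mono[OF s_mult_le[of m "m + n"], of "\<bar>y\<bar>"] by (simp add: abs_mult s_nonneg)

lemma pair_summable:
  assumes "\<And>m. \<bar>y m\<bar> \<le> B"
  shows "(\<lambda>m. s m * s (m + n) * y m) summable_on A"
proof (rule summable_on_subset_banach[OF _ subset_UNIV])
  show "(\<lambda>m. s m * s (m + n) * y m) summable_on UNIV"
  proof (rule abs_summable_summable, rule Infinite_Sum.abs_summable_on_comparison_test')
    show "(\<lambda>m. (Sd m + Sd (m + n)) * (B / 2)) summable_on UNIV"
      using has_sum_imp_summable[OF Sd_shift_has_sum] weight_diff_summable
      by (intro summable_on_cmult_left summable_on_add)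
    show "norm (s m * s (m + n) * y m) \<le> (Sd m + Sd (m + n)) * (B / 2)" for m
      using pair_bound[of m n "y m"]
        mult_left_mono[OF assms[of m], of "(Sd m + Sd (m + n)) / 2"] weight_diff_nonneg[of m] weight_diff_nonneg[of "m + n"]
      by simp
  qed
qed

text \<open>The pair weight is at most the mean of two differences with telescoping tails, so the
  error is governed by \<open>E\<close> near the two ends of the integers, where condition 2 is
  uniform in \<open>t\<close>.\<close>

lemma pair_tail:
  assumes y: "\<And>m. \<bar>y m\<bar> \<le> B" and n: "0 \<le> n"
  shows "\<bar>(\<Sum>\<^sub>\<infinity>m. s m * s (m + n) * y m) - (\<Sum>m\<in>{- int K..int K}. s m * s (m + n) * y m)\<bar> \<le>
    ((wp\<^sup>2 - E (int K)) + (E (n - 1 - int K) - wm\<^sup>2)) * B"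
proof -
  let ?f = "\<lambda>m. s m * s (m + n) * y m" and ?K = "{- int K..int K}"
  have B: "B \<ge> 0" using y[of 0] by linarith
  have "(?f has_sum (infsum ?f UNIV - sum ?f ?K)) (UNIV - ?K)"
    by (rule has_sum_Diff) (auto intro!: has_sum_infsum pair_summable y)
  moreover have "((\<lambda>m. (Sd m + Sd (m + n)) * (B / 2)) has_sum
      (((wp\<^sup>2 - wm\<^sup>2) - sum Sd ?K) + ((wp\<^sup>2 - wm\<^sup>2) - (\<Sum>m\<in>?K. Sd (m + n)))) * (B / 2)) (UNIV - ?K)"
    by (intro has_sum_cmult_left has_sum_add has_sum_Diff Sd_has_sum Sd_shift_has_sum) auto
  ultimately have "norm (infsum ?f UNIV - sum ?f ?K) \<le>
      (((wp\<^sup>2 - wm\<^sup>2) - sum Sd ?K) + ((wp\<^sup>2 - wm\<^sup>2) - (\<Sum>m\<in>?K. Sd (m + n)))) * (B / 2)"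
  proof (rule norm_infsum_le)
    show "norm (?f m) \<le> (Sd m + Sd (m + n)) * (B / 2)" for m
      using pair_bound[of m n "y m"]
        mult_left_mono[OF y[of m], of "(Sd m + Sd (m + n)) / 2"] weight_diff_nonneg[of m] weight_diff_nonneg[of "m + n"]
      by simp
  qed
  also have "sum Sd ?K = E (int K) - E (- int K - 1)"
    by (subst sum_weight_diff) (auto simp: algebra_simps)
  also have "(\<Sum>m\<in>?K. Sd (m + n)) = sum Sd ((\<lambda>m. m + n) ` ?K)"
    by (subst sum.reindex) auto
  also have "(\<lambda>m. m + n) ` ?K = {- int K + n..int K + n}" by (simp add: image_add_atLeastAtMost')
  also have "sum Sd \<dots> = E (int K + n) - E (n - 1 - int K)"
    by (subst sum_weight_diff) (auto simp: algebra_simps)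
  \<comment> \<open>\<open>E\<close> increases and \<open>0 \<le> n\<close>: the unshifted sum has
    the worse upper end, the shifted sum the worse lower end \<open>n - 1 - K\<close>, and these two
    are kept.\<close>
  also have "(wp\<^sup>2 - wm\<^sup>2 - (E (int K) - E (- int K - 1)) + (wp\<^sup>2 - wm\<^sup>2 - (E (int K + n) - E (n - 1 - int K)))) * (B / 2)
      \<le> (2 * ((wp\<^sup>2 - E (int K)) + (E (n - 1 - int K) - wm\<^sup>2))) * (B / 2)"
    using E_mono[of "int K" "int K + n"] E_mono[of "- int K - 1" "n - 1 - int K"] n B
    by (intro mult_right_mono) auto
  also have "\<dots> = ((wp\<^sup>2 - E (int K)) + (E (n - 1 - int K) - wm\<^sup>2)) * B" by simp
  finally show ?thesis by simp
qed

text \<open>The cells \<open>{E (k - 1)..E k}\<close> have length \<open>Sd k\<close>, with tag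
  \<open>E k\<close>, and tile \<open>J\<close> except for two end pieces that vanish in the limit.
  In the disk case the cells with negative index are points.\<close>

lemma Riemann_sum_error:
  assumes \<phi>: "continuous_on J \<phi>" and B: "\<And>u. u \<in> J \<Longrightarrow> \<bar>\<phi> u\<bar> \<le> B"
    and mesh: "\<And>k. Sd k \<le> \<delta>"
    and osc: "\<And>x y. x \<in> J \<Longrightarrow> y \<in> J \<Longrightarrow> \<bar>x - y\<bar> \<le> \<delta> \<Longrightarrow> \<bar>\<phi> x - \<phi> y\<bar> \<le> \<eta>"
  shows "\<bar>(\<Sum>\<^sub>\<infinity>m. Sd m * \<phi> (E m)) - integral J \<phi>\<bar> \<le> \<eta> * (wp\<^sup>2 - wm\<^sup>2)"
proof -
  have sub: "{E i..E j} \<subseteq> J" for i j using E_J[of i] E_J[of j] by auto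
  have int: "\<phi> integrable_on {a..b}" if "{a..b} \<subseteq> J" for a b
    using continuous_on_subset[OF \<phi> that] by (rule integrable_continuous_real)
  have cell: "\<bar>Sd k * \<phi> (E k) - integral {E (k - 1)..E k} \<phi>\<bar> \<le> \<eta> * Sd k" for k
  proof -
    have le: "E (k - 1) \<le> E k" by (rule E_mono) simp
    have "Sd k * \<phi> (E k) - integral {E (k - 1)..E k} \<phi> = integral {E (k - 1)..E k} (\<lambda>u. \<phi> (E k) - \<phi> u)"
      using le by (subst integral_diff) (auto intro: int[OF sub] simp: weight_diff_eq)
    also have "norm \<dots> \<le> \<eta> * (E k - E (k - 1))"
    proof (rule integral_bound[OF le])
      show "continuous_on {E (k - 1)..E k} (\<lambda>u. \<phi> (E k) - \<phi> u)"
        by (intro continuous_intros continuous_on_subset[OF \<phi> sub])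
      fix u assume u: "u \<in> {E (k - 1)..E k}"
      then have "u \<in> J" using sub by blast
      moreover have "\<bar>E k - u\<bar> \<le> \<delta>" using u mesh[of k] by (auto simp: weight_diff_eq)
      ultimately show "norm (\<phi> (E k) - \<phi> u) \<le> \<eta>" using osc[OF E_J] by simp
    qed
    finally show ?thesis by (simp add: weight_diff_eq)
  qed
  have chain: "(\<Sum>k\<in>{a..b}. integral {E (k - 1)..E k} \<phi>) = integral {E (a - 1)..E b} \<phi>" if "a - 1 \<le> b" for a b
    using that
  proof (induction b rule: int_ge_induct)
    case (step i)
    have "{a..i + 1} = insert (i + 1) {a..i}" using step by auto
    then have "(\<Sum>k\<in>{a..i + 1}. integral {E (k - 1)..E k} \<phi>) =
        integral {E (a - 1)..E i} \<phi> + integral {E i..E (i + 1)} \<phi>"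
      using step by simp
    also have "\<dots> = integral {E (a - 1)..E (i + 1)} \<phi>"
      using step.hyps by (intro Henstock_Kurzweil_Integration.integral_combine E_mono int sub) auto
    finally show ?case .
  qed simp
  have partial: "\<bar>(\<Sum>k\<in>{- int K..int K}. Sd k * \<phi> (E k)) - integral J \<phi>\<bar> \<le>
      \<eta> * (E (int K + 0) - E (- int K - 1)) + B * ((wp\<^sup>2 - E (int K + 0)) + (E (- int K - 1) - wm\<^sup>2))" for K
  proof -
    let ?a = "E (- int K - 1)" and ?b = "E (int K + 0)"
    have ab: "wm\<^sup>2 \<le> ?a" "?a \<le> ?b" "?b \<le> wp\<^sup>2"
      using E_J[of "- int K - 1"] E_J[of "int K + 0"] E_mono[of "- int K - 1" "int K + 0"] by auto
    have J: "integral J \<phi> = integral {wm\<^sup>2..?a} \<phi> + (integral {?a..?b} \<phi> + integral {?b..wp\<^sup>2} \<phi>)"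
      using ab by (simp add: Henstock_Kurzweil_Integration.integral_combine int)
    have edge: "\<bar>integral {x..y} \<phi>\<bar> \<le> B * (y - x)" if "x \<le> y" "{x..y} \<subseteq> J" for x y
      using integral_bound[OF that(1) continuous_on_subset[OF \<phi> that(2)], of B] B that(2) by auto
    have "(\<Sum>k\<in>{- int K..int K}. Sd k * \<phi> (E k)) - integral {?a..?b} \<phi> =
        (\<Sum>k\<in>{- int K..int K}. Sd k * \<phi> (E k) - integral {E (k - 1)..E k} \<phi>)"
      using chain[of "- int K" "int K"] by (simp add: sum_subtractf algebra_simps)
    also have "\<bar>\<dots>\<bar> \<le> (\<Sum>k\<in>{- int K..int K}. \<eta> * Sd k)"
      by (rule order_trans[OF sum_abs sum_mono[OF cell]])
    also have "\<dots> = \<eta> * (?b - ?a)"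
      unfolding sum_distrib_left[symmetric] by (subst sum_weight_diff) (auto simp: algebra_simps)
    finally show ?thesis
      unfolding J using edge[of "wm\<^sup>2" ?a] edge[of ?b "wp\<^sup>2"] ab by (simp add: algebra_simps)
  qed
  have "(\<lambda>m. Sd m * \<phi> (E m)) summable_on UNIV"
    using pair_summable[of "\<lambda>m. \<phi> (E m)" B 0 UNIV] B[OF E_J] by (simp add: s_square)
  then have "(\<lambda>K. \<bar>(\<Sum>k\<in>{- int K..int K}. Sd k * \<phi> (E k)) - integral J \<phi>\<bar>) \<longlonglongrightarrow>
      \<bar>(\<Sum>\<^sub>\<infinity>m. Sd m * \<phi> (E m)) - integral J \<phi>\<bar>"
    by (intro tendsto_intros sum_int_intervals_tendsto)
  moreover have "(\<lambda>K. \<eta> * (E (int K + 0) - E (- int K - 1)) + B * ((wp\<^sup>2 - E (int K + 0)) + (E (- int K - 1) - wm\<^sup>2)))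
      \<longlonglongrightarrow> \<eta> * (wp\<^sup>2 - wm\<^sup>2) + B * ((wp\<^sup>2 - wp\<^sup>2) + (wm\<^sup>2 - wm\<^sup>2))"
    by (intro tendsto_intros E_seq_top E_seq_bot')
  ultimately have "\<bar>(\<Sum>\<^sub>\<infinity>m. Sd m * \<phi> (E m)) - integral J \<phi>\<bar> \<le> \<eta> * (wp\<^sup>2 - wm\<^sup>2) + B * ((wp\<^sup>2 - wp\<^sup>2) + (wm\<^sup>2 - wm\<^sup>2))"
    by (rule LIMSEQ_le) (use partial in blast)
  then show ?thesis by simp
qed

text \<open>Each step changes the difference by at most the factor \<open>1 + h\<close>. The
  increments are bounded by \<open>h * (1 + h)^i * Sd m\<close>, and their geometric sum is the
  stated bound.\<close>

lemma Sd_ratio: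
  assumes h: "\<And>k. k \<in> S \<Longrightarrow> \<bar>1 - Sd (k + 1) / Sd k\<bar> \<le> h" and m: "m \<in> S"
  shows "\<bar>Sd (m + int n) - Sd m\<bar> \<le> ((1 + h) ^ n - 1) * Sd m"
proof (induction n)
  case (Suc n)
  have h0: "0 \<le> h" using h[OF m] by linarith
  have mn: "m + int n \<in> S" using m S_upward by simp
  have "\<bar>1 - Sd (m + int n + 1) / Sd (m + int n)\<bar> * Sd (m + int n) \<le> h * Sd (m + int n)"
    by (intro mult_right_mono h mn weight_diff_nonneg)
  moreover have "\<bar>1 - Sd (m + int n + 1) / Sd (m + int n)\<bar> * Sd (m + int n) = \<bar>Sd (m + int n) - Sd (m + int n + 1)\<bar>"
    using weight_diff_pos[OF mn] by (simp add: field_simps abs_mult_pos[symmetric])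
  ultimately have "\<bar>Sd (m + int n + 1) - Sd (m + int n)\<bar> \<le> h * Sd (m + int n)" by (simp add: abs_minus_commute)
  also have "\<dots> \<le> h * ((1 + h) ^ n * Sd m)"
    using Suc h0 by (intro mult_left_mono) (auto simp: algebra_simps)
  finally have "\<bar>Sd (m + int n + 1) - Sd (m + int n)\<bar> \<le> h * ((1 + h) ^ n * Sd m)" .
  then show ?case using Suc by (simp add: algebra_simps)
qed simp

text \<open>A termwise comparison with \<open>Sd\<close>, whose total mass does not depend on
  \<open>t\<close>; for fixed \<open>n\<close> the bound tends to 0 with \<open>h\<close>.\<close>

lemma pair_diag_diff:
  assumes h: "\<And>k. k \<in> S \<Longrightarrow> \<bar>1 - Sd (k + 1) / Sd k\<bar> \<le> h" and y: "\<And>m. \<bar>y m\<bar> \<le> B"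
  shows "\<bar>(\<Sum>\<^sub>\<infinity>m. s m * s (m + int n) * y m) - (\<Sum>\<^sub>\<infinity>m. Sd m * y m)\<bar> \<le> ((1 + h) ^ n - 1) * B * (wp\<^sup>2 - wm\<^sup>2)"
proof -
  have h0: "0 \<le> h" using h[OF zero_mem] by linarith
  have c: "0 \<le> (1 + h) ^ n - 1" using h0 by simp
  have summ: "(\<lambda>m. s m * s (m + int n) * y m) summable_on UNIV" "(\<lambda>m. Sd m * y m) summable_on UNIV"
    using pair_summable[of y B _ UNIV, OF y] pair_summable[of y B 0 UNIV, OF y] by (simp_all add: s_square)
  have "((\<lambda>m. s m * s (m + int n) * y m - Sd m * y m) has_sum
      ((\<Sum>\<^sub>\<infinity>m. s m * s (m + int n) * y m) - (\<Sum>\<^sub>\<infinity>m. Sd m * y m))) UNIV"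
    using has_sum_add[OF has_sum_infsum[OF summ(1)] has_sum_uminusI[OF has_sum_infsum[OF summ(2)]]]
    by simp
  moreover have "((\<lambda>m. ((1 + h) ^ n - 1) * B * Sd m) has_sum ((1 + h) ^ n - 1) * B * (wp\<^sup>2 - wm\<^sup>2)) UNIV"
    by (intro has_sum_cmult_right Sd_has_sum)
  ultimately have "norm ((\<Sum>\<^sub>\<infinity>m. s m * s (m + int n) * y m) - (\<Sum>\<^sub>\<infinity>m. Sd m * y m)) \<le> ((1 + h) ^ n - 1) * B * (wp\<^sup>2 - wm\<^sup>2)"
  proof (rule norm_infsum_le)
    fix m
    have diff: "\<bar>s m * s (m + int n) - Sd m\<bar> \<le> ((1 + h) ^ n - 1) * Sd m"
    proof (cases "m \<in> S")
      case True
      have "\<bar>s m * s (m + int n) - Sd m\<bar> = s m * \<bar>s (m + int n) - s m\<bar>"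
        using s_nonneg[of m] by (simp add: s_square[symmetric] right_diff_distrib[symmetric] abs_mult)
      \<comment> \<open>Enlarging the first factor produces a difference of squares, so that no
        square root of a ratio has to be estimated.\<close>
      also have "\<dots> \<le> (s m + s (m + int n)) * \<bar>s (m + int n) - s m\<bar>"
        by (intro mult_right_mono) (auto simp: s_nonneg)
      also have "\<dots> = \<bar>(s m + s (m + int n)) * (s (m + int n) - s m)\<bar>"
        by (simp add: abs_mult s_nonneg)
      also have "(s m + s (m + int n)) * (s (m + int n) - s m) = Sd (m + int n) - Sd m"
        by (simp add: s_square[symmetric] algebra_simps)
      also have "\<bar>\<dots>\<bar> \<le> ((1 + h) ^ n - 1) * Sd m" by (rule Sd_ratio[OF h True])
      finally show ?thesis .
    next
      case False
      then show ?thesis by (simp add: s_def weight_diff_outside)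
    qed
    have "norm (s m * s (m + int n) * y m - Sd m * y m) = \<bar>s m * s (m + int n) - Sd m\<bar> * \<bar>y m\<bar>"
      by (simp add: left_diff_distrib[symmetric] abs_mult)
    also have "\<dots> \<le> (((1 + h) ^ n - 1) * Sd m) * B"
      using diff y c weight_diff_nonneg by (intro mult_mono) auto
    finally show "norm (s m * s (m + int n) * y m - Sd m * y m) \<le> ((1 + h) ^ n - 1) * B * Sd m"
      by (simp add: mult_ac)
  qed
  then show ?thesis by simp
qed

end

section \<open>The contribution of one diagonal to the squared norm, as a function of
  \<open>t\<close>\<close>

definition G :: "int \<Rightarrow> (real \<Rightarrow> real) \<Rightarrow> real \<Rightarrow> real" where
  "G n \<phi> t = (\<Sum>\<^sub>\<infinity>m\<in>S. weight.s S (w t) m * weight.s S (w t) (m + n) * \<phi> ((w t m)\<^sup>2))"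

text \<open>Since \<open>s\<close> vanishes outside \<open>S\<close>, the sum may run over all
  integers, where the estimates above hold without boundary terms.\<close>

lemma G_eq:
  assumes t: "t \<in> {0<..<1}"
  shows "G n \<phi> t = (\<Sum>\<^sub>\<infinity>m. weight.s S (w t) m * weight.s S (w t) (m + n) * \<phi> (weight.E S (w t) m))"
proof -
  interpret weight S "w t" "lo t" "wp\<^sup>2" by (rule weight_w[OF t])
  show ?thesis
    unfolding G_def by (intro infsum_cong_neutral) (auto simp: E_eq s_def weight_diff_outside)
qed

lemma continuous_bounded_J:
  fixes \<phi> :: "real \<Rightarrow> real"
  assumes "continuous_on J \<phi>"
  obtains B where "\<And>u. u \<in> J \<Longrightarrow> \<bar>\<phi> u\<bar> \<le> B"
proof -
  have "bounded (\<phi> ` J)"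
    using assms by (intro compact_imp_bounded compact_continuous_image) auto
  then obtain C where "\<forall>u\<in>J. \<bar>\<phi> u\<bar> \<le> C" by (auto simp: bounded_iff)
  then show thesis using that by blast
qed

lemma E_uniform_top:
  assumes "\<epsilon> > 0" "e > 0"
  shows "\<forall>\<^sub>F K in sequentially. \<forall>t\<in>{\<epsilon><..<1}. wp\<^sup>2 - weight.E S (w t) (int K) < e"
proof -
  \<comment> \<open>The factor \<open>wp + w t k\<close> of the difference of squares is below
    \<open>2 * wp\<close>.\<close>
  have pos: "e / (2 * wp) > 0" using assms wp_pos by simp
  have "uniform_limit {\<epsilon>..<1} (\<lambda>k t. w t k) (\<lambda>_. wp) at_top"
    using cond2 assms by (simp add: condition2_def)
  then have "\<forall>\<^sub>F k in at_top. \<forall>t\<in>{\<epsilon>..<1}. dist (w t k) wp < e / (2 * wp)"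
    using pos by (rule uniform_limitD)
  then have "\<forall>\<^sub>F K in sequentially. \<forall>t\<in>{\<epsilon>..<1}. dist (w t (int K + 0)) wp < e / (2 * wp)"
    using filterlim_int_add by (rule eventually_compose_filterlim)
  then show ?thesis
  proof eventually_elim
    case (elim K)
    show ?case
    proof
      fix t assume t: "t \<in> {\<epsilon><..<1}"
      then have t': "t \<in> {0<..<1}" using assms by auto
      interpret weight S "w t" "lo t" "wp\<^sup>2" by (rule weight_w[OF t'])
      have K: "int K \<in> S" using upward_closed[OF zero_mem] by simp
      have "dist (w t (int K)) wp < e / (2 * wp)" using elim t by auto
      then have d: "wp - w t (int K) < e / (2 * wp)" unfolding dist_real_def by linarith
      have "wp\<^sup>2 - E (int K) = (wp - w t (int K)) * (wp + w t (int K))"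
        using K by (simp add: E_eq power2_eq_square algebra_simps)
      also have "\<dots> \<le> (wp - w t (int K)) * (2 * wp)"
        using w_less_wp[OF t' K] by (intro mult_left_mono) auto
      also have "\<dots> < e" using d wp_pos by (simp add: field_simps)
      finally show "wp\<^sup>2 - E (int K) < e" .
    qed
  qed
qed

lemma E_uniform_bot:
  assumes "\<epsilon> > 0" "e > 0"
  shows "\<forall>\<^sub>F K in sequentially. \<forall>t\<in>{\<epsilon><..<1}. weight.E S (w t) (n - int K) - wm\<^sup>2 < e"
proof (cases "S = UNIV")
  case True
  have pos: "e / (2 * wp) > 0" using assms wp_pos by simp
  have "uniform_limit {\<epsilon>..<1} (\<lambda>k t. w t k) (\<lambda>_. wm) at_bot"
    using cond2 assms True by (simp add: condition2_def)
  then have "\<forall>\<^sub>F k in at_bot. \<forall>t\<in>{\<epsilon>..<1}. dist (w t k) wm < e / (2 * wp)"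
    using pos by (rule uniform_limitD)
  then have "\<forall>\<^sub>F K in sequentially. \<forall>t\<in>{\<epsilon>..<1}. dist (w t (n - int K)) wm < e / (2 * wp)"
    using filterlim_int_diff by (rule eventually_compose_filterlim)
  then show ?thesis
  proof eventually_elim
    case (elim K)
    show ?case
    proof
      fix t assume t: "t \<in> {\<epsilon><..<1}"
      then have t': "t \<in> {0<..<1}" using assms by auto
      interpret weight S "w t" "lo t" "wp\<^sup>2" by (rule weight_w[OF t'])
      have K: "n - int K \<in> S" using True by simp
      have "dist (w t (n - int K)) wm < e / (2 * wp)" using elim t by auto
      then have d: "w t (n - int K) - wm < e / (2 * wp)" unfolding dist_real_def by linarith
      have "E (n - int K) - wm\<^sup>2 = (w t (n - int K) - wm) * (w t (n - int K) + wm)"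
        using K by (simp add: E_eq power2_eq_square algebra_simps)
      also have "\<dots> \<le> (w t (n - int K) - wm) * (2 * wp)"
        using w_less_wp[OF t' K] wm_less_w[OF t' K] by (intro mult_left_mono) auto
      also have "\<dots> < e" using d wp_pos by (simp add: field_simps)
      finally show "E (n - int K) - wm\<^sup>2 < e" .
    qed
  qed
next
  case False
  show ?thesis
    unfolding eventually_sequentially
  \<comment> \<open>From this \<open>K\<close> on the index \<open>n - K\<close> is negative, where
    \<open>E\<close> and \<open>wm\<close> are both 0.\<close>
  proof (intro exI[of _ "nat (n + 1)"] allI impI ballI)
    fix K t assume K: "nat (n + 1) \<le> K" and t: "t \<in> {\<epsilon><..<1}"
    then have t': "t \<in> {0<..<1}" using assms by auto
    interpret weight S "w t" "lo t" "wp\<^sup>2" by (rule weight_w[OF t'])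
    have "n - int K \<notin> S" using False index K by auto
    then show "E (n - int K) - wm\<^sup>2 < e"
      using False assms by (simp add: E_def weight_ext_def wm_zero)
  qed
qed

text \<open>Partial sums are continuous in \<open>t\<close>, and by \<open>pair_tail\<close> they
  converge uniformly on each interval bounded away from 0.\<close>

lemma G_continuous:
  assumes \<phi>: "continuous_on J \<phi>" and n: "0 \<le> n"
  shows "continuous_on {0<..<1} (G n \<phi>)"
proof -
  let ?f = "\<lambda>m t. weight.s S (w t) m * weight.s S (w t) (m + n) * \<phi> (weight.E S (w t) m)"
  obtain B where B: "\<And>u. u \<in> J \<Longrightarrow> \<bar>\<phi> u\<bar> \<le> B" using continuous_bounded_J[OF \<phi>] by blast
  have B0: "0 \<le> B" using B[OF E_J[of "1/2" 0]] by simp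
  have ext: "continuous_on {0<..<1} (\<lambda>t. weight_ext S (w t) k)" for k
    using cond2 by (cases "k \<in> S") (auto simp: weight_ext_def condition2_def)
  have E: "continuous_on {0<..<1} (\<lambda>t. weight.E S (w t) k)" for k
  proof (rule continuous_on_eq)
    show "continuous_on {0<..<1} (\<lambda>t. (weight_ext S (w t) k)\<^sup>2)" by (intro continuous_intros ext)
  qed (simp add: weight.E_def[OF weight_w])
  have s: "continuous_on {0<..<1} (\<lambda>t. weight.s S (w t) k)" for k
  proof (rule continuous_on_eq)
    show "continuous_on {0<..<1} (\<lambda>t. sqrt (weight_diff S (w t) k))"
      unfolding weight_diff_def by (intro continuous_intros ext)
  qed (simp add: weight.s_def[OF weight_w])
  have f: "continuous_on {0<..<1} (?f m)" for m
    by (intro continuous_intros s continuous_on_compose2[OF \<phi> E]) (use E_J in blast)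
  have "continuous_on {\<epsilon><..<1} (\<lambda>t. \<Sum>\<^sub>\<infinity>m. ?f m t)" if \<epsilon>: "\<epsilon> > 0" for \<epsilon>
  proof (rule uniform_limit_theorem)
    show "\<forall>\<^sub>F K in sequentially. continuous_on {\<epsilon><..<1} (\<lambda>t. \<Sum>m\<in>{- int K..int K}. ?f m t)"
      using \<epsilon> by (intro always_eventually allI continuous_intros continuous_on_subset[OF f]) auto
    show "uniform_limit {\<epsilon><..<1} (\<lambda>K t. \<Sum>m\<in>{- int K..int K}. ?f m t) (\<lambda>t. \<Sum>\<^sub>\<infinity>m. ?f m t) sequentially"
    proof (rule uniform_limitI)
      fix e :: real assume e: "e > 0"
      \<comment> \<open>Each of the two ends contributes at most \<open>r * B\<close>; the summand 1
        avoids a zero divisor and makes the last inequality strict.\<close>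
      define r where "r = e / (2 * (B + 1))"
      have r: "r > 0" using e B0 by (simp add: r_def)
      have r_eq: "r * (2 * (B + 1)) = e" using B0 nonzero_eq_divide_eq[of "2 * (B + 1)" r e] r_def by simp
      have "\<forall>\<^sub>F K in sequentially. (\<forall>t\<in>{\<epsilon><..<1}. wp\<^sup>2 - weight.E S (w t) (int K) < r) \<and>
          (\<forall>t\<in>{\<epsilon><..<1}. weight.E S (w t) (n - 1 - int K) - wm\<^sup>2 < r)"
        by (intro eventually_conj E_uniform_top E_uniform_bot \<epsilon> r)
      then show "\<forall>\<^sub>F K in sequentially. \<forall>t\<in>{\<epsilon><..<1}.
          dist (\<Sum>m\<in>{- int K..int K}. ?f m t) (\<Sum>\<^sub>\<infinity>m. ?f m t) < e"
      proof eventually_elim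
        case (elim K)
        show ?case
        proof
          fix t assume t: "t \<in> {\<epsilon><..<1}"
          then have t': "t \<in> {0<..<1}" using \<epsilon> by auto
          have "dist (\<Sum>m\<in>{- int K..int K}. ?f m t) (\<Sum>\<^sub>\<infinity>m. ?f m t) \<le>
              ((wp\<^sup>2 - weight.E S (w t) (int K)) + (weight.E S (w t) (n - 1 - int K) - wm\<^sup>2)) * B"
            unfolding dist_real_def abs_minus_commute[of "sum _ _"]
            by (rule pair_tail[OF t' B[OF E_J[OF t']] n])
          also have "\<dots> \<le> (r + r) * B"
            using elim t B0 by (intro mult_right_mono add_mono) (auto intro: less_imp_le)
          also have "\<dots> < (r + r) * (B + 1)" using r by simp
          also have "\<dots> = e" using r_eq by (simp add: algebra_simps)
          finally show "dist (\<Sum>m\<in>{- int K..int K}. ?f m t) (\<Sum>\<^sub>\<infinity>m. ?f m t) < e" .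
        qed
      qed
    qed
  qed simp
  \<comment> \<open>Continuity is local, so an exhaustion of \<open>{0<..<1}\<close> by open
    intervals replaces uniform convergence up to 0.\<close>
  then have "continuous_on (\<Union>\<epsilon>\<in>{0<..}. {\<epsilon><..<1}) (\<lambda>t. \<Sum>\<^sub>\<infinity>m. ?f m t)"
    by (intro continuous_on_open_UN) auto
  moreover have "(\<Union>\<epsilon>\<in>{0<..}. {\<epsilon><..<1::real}) = {0<..<1}"
  proof safe
    fix x :: real assume "x \<in> {0<..<1}"
    then show "x \<in> (\<Union>\<epsilon>\<in>{0<..}. {\<epsilon><..<1})" by (intro UN_I[of "x / 2"]) auto
  qed auto
  ultimately have "continuous_on {0<..<1} (\<lambda>t. \<Sum>\<^sub>\<infinity>m. ?f m t)" by simp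
  then show ?thesis by (rule continuous_on_eq) (simp add: G_eq)
qed

lemma G_tendsto:
  assumes \<phi>: "continuous_on J \<phi>"
  shows "(G (int n) \<phi> \<longlongrightarrow> integral J \<phi>) (at_right 0)"
proof (rule tendstoI)
  fix e :: real assume e: "e > 0"
  obtain B where B: "\<And>u. u \<in> J \<Longrightarrow> \<bar>\<phi> u\<bar> \<le> B" using continuous_bounded_J[OF \<phi>] by blast
  define L where "L = wp\<^sup>2 - wm\<^sup>2"
  have L: "L \<ge> 0" using E_J[of "1/2" 0] by (simp add: L_def)
  \<comment> \<open>\<open>L\<close> is the length of \<open>J\<close>, so that oscillation
    \<open>\<eta>\<close> on each cell costs at most \<open>e / 2\<close> in total.\<close>
  define \<eta> where "\<eta> = e / (2 * (L + 1))"
  have \<eta>: "\<eta> > 0" using e L by (simp add: \<eta>_def)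
  have "uniformly_continuous_on J \<phi>" using \<phi> by (intro compact_uniformly_continuous) auto
  then obtain \<delta> where \<delta>: "\<delta> > 0" "\<And>x y. x \<in> J \<Longrightarrow> y \<in> J \<Longrightarrow> \<bar>x - y\<bar> < \<delta> \<Longrightarrow> \<bar>\<phi> x - \<phi> y\<bar> < \<eta>"
    unfolding uniformly_continuous_on_def dist_real_def using \<eta> by (metis abs_minus_commute)
  \<comment> \<open>The other half of \<open>e\<close>: the bound of \<open>pair_diag_diff\<close>
    with \<open>h = h2 S w t\<close>, which is continuous in \<open>h\<close> and 0 at
    \<open>h = 0\<close>.\<close>
  have "((\<lambda>t. ((1 + h2 S w t) ^ n - 1) * B * L) \<longlongrightarrow> ((1 + 0) ^ n - 1) * B * L) (at_right 0)"
    using cond4 by (intro tendsto_intros) (auto simp: condition4_def)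
  then have "\<forall>\<^sub>F t in at_right 0. ((1 + h2 S w t) ^ n - 1) * B * L < e / 2"
    using e by (intro order_tendstoD(2)) auto
  \<comment> \<open>\<open>h1\<close> bounds the mesh of the Riemann sum; halving
    \<open>\<delta>\<close> leaves room for the strict inequality in uniform continuity.\<close>
  moreover have "\<forall>\<^sub>F t in at_right 0. h1 S w t < \<delta> / 2"
    using cond3 \<delta>(1) unfolding condition3_def by (intro order_tendstoD(2)) auto
  moreover have "\<forall>\<^sub>F t in at_right 0. t \<in> {0<..<1::real}"
    by (rule eventually_at_right_real) simp
  ultimately show "\<forall>\<^sub>F t in at_right 0. dist (G (int n) \<phi> t) (integral J \<phi>) < e"
  proof eventually_elim
    case (elim t)
    then have t: "t \<in> {0<..<1}" by simp
    interpret weight S "w t" "lo t" "wp\<^sup>2" by (rule weight_w[OF t])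
    let ?Sd = "weight_diff S (w t)"
    have bdd: "bdd_above (?Sd ` S)"
      using sum_weight_diff_le[of "{_}"] by (auto simp: bdd_above_def)
    have mesh: "?Sd k \<le> \<delta> / 2" for k
    proof (cases "k \<in> S")
      case True
      then show ?thesis using cSUP_upper[OF True bdd] elim(2) by (simp add: h1_def)
    qed (use \<delta> in \<open>simp add: weight_diff_outside\<close>)
    have ratio: "\<bar>1 - ?Sd (k + 1) / ?Sd k\<bar> \<le> h2 S w t" if "k \<in> S" for k
      unfolding h2_def using cond4 t by (intro cSUP_upper[OF that]) (auto simp: condition4_def)
    have "\<bar>(\<Sum>\<^sub>\<infinity>m. s m * s (m + int n) * \<phi> (E m)) - (\<Sum>\<^sub>\<infinity>m. ?Sd m * \<phi> (E m))\<bar> \<le>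
        ((1 + h2 S w t) ^ n - 1) * B * L"
      unfolding L_def by (rule pair_diag_diff[OF t ratio B[OF E_J[OF t]]])
    moreover have "\<bar>(\<Sum>\<^sub>\<infinity>m. ?Sd m * \<phi> (E m)) - integral J \<phi>\<bar> \<le> \<eta> * L"
      unfolding L_def
    proof (rule Riemann_sum_error[OF t \<phi> B mesh])
      fix x y assume "x \<in> J" "y \<in> J" "\<bar>x - y\<bar> \<le> \<delta> / 2"
      then show "\<bar>\<phi> x - \<phi> y\<bar> \<le> \<eta>" using \<delta> by (intro less_imp_le \<delta>(2)) auto
    qed
    moreover have "\<eta> * L \<le> e / 2"
    proof -
      have "\<eta> * L \<le> \<eta> * (L + 1)" using \<eta> by simp
      also have "\<dots> = e / 2" using L by (simp add: \<eta>_def field_simps)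
      finally show ?thesis .
    qed
    ultimately show ?case using elim(1) by (simp add: G_eq[OF t] dist_real_def)
  qed
qed

end

section \<open>The continuous field\<close>

sublocale weight_family \<subseteq> N: annulus wm wp
proof
  show "0 \<le> wm" by (rule wm_nonneg)
  \<comment> \<open>At any parameter value every weight lies strictly between the two limits;
    \<open>1/2\<close> is an arbitrary choice.\<close>
  show "wm < wp" using wm_less_w[of "1/2" 0] w_less_wp[of "1/2" 0] index by auto
qed

context weight_family
begin

section \<open>Sections described by their diagonal coefficients\<close>

definition admissible :: "nat \<Rightarrow> (int \<Rightarrow> real \<Rightarrow> complex) \<Rightarrow> bool" where
  "admissible N c \<longleftrightarrow> (\<forall>d. continuous_on J (c d)) \<and> (\<forall>d. int N < \<bar>d\<bar> \<longrightarrow> c d = (\<lambda>_. 0))"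

text \<open>The same coefficients are Fourier coefficients in the classical fibre and diagonals of
  the matrix in the others, so that linear operations act on coefficients and norms split by
  diagonals.\<close>

definition poly_section :: "nat \<Rightarrow> (int \<Rightarrow> real \<Rightarrow> complex) \<Rightarrow> real \<Rightarrow> fibre_vec" where
  "poly_section N c = (\<lambda>t\<in>{0..<1}. if t = 0 then Inl (ae_class N.D (N.trig_poly N c))
     else Inr (embed (quantum_pre S (w t)) (weight.qop S (w t) N c)))"

lemma poly_section_extensional: "poly_section N c \<in> extensional {0..<1}"
  by (simp add: poly_section_def)

lemma admissible_cont: "admissible N c \<Longrightarrow> continuous_on J (c d)"
  and admissible_supp: "admissible N c \<Longrightarrow> int N < \<bar>d\<bar> \<Longrightarrow> c d = (\<lambda>_. 0)"
  by (simp_all add: admissible_def)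

lemma admissible_mono: "admissible N c \<Longrightarrow> N \<le> M \<Longrightarrow> admissible M c"
  by (simp add: admissible_def)

lemma poly_section_mono:
  assumes "admissible N c" "N \<le> M"
  shows "poly_section M c = poly_section N c"
proof -
  have "N.trig_poly M c = N.trig_poly N c"
    by (rule ext) (rule N.trig_poly_mono[OF assms(2) admissible_supp[OF assms(1)]])
  moreover have "weight.qop S (w t) M c = weight.qop S (w t) N c" if "t \<in> {0<..<1}" for t
    by (rule weight.qop_mono[OF weight_w[OF that] assms(2) admissible_supp[OF assms(1)]])
  ultimately show ?thesis unfolding poly_section_def by (intro restrict_ext) auto
qed

lemma classical_poly_eq:
  "classical_poly N f g = N.trig_poly N (\<lambda>d. if d \<ge> 0 then f (nat d) else g (nat (- d)))"
proof
  fix z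
  have "(\<Sum>n=1..N. g n ((cmod z)\<^sup>2) * cis (- real n * Arg z)) =
      (\<Sum>n=1..N. (if - int n \<ge> 0 then f (nat (- int n)) else g (nat (- (- int n)))) ((cmod z)\<^sup>2) * ang (- int n) z)"
    by (intro sum.cong) (auto simp: ang_def)
  then show "classical_poly N f g z = N.trig_poly N (\<lambda>d. if d \<ge> 0 then f (nat d) else g (nat (- d))) z"
    unfolding classical_poly_def N.trig_poly_def sum_int_split by (simp add: ang_def)
qed

lemma Lambda_sections_eq: "Lambda_sections S w wm wp = {poly_section N c | N c. admissible N c}"
proof safe
  fix x assume "x \<in> Lambda_sections S w wm wp"
  then obtain N f g where f: "\<And>n. n \<le> N \<Longrightarrow> continuous_on J (f n)"
    and g: "\<And>n. 1 \<le> n \<Longrightarrow> n \<le> N \<Longrightarrow> continuous_on J (g n)"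
    and x: "x = (\<lambda>t\<in>{0..<1}. if t = 0 then Inl (ae_class N.D (classical_poly N f g))
      else Inr (embed (quantum_pre S (w t)) (quantum_poly S (w t) N f g)))"
    unfolding Lambda_sections_def by (simp add: Ball_def) blast
  let ?c = "\<lambda>d. if d \<ge> 0 then f (nat d) else g (nat (- d))"
  \<comment> \<open>Beyond \<open>N\<close> the given functions are arbitrary and possibly
    discontinuous; they are replaced by 0.\<close>
  define c where "c d = (if \<bar>d\<bar> \<le> int N then ?c d else (\<lambda>_. 0))" for d
  have "admissible N c"
    unfolding admissible_def c_def using f g by auto
  moreover have "x = poly_section N c"
  proof -
    have "N.trig_poly N ?c = N.trig_poly N c"
      unfolding N.trig_poly_def c_def by (intro ext sum.cong refl) (simp add: abs_le_iff)
    moreover have "quantum_poly S (w t) N f g = weight.qop S (w t) N c" if t: "t \<in> {0<..<1}" for t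
    proof -
      interpret weight S "w t" "lo t" "wp\<^sup>2" by (rule weight_w[OF t])
      have "quantum_poly S (w t) N f g = qop N ?c"
        by (rule quantum_poly_eq) (rule continuous_on_subset[OF f lo_J[OF t]])
      also have "\<dots> = qop N c" by (rule qop_cong) (simp add: c_def)
      finally show ?thesis .
    qed
    ultimately show ?thesis
      unfolding x poly_section_def classical_poly_eq by (intro restrict_ext) auto
  qed
  ultimately show "\<exists>N c. x = poly_section N c \<and> admissible N c" by blast
next
  fix N c assume c: "admissible N c"
  let ?f = "\<lambda>n. c (int n)" and ?g = "\<lambda>n. c (- int n)"
  have eq: "(\<lambda>d. if d \<ge> 0 then ?f (nat d) else ?g (nat (- d))) = c" by auto
  \<comment> \<open>The definition of the space of sections asks for a positive degree.\<close>
  have "poly_section N c = poly_section (Suc N) c" by (rule poly_section_mono[symmetric, OF c]) simp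
  also have "\<dots> = (\<lambda>t\<in>{0..<1}. if t = 0 then Inl (ae_class N.D (classical_poly (Suc N) ?f ?g))
      else Inr (embed (quantum_pre S (w t)) (quantum_poly S (w t) (Suc N) ?f ?g)))"
    unfolding poly_section_def classical_poly_eq eq
  proof (intro restrict_ext if_cong refl arg_cong[of _ _ Inr] arg_cong2[of _ _ _ _ embed])
    fix t :: real assume "t \<in> {0..<1}" "t \<noteq> 0"
    then have t: "t \<in> {0<..<1}" by auto
    interpret weight S "w t" "lo t" "wp\<^sup>2" by (rule weight_w[OF t])
    show "qop (Suc N) c = quantum_poly S (w t) (Suc N) ?f ?g"
      by (subst quantum_poly_eq) (auto simp: eq intro: continuous_on_subset[OF admissible_cont[OF c] lo_J[OF t]])
  qed
  finally show "poly_section N c \<in> Lambda_sections S w wm wp"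
    unfolding Lambda_sections_def using admissible_cont[OF c]
    by (intro CollectI exI[of _ "Suc N"] exI[of _ ?f] exI[of _ ?g]) simp
qed

section \<open>Linear structure, density and norms in the fibres\<close>

abbreviation H :: "real \<Rightarrow> fibre_vec cspace" where "H \<equiv> fibre S w wm wp"

lemma fibre_zero: "H 0 = transport Inl (L2 N.D)"
  and fibre_pos: "t \<noteq> 0 \<Longrightarrow> H t = transport Inr (hcompletion (quantum_pre S (w t)))"
  by (simp_all add: fibre_def)

lemma interval_cases:
  assumes "t \<in> {0..<1::real}"
  obtains "t = 0" | "t \<in> {0<..<1}"
  using assms by fastforce

lemma hilbert_fibre:
  assumes "t \<in> {0..<1}" shows "hilbert_space (H t)"
  using assms
proof (cases rule: interval_cases)
  case 1
  then show ?thesis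
    by (simp add: fibre_zero hilbert_space_transport hilbert_space_L2 N.finite_measure_D)
next
  case 2
  interpret weight S "w t" "lo t" "wp\<^sup>2" by (rule weight_w[OF 2])
  show ?thesis
    using 2 pre_hilbert.hilbert_space_completion[OF pre_hilbert_quantum]
    by (simp add: fibre_pos hilbert_space_transport)
qed

lemma trig_poly_square: "admissible N c \<Longrightarrow> square_integrable N.D (N.trig_poly N c)"
  by (rule N.trig_poly_square_integrable) (rule admissible_cont)

lemma trig_poly_vecs: "admissible N c \<Longrightarrow> ae_class N.D (N.trig_poly N c) \<in> vecs (L2 N.D)"
  by (simp add: L2_vecs trig_poly_square)

lemma trig_poly_measurable: "admissible N c \<Longrightarrow> N.trig_poly N c \<in> borel_measurable N.D"
  by (rule square_integrable_measurable[OF trig_poly_square])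

lemma qop_vecs:
  assumes "admissible N c" "t \<in> {0<..<1}"
  shows "weight.qop S (w t) N c \<in> vecs (quantum_pre S (w t))"
proof -
  interpret weight S "w t" "lo t" "wp\<^sup>2" by (rule weight_w[OF assms(2)])
  show ?thesis
    unfolding quantum_vecs
    by (intro qop_in_alg continuous_on_subset[OF admissible_cont[OF assms(1)] lo_J[OF assms(2)]])
qed

lemma quantum_pre_hilbert: "t \<in> {0<..<1} \<Longrightarrow> pre_hilbert (quantum_pre S (w t))"
  by (rule weight.pre_hilbert_quantum[OF weight_w])

lemma poly_section_vecs:
  assumes c: "admissible N c" and t: "t \<in> {0..<1}"
  shows "poly_section N c t \<in> vecs (H t)"
  using t
proof (cases rule: interval_cases)
  case 1
  then show ?thesis by (simp add: poly_section_def fibre_zero transport_vecs trig_poly_vecs[OF c])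
next
  case 2
  then show ?thesis
    by (simp add: poly_section_def fibre_pos transport_vecs pre_hilbert.embed_closed quantum_pre_hilbert
        qop_vecs[OF c])
qed

lemma poly_section_add:
  assumes c: "admissible N c" "admissible N c'" and t: "t \<in> {0..<1}"
  shows "vadd (H t) (poly_section N c t) (poly_section N c' t) = poly_section N (\<lambda>d u. c d u + c' d u) t"
  using t
proof (cases rule: interval_cases)
  case 1
  have "(\<lambda>z. N.trig_poly N c z + N.trig_poly N c' z) = N.trig_poly N (\<lambda>d u. c d u + c' d u)"
    by (auto simp: N.trig_poly_def sum.distrib distrib_right)
  then show ?thesis
    using 1 c by (simp add: poly_section_def fibre_zero transport_add trig_poly_vecs L2_add trig_poly_measurable)
next
  case 2
  interpret weight S "w t" "lo t" "wp\<^sup>2" by (rule weight_w[OF 2])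
  interpret Q: pre_hilbert "quantum_pre S (w t)" by (rule pre_hilbert_quantum)
  show ?thesis
    using 2 qop_vecs[OF c(1) 2] qop_vecs[OF c(2) 2]
    by (simp add: poly_section_def fibre_pos transport_add Q.embed_closed Q.embed_add quantum_add qop_add)
qed

lemma poly_section_scale:
  assumes c: "admissible N c" and t: "t \<in> {0..<1}"
  shows "vscale (H t) a (poly_section N c t) = poly_section N (\<lambda>d u. a * c d u) t"
  using t
proof (cases rule: interval_cases)
  case 1
  have "(\<lambda>z. a * N.trig_poly N c z) = N.trig_poly N (\<lambda>d u. a * c d u)"
    by (auto simp: N.trig_poly_def sum_distrib_left mult.assoc)
  then show ?thesis
    using 1 c by (simp add: poly_section_def fibre_zero transport_scale trig_poly_vecs L2_scale trig_poly_measurable)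
next
  case 2
  interpret weight S "w t" "lo t" "wp\<^sup>2" by (rule weight_w[OF 2])
  interpret Q: pre_hilbert "quantum_pre S (w t)" by (rule pre_hilbert_quantum)
  show ?thesis
    using 2 qop_vecs[OF c 2]
    by (simp add: poly_section_def fibre_pos transport_scale Q.embed_closed Q.embed_scale quantum_scale qop_scale)
qed

lemma poly_section_zero: "poly_section 0 (\<lambda>_ _. 0) = (\<lambda>t\<in>{0..<1}. vzero (H t))"
  unfolding poly_section_def
proof (rule restrict_ext)
  fix t :: real assume "t \<in> {0..<1}"
  then show "(if t = 0 then Inl (ae_class N.D (N.trig_poly 0 (\<lambda>_ _. 0)))
      else Inr (embed (quantum_pre S (w t)) (weight.qop S (w t) 0 (\<lambda>_ _. 0)))) = vzero (H t)"
  proof (cases rule: interval_cases)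
    case 1
    then show ?thesis by (simp add: fibre_zero transport_zero L2_zero N.trig_poly_def[abs_def])
  next
    case 2
    interpret weight S "w t" "lo t" "wp\<^sup>2" by (rule weight_w[OF 2])
    interpret Q: pre_hilbert "quantum_pre S (w t)" by (rule pre_hilbert_quantum)
    show ?thesis
      using 2 by (simp add: fibre_pos transport_zero Q.embed_zero quantum_zero qop_zero)
  qed
qed

abbreviation I :: "real topology" where "I \<equiv> top_of_set {0..<1}"
abbreviation \<Lambda> :: "(real \<Rightarrow> fibre_vec) set" where "\<Lambda> \<equiv> Lambda_sections S w wm wp"

lemma Lambda_subspace: "section_subspace I H \<Lambda>"
  unfolding section_subspace_def Lambda_sections_eq
proof (intro conjI ballI allI)
  show "{poly_section N c |N c. admissible N c} \<subseteq> (\<Pi>\<^sub>E t\<in>topspace I. vecs (H t))"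
    using poly_section_vecs by (auto simp: poly_section_def)
  have zero: "admissible 0 (\<lambda>_ _. 0)" by (simp add: admissible_def)
  have "(\<lambda>t\<in>topspace I. vzero (H t)) = poly_section 0 (\<lambda>_ _. 0)"
    by (simp only: poly_section_zero topspace_euclidean_subtopology)
  with zero show "(\<lambda>t\<in>topspace I. vzero (H t)) \<in> {poly_section N c |N c. admissible N c}"
    by (metis (mono_tags, lifting) mem_Collect_eq)
next
  fix x y assume "x \<in> {poly_section N c |N c. admissible N c}" "y \<in> {poly_section N c |N c. admissible N c}"
  then obtain N c M d where x: "x = poly_section N c" "admissible N c"
    and y: "y = poly_section M d" "admissible M d" by blast
  let ?K = "max N M"
  have ad: "admissible ?K c" "admissible ?K d"
    by (rule admissible_mono[OF x(2)], simp) (rule admissible_mono[OF y(2)], simp)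
  have mono: "poly_section ?K c = x" "poly_section ?K d = y"
    unfolding x(1) y(1)
    by (rule poly_section_mono[OF x(2)], simp) (rule poly_section_mono[OF y(2)], simp)
  have "(\<lambda>t\<in>topspace I. vadd (H t) (x t) (y t)) = poly_section ?K (\<lambda>n u. c n u + d n u)"
  proof (rule extensionalityI[OF _ poly_section_extensional])
    fix t :: real assume "t \<in> {0..<1}"
    then show "(\<lambda>t\<in>topspace I. vadd (H t) (x t) (y t)) t = poly_section ?K (\<lambda>n u. c n u + d n u) t"
      using poly_section_add[OF ad] by (simp add: mono)
  qed simp
  moreover have "admissible ?K (\<lambda>n u. c n u + d n u)"
    using ad by (auto simp: admissible_def intro!: continuous_intros)
  ultimately show "(\<lambda>t\<in>topspace I. vadd (H t) (x t) (y t)) \<in> {poly_section N c |N c. admissible N c}" by blast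
next
  fix a x assume "x \<in> {poly_section N c |N c. admissible N c}"
  then obtain N c where x: "x = poly_section N c" "admissible N c" by blast
  have "(\<lambda>t\<in>topspace I. vscale (H t) a (x t)) = poly_section N (\<lambda>n u. a * c n u)"
    unfolding x(1)
    by (rule extensionalityI[OF _ poly_section_extensional])
      (simp_all add: poly_section_scale[OF x(2)])
  moreover have "admissible N (\<lambda>n u. a * c n u)"
    using x by (auto simp: admissible_def intro!: continuous_intros)
  ultimately show "(\<lambda>t\<in>topspace I. vscale (H t) a (x t)) \<in> {poly_section N c |N c. admissible N c}" by blast
qed

text \<open>One fibre is considered at a time, so the coefficients may depend on \<open>t\<close>.
  They must still be continuous on all of \<open>J\<close>, not only on the spectrum in that fibre;
  the bump functions are continuous on the whole line.\<close>

lemma Lambda_dense: "fibrewise_dense I H \<Lambda>"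
  unfolding fibrewise_dense_def
proof (intro ballI allI impI)
  fix t v and \<epsilon> :: real assume t: "t \<in> topspace I" and v: "v \<in> vecs (H t)" and \<epsilon>: "\<epsilon> > 0"
  have "\<exists>N c. admissible N c \<and> vdist (H t) (poly_section N c t) v < \<epsilon>"
    using t[simplified topspace_euclidean_subtopology]
  proof (cases rule: interval_cases)
    case 1
    then obtain f where f: "v = Inl (ae_class N.D f)" "square_integrable N.D f"
      using v by (auto simp: fibre_zero transport_vecs L2_vecs)
    obtain N c where c: "\<And>d. continuous_on J (c d)" "\<And>d. int N < \<bar>d\<bar> \<Longrightarrow> c d = (\<lambda>_. 0)"
      "sqrt (\<integral>z. (cmod (N.trig_poly N c z - f z))\<^sup>2 \<partial>N.D) < \<epsilon>"
      using N.trig_dense[OF f(2) \<epsilon>] by blast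
    then have ad: "admissible N c" by (simp add: admissible_def)
    have "ae_class N.D f \<in> vecs (L2 N.D)" using f(2) by (simp add: L2_vecs)
    then have "vdist (H t) (poly_section N c t) v < \<epsilon>"
      using 1 c(3) trig_poly_vecs[OF ad] trig_poly_measurable[OF ad] square_integrable_measurable[OF f(2)]
      by (simp add: f fibre_zero poly_section_def transport_dist pre_hilbert_L2 L2_dist)
    then show ?thesis using ad by blast
  next
    case 2
    interpret weight S "w t" "lo t" "wp\<^sup>2" by (rule weight_w[OF 2])
    interpret Q: pre_hilbert "quantum_pre S (w t)" by (rule pre_hilbert_quantum)
    interpret C: pre_hilbert "hcompletion (quantum_pre S (w t))" by (rule Q.pre_hilbert_completion)
    obtain u where u: "v = Inr u" "u \<in> vecs (hcompletion (quantum_pre S (w t)))"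
      using 2 v by (auto simp: fibre_pos transport_vecs)
    have half: "\<epsilon> / 2 > 0" using \<epsilon> by simp
    obtain a where a: "a \<in> vecs (quantum_pre S (w t))"
      "vdist (hcompletion (quantum_pre S (w t))) (embed (quantum_pre S (w t)) a) u < \<epsilon> / 2"
      using Q.embed_dense[OF u(2) half] by blast
    obtain N c where c: "\<And>d. continuous_on UNIV (c d)" "\<And>d. int N < \<bar>d\<bar> \<Longrightarrow> c d = (\<lambda>_. 0)"
      "vdist (quantum_pre S (w t)) (qop N c) a < \<epsilon> / 2"
      using quantum_dense[OF a(1)[unfolded quantum_vecs] half] by blast
    have ad: "admissible N c"
      unfolding admissible_def using c(1,2) continuous_on_subset[OF c(1) subset_UNIV] by blast
    note q = qop_vecs[OF ad 2]
    have "vdist (hcompletion (quantum_pre S (w t))) (embed (quantum_pre S (w t)) (qop N c)) u < \<epsilon>"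
      using C.dist_triangle[OF Q.embed_closed[OF q] Q.embed_closed[OF a(1)] u(2)] a(2) c(3)
      by (simp add: Q.embed_dist q a(1))
    then have "vdist (H t) (poly_section N c t) v < \<epsilon>"
      using 2 by (simp add: u fibre_pos poly_section_def transport_dist C.pre_hilbert_axioms Q.embed_closed[OF q])
    then show ?thesis using ad by blast
  qed
  then show "\<exists>x\<in>\<Lambda>. vdist (H t) (x t) v < \<epsilon>" unfolding Lambda_sections_eq by blast
qed

text \<open>In both kinds of fibre the squared norm is a finite sum over the same diagonals, so that
  continuity is a statement about one diagonal at a time.\<close>

lemma Lambda_norm_continuous: "norm_continuous I H \<Lambda>"
  unfolding norm_continuous_def Lambda_sections_eq
proof safe
  fix N c assume c: "admissible N c"
  let ?\<phi> = "\<lambda>d u. (cmod (c d u))\<^sup>2"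
  let ?F = "\<lambda>t. sqrt (\<Sum>d\<in>{- int N..int N}. G \<bar>d\<bar> (?\<phi> d) t)"
  have \<phi>: "continuous_on J (?\<phi> d)" for d by (intro continuous_intros admissible_cont[OF c])
  have pos: "vnorm (H t) (poly_section N c t) = ?F t" if t: "t \<in> {0<..<1}" for t
  proof -
    interpret weight S "w t" "lo t" "wp\<^sup>2" by (rule weight_w[OF t])
    interpret Q: pre_hilbert "quantum_pre S (w t)" by (rule pre_hilbert_quantum)
    have "vnorm (H t) (poly_section N c t) = vnorm (quantum_pre S (w t)) (qop N c)"
      using t qop_vecs[OF c t]
      by (simp add: fibre_pos poly_section_def transport_norm Q.embed_closed Q.embed_norm)
    also have "\<dots> = ?F t"
      unfolding G_def
      by (rule qop_norm[OF continuous_on_subset[OF admissible_cont[OF c] lo_J[OF t]] admissible_supp[OF c]])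
    finally show ?thesis .
  qed
  have zero: "vnorm (H 0) (poly_section N c 0) = sqrt (\<Sum>d\<in>{- int N..int N}. integral J (?\<phi> d))"
    using trig_poly_vecs[OF c] trig_poly_measurable[OF c]
    by (simp add: fibre_zero poly_section_def transport_norm L2_norm
        N.integral_trig_poly[OF admissible_cont[OF c]])
  have "continuous_on {0..<1} (\<lambda>t. vnorm (H t) (poly_section N c t))"
    unfolding continuous_on_eq_continuous_within
  proof
    fix t :: real assume "t \<in> {0..<1}"
    then show "continuous (at t within {0..<1}) (\<lambda>t. vnorm (H t) (poly_section N c t))"
    proof (cases rule: interval_cases)
      case 1
      have "(?F \<longlongrightarrow> sqrt (\<Sum>d\<in>{- int N..int N}. integral J (?\<phi> d))) (at_right 0)"
        using G_tendsto[OF \<phi>, of "nat \<bar>_\<bar>"] by (intro tendsto_real_sqrt tendsto_sum) simp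
      then have "((\<lambda>t. vnorm (H t) (poly_section N c t)) \<longlongrightarrow> vnorm (H 0) (poly_section N c 0)) (at_right 0)"
        unfolding zero
      proof (rule Lim_transform_eventually)
        show "\<forall>\<^sub>F t in at_right 0. ?F t = vnorm (H t) (poly_section N c t)"
          using eventually_at_right_real[OF zero_less_one] by eventually_elim (simp add: pos)
      qed
      \<comment> \<open>0 is an end point of the base, so that the limit from the right is the limit
        within the base.\<close>
      then have "((\<lambda>t. vnorm (H t) (poly_section N c t)) \<longlongrightarrow> vnorm (H 0) (poly_section N c 0)) (at 0 within {0..1})"
        by (simp add: at_within_Icc_at_right)
      then show ?thesis
        unfolding 1 continuous_within by (rule tendsto_within_subset) auto
    next
      case 2
      have "continuous_on {0<..<1} ?F" by (intro continuous_intros G_continuous \<phi>) simp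
      then have "continuous_on {0<..<1} (\<lambda>t. vnorm (H t) (poly_section N c t))"
        by (rule continuous_on_eq) (simp add: pos)
      then have "continuous (at t) (\<lambda>t. vnorm (H t) (poly_section N c t))"
        using 2 by (simp add: continuous_on_eq_continuous_at)
      then show ?thesis by (rule continuous_at_imp_continuous_at_within)
    qed
  qed
  then show "continuous_map I euclideanreal (\<lambda>t. vnorm (H t) (poly_section N c t))" by simp
qed

end

lemma locally_compact_space_Ico: "locally_compact_space (top_of_set {0..<1::real})"
  unfolding locally_compact_space_def
proof
  fix x :: real assume "x \<in> topspace (top_of_set {0..<1})"
  then have x: "0 \<le> x" "x < 1" by auto
  show "\<exists>U K. openin (top_of_set {0..<1}) U \<and> compactin (top_of_set {0..<1}) K \<and> x \<in> U \<and> U \<subseteq> K"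
  proof (intro exI conjI)
    show "openin (top_of_set {0..<1}) ({0..<1} \<inter> {..<(x + 1) / 2})" by (intro openin_open_Int) auto
    show "compactin (top_of_set {0..<1}) {0..(x + 1) / 2}"
      using x by (auto simp: compactin_subtopology)
  qed (use x in auto)
qed

theorem theorem3p1:
  fixes S :: "int set"
    and w :: "real \<Rightarrow> int \<Rightarrow> real"
    and wm wp :: real
  assumes "S = {0..} \<or> S = UNIV"
    and "condition1 S w wm wp"
    and "condition2 S w wm wp"
    and "condition3 S w"
    and "condition4 S w"
    and "condition5 S w"
  defines "I \<equiv> top_of_set {0..<1::real}"
    and "H \<equiv> fibre S w wm wp"
    and "\<Lambda> \<equiv> Lambda_sections S w wm wp"
  shows "section_subspace I H \<Lambda> \<and>
         fibrewise_dense I H \<Lambda> \<and>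
         norm_continuous I H \<Lambda> \<and>
         (\<exists>!\<Gamma>. \<Lambda> \<subseteq> \<Gamma> \<and> continuous_field I H \<Gamma>)"
proof -
  interpret weight_family S w wm wp
    by unfold_locales (use assms(1-5) in auto)
  have "\<exists>!\<Gamma>. \<Lambda> \<subseteq> \<Gamma> \<and> continuous_field I H \<Gamma>"
    unfolding I_def H_def \<Lambda>_def
    by (intro generating_subspace_extends_uniquely locally_compact_space_Ico hilbert_fibre
        Lambda_subspace Lambda_dense Lambda_norm_continuous) simp
  then show ?thesis
    unfolding I_def H_def \<Lambda>_def using Lambda_subspace Lambda_dense Lambda_norm_continuous by blast
qed

end
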